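(* Let $B$ be a ring, and let $A$ be the ring $B[x,y,z]/(x,y,z)^2$, which has rank $4$ over $B$. Then $G(A/B)$ is free of rank $32$ over $B$.
   Context: All rings are commutative with unity. Let $A$ be a $B$-algebra that is free of rank $n$ as a $B$-module (here $n=4$). For $a\in A$ let $P_a(x)=x^n-s_1(a)x^{n-1}+s_2(a)x^{n-2}-\cdots+(-1)^n s_n(a)$ be the characteristic polynomial of the $B$-linear map $A\to A$ given by multiplication by $a$; this defines $s_j(a)\in B$ for $1\le j\le n$. All tensor powers are over $B$. For $a\in A$ and $1\le i\le n$ let $a^{(i)}=1\otimes\cdots\otimes a\otimes\cdots\otimes 1\in A^{\otimes n}$, with $a$ in the $i$-th tensor factor. Let $I(A,B)\subset A^{\otimes n}$ be the ideal generated by all elements $$s_j(a)-\sum_{1\le i_1<\cdots<i_j\le n}a^{(i_1)}a^{(i_2)}\cdots a^{(i_j)},\qquad a\in A,\ 1\le j\le n.$$ The $S_n$-closure of $A$ over $B$ is the $B$-algebra $G(A/B)=A^{\otimes n}/I(A,B)$. *)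

theory Defs
  imports "HOL-Algebra.UnivPoly" "HOL-Algebra.QuotRing" "HOL-Algebra.Ideal_Product" "HOL-Algebra.Product_Groups"
    "HOL-Combinatorics.Permutations" "HOL-Library.Multiset"
begin

section \<open>Free modules of finite rank\<close>

definition is_basis :: "('b, 'm) ring_scheme \<Rightarrow> ('b, 'a, 'k) module_scheme \<Rightarrow> nat \<Rightarrow> (nat \<Rightarrow> 'a) \<Rightarrow> bool"
  where "is_basis B M n e \<longleftrightarrow>
    e \<in> {..<n} \<rightarrow> carrier M \<and>
    (\<forall>v\<in>carrier M. \<exists>!c. c \<in> {..<n} \<rightarrow>\<^sub>E carrier B \<and> v = (\<Oplus>\<^bsub>M\<^esub>i\<in>{..<n}. c i \<odot>\<^bsub>M\<^esub> e i))"

text \<open>A basis is an indexed family, not a set, so that over the zero ring the zero module is free of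
  every rank.\<close>

definition free_of_rank :: "('b, 'm) ring_scheme \<Rightarrow> ('b, 'a, 'k) module_scheme \<Rightarrow> nat \<Rightarrow> bool"
  where "free_of_rank B M n \<longleftrightarrow> module B M \<and> (\<exists>e. is_basis B M n e)"

definition coords ::
    "('b, 'm) ring_scheme \<Rightarrow> ('b, 'a, 'k) module_scheme \<Rightarrow> nat \<Rightarrow> (nat \<Rightarrow> 'a) \<Rightarrow> 'a \<Rightarrow> nat \<Rightarrow> 'b"
  where "coords B M n e v =
    (THE c. c \<in> {..<n} \<rightarrow>\<^sub>E carrier B \<and> v = (\<Oplus>\<^bsub>M\<^esub>i\<in>{..<n}. c i \<odot>\<^bsub>M\<^esub> e i))"


section \<open>Characteristic polynomials\<close>

definition ring_det :: "('r, 'm) ring_scheme \<Rightarrow> nat \<Rightarrow> (nat \<Rightarrow> nat \<Rightarrow> 'r) \<Rightarrow> 'r"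
  where "ring_det R n M =
    (\<Oplus>\<^bsub>R\<^esub>p\<in>{p. p permutes {..<n}}.
      (if evenperm p then \<one>\<^bsub>R\<^esub> else \<ominus>\<^bsub>R\<^esub> \<one>\<^bsub>R\<^esub>) \<otimes>\<^bsub>R\<^esub> (\<Otimes>\<^bsub>R\<^esub>i\<in>{..<n}. M i (p i)))"

definition char_poly :: "('b, 'm) ring_scheme \<Rightarrow> nat \<Rightarrow> (nat \<Rightarrow> nat \<Rightarrow> 'b) \<Rightarrow> nat \<Rightarrow> 'b"
  where "char_poly B n M =
    ring_det (UP B) n (\<lambda>i j.
      (if i = j then monom (UP B) \<one>\<^bsub>B\<^esub> 1 else \<zero>\<^bsub>UP B\<^esub>) \<ominus>\<^bsub>UP B\<^esub> monom (UP B) (M i j) 0)"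

definition mult_matrix ::
    "('b, 'm) ring_scheme \<Rightarrow> ('b, 'a, 'k) module_scheme \<Rightarrow> nat \<Rightarrow> (nat \<Rightarrow> 'a) \<Rightarrow> 'a \<Rightarrow> nat \<Rightarrow> nat \<Rightarrow> 'b"
  where "mult_matrix B A n e a i j = coords B A n e (a \<otimes>\<^bsub>A\<^esub> e j) i"

text \<open>The characteristic polynomial of multiplication by \<open>a\<close>; it does not depend on the basis chosen
  for the matrix.\<close>

definition mult_char_poly ::
    "('b, 'm) ring_scheme \<Rightarrow> ('b, 'a, 'k) module_scheme \<Rightarrow> nat \<Rightarrow> 'a \<Rightarrow> nat \<Rightarrow> 'b"
  where "mult_char_poly B A n a =
    char_poly B n (mult_matrix B A n (SOME e. is_basis B A n e) a)"

text \<open>\<open>s\<^sub>j(a)\<close>, where the coefficient of \<open>x\<^sup>n\<^sup>-\<^sup>j\<close> is \<open>(-1)\<^sup>j s\<^sub>j(a)\<close>.\<close>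

definition char_coeff ::
    "('b, 'm) ring_scheme \<Rightarrow> ('b, 'a, 'k) module_scheme \<Rightarrow> nat \<Rightarrow> nat \<Rightarrow> 'a \<Rightarrow> 'b"
  where "char_coeff B A n j a =
    (\<ominus>\<^bsub>B\<^esub> \<one>\<^bsub>B\<^esub>) [^]\<^bsub>B\<^esub> j \<otimes>\<^bsub>B\<^esub> coeff (UP B) (mult_char_poly B A n a) (n - j)"


section \<open>Quotient algebras and monoid algebras\<close>

text \<open>The quotient ring \<open>A Quot I\<close> together with the induced scalar multiplication.\<close>

definition quot_algebra :: "('b, 'a, 'k) module_scheme \<Rightarrow> 'a set \<Rightarrow> ('b, 'a set) module"
  where "quot_algebra A I =
    \<lparr>carrier = carrier (A Quot I), monoid.mult = monoid.mult (A Quot I), one = one (A Quot I),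
     zero = zero (A Quot I), add = add (A Quot I),
     smult = (\<lambda>b C. \<Union>x\<in>C. I +>\<^bsub>A\<^esub> (b \<odot>\<^bsub>A\<^esub> x))\<rparr>"

text \<open>The monoid algebra \<open>B[M]\<close>: functions of finite support on \<open>M\<close>, multiplied by convolution.\<close>

definition monoid_algebra :: "('b, 'm) ring_scheme \<Rightarrow> ('c, 'k) monoid_scheme \<Rightarrow> ('b, 'c \<Rightarrow> 'b) module"
  where "monoid_algebra B M =
    \<lparr>carrier = {f. (\<forall>m. f m \<in> carrier B) \<and> finite {m. f m \<noteq> \<zero>\<^bsub>B\<^esub>} \<and> {m. f m \<noteq> \<zero>\<^bsub>B\<^esub>} \<subseteq> carrier M},
     monoid.mult = (\<lambda>f g m.
       \<Oplus>\<^bsub>B\<^esub>r\<in>{(p, q). f p \<noteq> \<zero>\<^bsub>B\<^esub> \<and> g q \<noteq> \<zero>\<^bsub>B\<^esub> \<and> p \<otimes>\<^bsub>M\<^esub> q = m}. f (fst r) \<otimes>\<^bsub>B\<^esub> g (snd r)),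
     one = (\<lambda>m. if m = \<one>\<^bsub>M\<^esub> then \<one>\<^bsub>B\<^esub> else \<zero>\<^bsub>B\<^esub>),
     zero = (\<lambda>m. \<zero>\<^bsub>B\<^esub>),
     add = (\<lambda>f g m. f m \<oplus>\<^bsub>B\<^esub> g m),
     smult = (\<lambda>b f m. b \<otimes>\<^bsub>B\<^esub> f m)\<rparr>"

definition basis_elem :: "('b, 'm) ring_scheme \<Rightarrow> 'c \<Rightarrow> 'c \<Rightarrow> 'b"
  where "basis_elem B t = (\<lambda>m. if m = t then \<one>\<^bsub>B\<^esub> else \<zero>\<^bsub>B\<^esub>)"


section \<open>Tensor powers of an algebra\<close>

text \<open>The \<open>n\<close>-fold tensor power of \<open>A\<close> over \<open>B\<close> is the free \<open>B\<close>-module on the set \<open>A\<^sup>n\<close> of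
  \<open>n\<close>-tuples modulo the multilinearity relations, with tuples multiplied componentwise. The free
  module with this multiplication is the monoid algebra of the multiplicative monoid \<open>A\<^sup>n\<close>. The
  ideal generated by the relations is also the submodule generated by them, since multiplying a
  relation by a tuple gives a relation.\<close>

definition tuple_algebra ::
    "('b, 'm) ring_scheme \<Rightarrow> ('b, 'a, 'k) module_scheme \<Rightarrow> nat \<Rightarrow> ('b, (nat \<Rightarrow> 'a) \<Rightarrow> 'b) module"
  where "tuple_algebra B A n = monoid_algebra B (product_group {..<n} (\<lambda>_. A))"

definition tensor_relations ::
    "('b, 'm) ring_scheme \<Rightarrow> ('b, 'a, 'k) module_scheme \<Rightarrow> nat \<Rightarrow> ((nat \<Rightarrow> 'a) \<Rightarrow> 'b) set"
  where "tensor_relations B A n =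
    (let F = tuple_algebra B A n in
     {basis_elem B (t(i := a \<oplus>\<^bsub>A\<^esub> a')) \<ominus>\<^bsub>F\<^esub>
        (basis_elem B (t(i := a)) \<oplus>\<^bsub>F\<^esub> basis_elem B (t(i := a')))
      | t i a a'. t \<in> {..<n} \<rightarrow>\<^sub>E carrier A \<and> i < n \<and> a \<in> carrier A \<and> a' \<in> carrier A} \<union>
     {basis_elem B (t(i := b \<odot>\<^bsub>A\<^esub> a)) \<ominus>\<^bsub>F\<^esub> b \<odot>\<^bsub>F\<^esub> basis_elem B (t(i := a))
      | t i a b. t \<in> {..<n} \<rightarrow>\<^sub>E carrier A \<and> i < n \<and> a \<in> carrier A \<and> b \<in> carrier B})"

definition tensor_ideal ::
    "('b, 'm) ring_scheme \<Rightarrow> ('b, 'a, 'k) module_scheme \<Rightarrow> nat \<Rightarrow> ((nat \<Rightarrow> 'a) \<Rightarrow> 'b) set"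
  where "tensor_ideal B A n = Idl\<^bsub>tuple_algebra B A n\<^esub> (tensor_relations B A n)"

definition tensor_power ::
    "('b, 'm) ring_scheme \<Rightarrow> ('b, 'a, 'k) module_scheme \<Rightarrow> nat \<Rightarrow> ('b, ((nat \<Rightarrow> 'a) \<Rightarrow> 'b) set) module"
  where "tensor_power B A n = quot_algebra (tuple_algebra B A n) (tensor_ideal B A n)"

definition pure_tensor ::
    "('b, 'm) ring_scheme \<Rightarrow> ('b, 'a, 'k) module_scheme \<Rightarrow> nat \<Rightarrow> (nat \<Rightarrow> 'a) \<Rightarrow> ((nat \<Rightarrow> 'a) \<Rightarrow> 'b) set"
  where "pure_tensor B A n t = tensor_ideal B A n +>\<^bsub>tuple_algebra B A n\<^esub> basis_elem B t"

text \<open>\<open>a\<close> in the tensor factor \<open>i\<close> and \<open>1\<close> in the others; the factors are numbered from \<open>0\<close>.\<close>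

definition tensor_factor ::
    "('b, 'm) ring_scheme \<Rightarrow> ('b, 'a, 'k) module_scheme \<Rightarrow> nat \<Rightarrow> nat \<Rightarrow> 'a \<Rightarrow> ((nat \<Rightarrow> 'a) \<Rightarrow> 'b) set"
  where "tensor_factor B A n i a =
    pure_tensor B A n (\<lambda>k\<in>{..<n}. if k = i then a else \<one>\<^bsub>A\<^esub>)"


section \<open>The closure of an algebra of rank \<open>n\<close>\<close>

text \<open>Sequences \<open>i\<^sub>1 < \<dots> < i\<^sub>j\<close> of indices are encoded as sets of \<open>j\<close> indices.\<close>

definition Sn_generators ::
    "('b, 'm) ring_scheme \<Rightarrow> ('b, 'a, 'k) module_scheme \<Rightarrow> nat \<Rightarrow> ((nat \<Rightarrow> 'a) \<Rightarrow> 'b) set set"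
  where "Sn_generators B A n =
    (let T = tensor_power B A n in
     {char_coeff B A n j a \<odot>\<^bsub>T\<^esub> \<one>\<^bsub>T\<^esub> \<ominus>\<^bsub>T\<^esub>
        (\<Oplus>\<^bsub>T\<^esub>S\<in>{S. S \<subseteq> {..<n} \<and> card S = j}. \<Otimes>\<^bsub>T\<^esub>i\<in>S. tensor_factor B A n i a)
      | j a. 1 \<le> j \<and> j \<le> n \<and> a \<in> carrier A})"

definition Sn_closure ::
    "('b, 'm) ring_scheme \<Rightarrow> ('b, 'a, 'k) module_scheme \<Rightarrow> nat \<Rightarrow> ('b, ((nat \<Rightarrow> 'a) \<Rightarrow> 'b) set set) module"
  where "Sn_closure B A n =
    quot_algebra (tensor_power B A n) (Idl\<^bsub>tensor_power B A n\<^esub> (Sn_generators B A n))"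


section \<open>The ring \<open>B[x,y,z]/(x,y,z)\<^sup>2\<close>\<close>

datatype xyz = Var_x | Var_y | Var_z

text \<open>Monomials in \<open>x, y, z\<close> are multisets of variables.\<close>

definition monomials_xyz :: "xyz multiset monoid"
  where "monomials_xyz = \<lparr>carrier = UNIV, monoid.mult = (+), one = {#}\<rparr>"

definition poly_xyz :: "('b, 'm) ring_scheme \<Rightarrow> ('b, xyz multiset \<Rightarrow> 'b) module"
  where "poly_xyz B = monoid_algebra B monomials_xyz"

definition ideal_xyz :: "('b, 'm) ring_scheme \<Rightarrow> (xyz multiset \<Rightarrow> 'b) set"
  where "ideal_xyz B =
    Idl\<^bsub>poly_xyz B\<^esub> {basis_elem B {#Var_x#}, basis_elem B {#Var_y#}, basis_elem B {#Var_z#}}"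

definition trunc_xyz :: "('b, 'm) ring_scheme \<Rightarrow> ('b, (xyz multiset \<Rightarrow> 'b) set) module"
  where "trunc_xyz B = quot_algebra (poly_xyz B) (ideal_xyz B \<cdot>\<^bsub>poly_xyz B\<^esub> ideal_xyz B)"

end

theory Submission
  imports Defs
begin

text \<open>
  Let \<open>A = B[x,y,z]/(x,y,z)\<^sup>2\<close>, with basis \<open>1, x, y, z\<close>. An element \<open>a = b + m\<close>, with \<open>b\<close> in \<open>B\<close> and
  \<open>m\<close> in the ideal \<open>(x,y,z)\<close>, multiplies by \<open>b\<close> plus the rank one map \<open>v \<mapsto> v(0) m\<close>, whose trace is
  \<open>m(0) = 0\<close>. Hence its characteristic polynomial is \<open>(X - b)\<^sup>4\<close> (\<open>char_coeff_rank_one\<close>), and the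
  relations of the closure say that \<open>e\<^sub>j(m\<^sub>0, m\<^sub>1, m\<^sub>2, m\<^sub>3) = 0\<close> for all \<open>m\<close> in \<open>(x,y,z)\<close> and
  \<open>1 \<le> j \<le> 4\<close>, where \<open>e\<^sub>j\<close> is the elementary symmetric function and \<open>m\<^sub>k\<close> is \<open>m\<close> in the tensor factor \<open>k\<close>.
  Products of two elements of \<open>(x,y,z)\<close> in the same factor vanish, so \<open>m \<mapsto> \<Prod>\<^sub>k (1 + m\<^sub>k s)\<close> turns sums
  into products (\<open>esym_poly_add\<close>), and the relations for \<open>m\<close> in \<open>{x, y, z}\<close> imply all others.
  For such \<open>m\<close>, the relations \<open>e\<^sub>3\<close> and \<open>e\<^sub>4\<close> follow from \<open>e\<^sub>1\<close> and \<open>e\<^sub>2\<close> (\<open>esym_X_eq_zero\<close>).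

  Thus the closure is generated by \<open>u\<^sub>k\<close> for \<open>u\<close> in \<open>{x, y, z}\<close> and \<open>k < 4\<close> with the relations
  \<open>u\<^sub>k v\<^sub>k = 0\<close>, \<open>e\<^sub>1(u) = 0\<close> and \<open>e\<^sub>2(u) = 0\<close>. The relation \<open>e\<^sub>1\<close> eliminates \<open>u\<^sub>3\<close>; between the conjugates in
  the factors \<open>0, 1, 2\<close> there remain
  \<open>u\<^sub>0 u\<^sub>1 + u\<^sub>0 u\<^sub>2 + u\<^sub>1 u\<^sub>2 = 0\<close> and, for \<open>u \<noteq> v\<close>, \<open>\<Sum> u\<^sub>i v\<^sub>j = 0\<close> over the six pairs \<open>i \<noteq> j\<close>.
  Multiplying these by a third conjugate shows that a monomial of degree three vanishes if a variable
  repeats, and changes sign if two variables are exchanged. What is left over is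
  \<open>1\<close> in degree 0, the \<open>9\<close> elements \<open>u\<^sub>k\<close> in degree 1, two monomials \<open>u\<^sub>i u\<^sub>j\<close> for each variable and five
  monomials \<open>u\<^sub>i v\<^sub>j\<close> for each pair of variables in degree 2, and \<open>x\<^sub>0 y\<^sub>1 z\<^sub>2\<close> in degree 3:
  altogether \<open>1 + 9 + (6 + 15) + 1 = 32\<close>.

  The function \<open>reduce4\<close> expresses a monomial in these 32 normal ones. It has values in any ring in which
  values for the normal monomials are prescribed. With values in the closure it shows that the
  normal monomials span (\<open>mon_reduce4\<close>). With values in \<open>B\<close> it extends any prescription on the normal
  monomials to a linear form on the tensor power. This form vanishes on the ideal of the closure, because the
  reduction respects \<open>e\<^sub>1\<close> and \<open>e\<^sub>2\<close> (\<open>reduce4_e1\<close>, \<open>reduce4_e2\<close>). So the normal monomials have a dual family of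
  linear forms and are a basis (\<open>is_basisI\<close>), whatever the ring \<open>B\<close> is.
\<close>

section \<open>Algebra homomorphisms, quotients and linear forms\<close>

lemma (in abelian_group) minus_eq_zero_iff:
  assumes "x \<in> carrier G" "y \<in> carrier G"
  shows "x \<ominus> y = \<zero> \<longleftrightarrow> x = y"
  using assms by (metis a_minus_def add.inv_closed minus_equality r_neg a_inv_closed minus_minus)

definition alg_hom :: "('b, 'm) ring_scheme \<Rightarrow> ('b, 'a, 'k) module_scheme \<Rightarrow> ('b, 'c, 'l) module_scheme
    \<Rightarrow> ('a \<Rightarrow> 'c) set"
  where "alg_hom B A C =
    {h \<in> ring_hom A C. \<forall>b\<in>carrier B. \<forall>a\<in>carrier A. h (b \<odot>\<^bsub>A\<^esub> a) = b \<odot>\<^bsub>C\<^esub> h a}"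

lemma alg_homD:
  assumes "h \<in> alg_hom B A C"
  shows "h \<in> ring_hom A C"
    and "a \<in> carrier A \<Longrightarrow> h a \<in> carrier C"
    and "a \<in> carrier A \<Longrightarrow> a' \<in> carrier A \<Longrightarrow> h (a \<oplus>\<^bsub>A\<^esub> a') = h a \<oplus>\<^bsub>C\<^esub> h a'"
    and "a \<in> carrier A \<Longrightarrow> a' \<in> carrier A \<Longrightarrow> h (a \<otimes>\<^bsub>A\<^esub> a') = h a \<otimes>\<^bsub>C\<^esub> h a'"
    and "h \<one>\<^bsub>A\<^esub> = \<one>\<^bsub>C\<^esub>"
    and "b \<in> carrier B \<Longrightarrow> a \<in> carrier A \<Longrightarrow> h (b \<odot>\<^bsub>A\<^esub> a) = b \<odot>\<^bsub>C\<^esub> h a"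
  using assms by (auto simp: alg_hom_def ring_hom_def)

lemma alg_hom_comp:
  assumes "f \<in> alg_hom B A C" "g \<in> alg_hom B C D"
  shows "g \<circ> f \<in> alg_hom B A D"
  using assms by (auto simp: alg_hom_def ring_hom_def Pi_iff)

lemma alg_hom_ring_hom_cring:
  assumes "algebra B A" "algebra B C" "h \<in> alg_hom B A C"
  shows "ring_hom_cring A C h"
  using assms by (intro ring_hom_cringI) (auto simp: algebra_def alg_hom_def)

text \<open>All axioms of an algebra are identities, except for negatives, and these can be transported along a surjection that respects the operations.
This spares checking the axioms in quotients.\<close>

lemma algebra_image:
  assumes "algebra B A" and h: "h \<in> alg_hom B A C" and surj: "h ` carrier A = carrier C"
    and zero: "h \<zero>\<^bsub>A\<^esub> = \<zero>\<^bsub>C\<^esub>"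
  shows "algebra B C"
proof -
  interpret A: algebra B A by fact
  note h_simps = alg_homD(3)[OF h, symmetric] alg_homD(4)[OF h, symmetric]
    alg_homD(5)[OF h, symmetric] alg_homD(6)[OF h, symmetric] zero[symmetric]
  have rep: "\<exists>a\<in>carrier A. c = h a" if "c \<in> carrier C" for c
    using that surj by auto
  show ?thesis
  proof (rule algebraI)
    show "cring B" by (rule A.R_cring)
    show "cring C"
    proof (rule cringI)
      show "abelian_group C"
      proof (rule abelian_groupI)
        show "x \<oplus>\<^bsub>C\<^esub> y \<in> carrier C" if "x \<in> carrier C" "y \<in> carrier C" for x y
          using that by (auto dest!: rep simp: h_simps alg_homD(2)[OF h])
        show "\<zero>\<^bsub>C\<^esub> \<in> carrier C"
          by (simp add: h_simps alg_homD(2)[OF h])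
        show "x \<oplus>\<^bsub>C\<^esub> y \<oplus>\<^bsub>C\<^esub> z = x \<oplus>\<^bsub>C\<^esub> (y \<oplus>\<^bsub>C\<^esub> z)"
          if "x \<in> carrier C" "y \<in> carrier C" "z \<in> carrier C" for x y z
          using that by (auto dest!: rep simp: h_simps A.a_assoc)
        show "x \<oplus>\<^bsub>C\<^esub> y = y \<oplus>\<^bsub>C\<^esub> x" if "x \<in> carrier C" "y \<in> carrier C" for x y
          using that by (auto dest!: rep simp: h_simps A.a_comm)
        show "\<zero>\<^bsub>C\<^esub> \<oplus>\<^bsub>C\<^esub> x = x" if "x \<in> carrier C" for x
          using that by (auto dest!: rep simp: h_simps)
        show "\<exists>y\<in>carrier C. y \<oplus>\<^bsub>C\<^esub> x = \<zero>\<^bsub>C\<^esub>" if "x \<in> carrier C" for x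
        proof -
          obtain a where a: "a \<in> carrier A" "x = h a" using rep \<open>x \<in> carrier C\<close> by blast
          then have "h (\<ominus>\<^bsub>A\<^esub> a) \<oplus>\<^bsub>C\<^esub> x = \<zero>\<^bsub>C\<^esub>" by (simp add: h_simps A.l_neg)
          then show ?thesis using a alg_homD(2)[OF h] by blast
        qed
      qed
      show "comm_monoid C"
      proof (rule comm_monoidI)
        show "x \<otimes>\<^bsub>C\<^esub> y = y \<otimes>\<^bsub>C\<^esub> x" if "x \<in> carrier C" "y \<in> carrier C" for x y
          using that by (auto dest!: rep simp: h_simps A.m_comm)
      qed (auto dest!: rep simp: h_simps alg_homD(2)[OF h] A.m_assoc)
      show "(x \<oplus>\<^bsub>C\<^esub> y) \<otimes>\<^bsub>C\<^esub> z = x \<otimes>\<^bsub>C\<^esub> z \<oplus>\<^bsub>C\<^esub> y \<otimes>\<^bsub>C\<^esub> z"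
        if "x \<in> carrier C" "y \<in> carrier C" "z \<in> carrier C" for x y z
        using that by (auto dest!: rep simp: h_simps A.l_distr)
    qed
  qed (auto dest!: rep simp: h_simps alg_homD(2)[OF h] A.smult_l_distr A.smult_r_distr
      A.smult_assoc1 A.smult_assoc2)
qed

text \<open>Linear forms are the tool for proofs of linear independence: they are easy to construct on a
free module and descend to quotients.\<close>

definition linear_form :: "('b, 'm) ring_scheme \<Rightarrow> ('b, 'a, 'k) module_scheme \<Rightarrow> ('a \<Rightarrow> 'b) \<Rightarrow> bool"
  where "linear_form B M l \<longleftrightarrow> l \<in> carrier M \<rightarrow> carrier B \<and>
    (\<forall>x\<in>carrier M. \<forall>y\<in>carrier M. l (x \<oplus>\<^bsub>M\<^esub> y) = l x \<oplus>\<^bsub>B\<^esub> l y) \<and>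
    (\<forall>b\<in>carrier B. \<forall>x\<in>carrier M. l (b \<odot>\<^bsub>M\<^esub> x) = b \<otimes>\<^bsub>B\<^esub> l x)"

lemma linear_formD:
  assumes "linear_form B M l"
  shows "x \<in> carrier M \<Longrightarrow> l x \<in> carrier B"
    and "x \<in> carrier M \<Longrightarrow> y \<in> carrier M \<Longrightarrow> l (x \<oplus>\<^bsub>M\<^esub> y) = l x \<oplus>\<^bsub>B\<^esub> l y"
    and "b \<in> carrier B \<Longrightarrow> x \<in> carrier M \<Longrightarrow> l (b \<odot>\<^bsub>M\<^esub> x) = b \<otimes>\<^bsub>B\<^esub> l x"
  using assms by (auto simp: linear_form_def)

lemma (in module) linear_form_simps:
  assumes "linear_form R M l"
  shows "l \<zero>\<^bsub>M\<^esub> = \<zero>" and "x \<in> carrier M \<Longrightarrow> l (\<ominus>\<^bsub>M\<^esub> x) = \<ominus> l x"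
    and "x \<in> carrier M \<Longrightarrow> y \<in> carrier M \<Longrightarrow> l (x \<ominus>\<^bsub>M\<^esub> y) = l x \<ominus> l y"
    and "finite S \<Longrightarrow> f \<in> S \<rightarrow> carrier M \<Longrightarrow> l (\<Oplus>\<^bsub>M\<^esub>i\<in>S. f i) = (\<Oplus>i\<in>S. l (f i))"
proof -
  note l = linear_formD[OF assms]
  have "l (\<zero> \<odot>\<^bsub>M\<^esub> \<zero>\<^bsub>M\<^esub>) = \<zero> \<otimes> l \<zero>\<^bsub>M\<^esub>" by (rule l) auto
  then show zero: "l \<zero>\<^bsub>M\<^esub> = \<zero>" by (simp add: l(1))
  show neg: "l (\<ominus>\<^bsub>M\<^esub> x) = \<ominus> l x" if "x \<in> carrier M" for x
  proof -
    have "l (\<ominus>\<^bsub>M\<^esub> x \<oplus>\<^bsub>M\<^esub> x) = l (\<ominus>\<^bsub>M\<^esub> x) \<oplus> l x" using that by (intro l) auto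
    then show ?thesis using that
      by (metis M.a_inv_closed M.l_neg R.minus_equality l(1) zero)
  qed
  show "l (x \<ominus>\<^bsub>M\<^esub> y) = l x \<ominus> l y" if "x \<in> carrier M" "y \<in> carrier M" for x y
    using that by (simp add: M.minus_eq R.minus_eq l neg)
  show "l (\<Oplus>\<^bsub>M\<^esub>i\<in>S. f i) = (\<Oplus>i\<in>S. l (f i))" if "finite S" "f \<in> S \<rightarrow> carrier M"
    using that by (induction S rule: finite_induct) (auto simp: zero l Pi_iff)
qed

text \<open>A scalar acts as multiplication by a multiple of \<open>1\<close>.\<close>

lemma (in algebra) ideal_smult:
  assumes "ideal I M" "b \<in> carrier R" "x \<in> I"
  shows "b \<odot>\<^bsub>M\<^esub> x \<in> I"
proof -
  have x: "x \<in> carrier M" using assms ideal.Icarr by fast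
  have "b \<odot>\<^bsub>M\<^esub> x = (b \<odot>\<^bsub>M\<^esub> \<one>\<^bsub>M\<^esub>) \<otimes>\<^bsub>M\<^esub> x"
    using x assms by (simp add: smult_assoc2)
  then show ?thesis using assms ideal.I_l_closed by fastforce
qed

definition quot_map :: "('b, 'a, 'k) module_scheme \<Rightarrow> 'a set \<Rightarrow> 'a \<Rightarrow> 'a set"
  where "quot_map A I a = I +>\<^bsub>A\<^esub> a"

lemma
  assumes alg: "algebra B A" and I: "ideal I A"
  shows quot_map_alg_hom: "quot_map A I \<in> alg_hom B A (quot_algebra A I)"
    and quot_map_surj: "quot_map A I ` carrier A = carrier (quot_algebra A I)"
    and quot_algebra: "algebra B (quot_algebra A I)"
    and quot_map_eq_iff:
      "\<lbrakk>a \<in> carrier A; a' \<in> carrier A\<rbrakk> \<Longrightarrow> quot_map A I a = quot_map A I a' \<longleftrightarrow> a \<ominus>\<^bsub>A\<^esub> a' \<in> I"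
    and quot_map_zero_iff:
      "a \<in> carrier A \<Longrightarrow> quot_map A I a = \<zero>\<^bsub>quot_algebra A I\<^esub> \<longleftrightarrow> a \<in> I"
proof -
  interpret A: algebra B A by fact
  interpret I: ideal I A by fact
  show eq_iff: "quot_map A I a = quot_map A I a' \<longleftrightarrow> a \<ominus>\<^bsub>A\<^esub> a' \<in> I"
    if "a \<in> carrier A" "a' \<in> carrier A" for a a'
    using A.quotient_eq_iff_same_a_r_cos[OF I that] by (simp add: quot_map_def)
  have "b \<odot>\<^bsub>quot_algebra A I\<^esub> quot_map A I a = quot_map A I (b \<odot>\<^bsub>A\<^esub> a)"
    if b: "b \<in> carrier B" and a: "a \<in> carrier A" for a b
  proof -
    have "quot_map A I (b \<odot>\<^bsub>A\<^esub> x) = quot_map A I (b \<odot>\<^bsub>A\<^esub> a)" if x: "x \<in> quot_map A I a" for x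
    proof -
      have xc: "x \<in> carrier A" using x a A.a_r_coset_subset_G[OF I.a_subset] by (auto simp: quot_map_def)
      have "quot_map A I x = quot_map A I a"
        using A.a_repr_independence[OF _ a I.a_subgroup, of x] x unfolding quot_map_def by metis
      then have "x \<ominus>\<^bsub>A\<^esub> a \<in> I" using xc a eq_iff by simp
      then have "b \<odot>\<^bsub>A\<^esub> (x \<ominus>\<^bsub>A\<^esub> a) \<in> I" by (rule A.ideal_smult[OF I b])
      moreover have "b \<odot>\<^bsub>A\<^esub> (x \<ominus>\<^bsub>A\<^esub> a) = b \<odot>\<^bsub>A\<^esub> x \<ominus>\<^bsub>A\<^esub> b \<odot>\<^bsub>A\<^esub> a"
        using xc a b by (simp add: A.minus_eq A.smult_r_distr A.smult_r_minus)
      ultimately show ?thesis using xc a b by (simp add: eq_iff)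
    qed
    moreover have "a \<in> quot_map A I a"
      using a I.a_rcos_self unfolding quot_map_def by simp
    ultimately have "(\<Union>x\<in>quot_map A I a. quot_map A I (b \<odot>\<^bsub>A\<^esub> x)) = quot_map A I (b \<odot>\<^bsub>A\<^esub> a)"
      by blast
    then show ?thesis by (simp add: quot_algebra_def quot_map_def)
  qed
  moreover have "quot_map A I \<in> ring_hom A (quot_algebra A I)"
    using I.rcos_ring_hom by (simp add: ring_hom_def quot_algebra_def quot_map_def Pi_iff)
  ultimately show hom: "quot_map A I \<in> alg_hom B A (quot_algebra A I)"
    by (simp add: alg_hom_def)
  show surj: "quot_map A I ` carrier A = carrier (quot_algebra A I)"
    by (auto simp: quot_algebra_def FactRing_simps quot_map_def)
  have zero: "\<zero>\<^bsub>quot_algebra A I\<^esub> = quot_map A I \<zero>\<^bsub>A\<^esub>"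
    using I.a_subset by (simp add: quot_algebra_def FactRing_def quot_map_def)
  then show "algebra B (quot_algebra A I)"
    by (intro algebra_image[OF alg hom surj]) simp
  show "quot_map A I a = \<zero>\<^bsub>quot_algebra A I\<^esub> \<longleftrightarrow> a \<in> I" if "a \<in> carrier A"
    using that by (simp add: zero eq_iff A.minus_eq)
qed

lemma linear_form_quot:
  assumes alg: "algebra B A" and I: "ideal I A" and l: "linear_form B A l"
    and zero: "\<And>x. x \<in> I \<Longrightarrow> l x = \<zero>\<^bsub>B\<^esub>"
  obtains l' where "linear_form B (quot_algebra A I) l'"
    "\<And>a. a \<in> carrier A \<Longrightarrow> l' (quot_map A I a) = l a"
proof -
  interpret A: algebra B A by fact
  \<comment> \<open>A choice of representatives; the form does not depend on it, since it vanishes on \<open>I\<close>.\<close>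
  define r where "r = inv_into (carrier A) (quot_map A I)"
  note surj = quot_map_surj[OF alg I]
  have l'_quot: "(l \<circ> r) (quot_map A I a) = l a" if a: "a \<in> carrier A" for a
  proof -
    have r: "r (quot_map A I a) \<in> carrier A" "quot_map A I (r (quot_map A I a)) = quot_map A I a"
      unfolding r_def
      using inv_into_into[OF imageI[OF a], of "quot_map A I"]
        f_inv_into_f[OF imageI[OF a], of "quot_map A I"] by blast+
    then have "r (quot_map A I a) \<ominus>\<^bsub>A\<^esub> a \<in> I"
      using a quot_map_eq_iff[OF alg I] by blast
    then have "l (r (quot_map A I a)) \<ominus>\<^bsub>B\<^esub> l a = \<zero>\<^bsub>B\<^esub>"
      using zero a r by (metis A.linear_form_simps(3)[OF l])
    then show ?thesis using a r linear_formD(1)[OF l] A.R.minus_eq_zero_iff by simp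
  qed
  have rep: "\<exists>a\<in>carrier A. c = quot_map A I a" if "c \<in> carrier (quot_algebra A I)" for c
    using that surj by blast
  have "linear_form B (quot_algebra A I) (l \<circ> r)"
    unfolding linear_form_def
  proof (intro conjI ballI funcsetI)
    fix x assume "x \<in> carrier (quot_algebra A I)"
    then obtain a where a: "a \<in> carrier A" "x = quot_map A I a" using rep by blast
    then show "(l \<circ> r) x \<in> carrier B" using l'_quot linear_formD(1)[OF l] by metis
    show "(l \<circ> r) (b \<odot>\<^bsub>quot_algebra A I\<^esub> x) = b \<otimes>\<^bsub>B\<^esub> (l \<circ> r) x" if "b \<in> carrier B" for b
      using a that l'_quot linear_formD(3)[OF l] alg_homD(6)[OF quot_map_alg_hom[OF alg I]]
        A.smult_closed by metis
    fix y assume "y \<in> carrier (quot_algebra A I)"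
    then obtain a' where a': "a' \<in> carrier A" "y = quot_map A I a'" using rep by blast
    show "(l \<circ> r) (x \<oplus>\<^bsub>quot_algebra A I\<^esub> y) = (l \<circ> r) x \<oplus>\<^bsub>B\<^esub> (l \<circ> r) y"
      using a a' l'_quot linear_formD(2)[OF l] alg_homD(3)[OF quot_map_alg_hom[OF alg I]]
        A.a_closed by metis
  qed
  then show thesis using l'_quot by (rule that)
qed

text \<open>The dual forms read off the coefficients of a linear combination, so these are unique over
any ring \<open>B\<close>.\<close>

lemma is_basisI:
  assumes "module B M" and e: "e \<in> {..<n} \<rightarrow> carrier M"
    and span: "\<And>v. v \<in> carrier M \<Longrightarrow>
      \<exists>c \<in> {..<n} \<rightarrow> carrier B. v = (\<Oplus>\<^bsub>M\<^esub>i\<in>{..<n}. c i \<odot>\<^bsub>M\<^esub> e i)"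
    and dual: "\<And>k. k < n \<Longrightarrow>
      \<exists>l. linear_form B M l \<and> (\<forall>i<n. l (e i) = (if i = k then \<one>\<^bsub>B\<^esub> else \<zero>\<^bsub>B\<^esub>))"
  shows "is_basis B M n e"
proof -
  interpret module B M by fact
  have e': "e i \<in> carrier M" if "i < n" for i using e that by auto
  have coeff: "l (\<Oplus>\<^bsub>M\<^esub>i\<in>{..<n}. c i \<odot>\<^bsub>M\<^esub> e i) = c k"
    if "linear_form B M l" "\<forall>i<n. l (e i) = (if i = k then \<one>\<^bsub>B\<^esub> else \<zero>\<^bsub>B\<^esub>)"
      "c \<in> {..<n} \<rightarrow> carrier B" "k < n" for l c k
  proof -
    have "l (\<Oplus>\<^bsub>M\<^esub>i\<in>{..<n}. c i \<odot>\<^bsub>M\<^esub> e i) = (\<Oplus>\<^bsub>B\<^esub>i\<in>{..<n}. l (c i \<odot>\<^bsub>M\<^esub> e i))"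
      using that e' by (intro linear_form_simps) auto
    also have "\<dots> = (\<Oplus>\<^bsub>B\<^esub>i\<in>{..<n}. if k = i then c i else \<zero>\<^bsub>B\<^esub>)"
      using that e' by (intro R.finsum_cong') (auto simp: linear_formD[OF that(1)] Pi_iff)
    also have "\<dots> = c k"
      using that by (intro R.finsum_singleton) auto
    finally show ?thesis .
  qed
  have "\<exists>!c. c \<in> {..<n} \<rightarrow>\<^sub>E carrier B \<and> v = (\<Oplus>\<^bsub>M\<^esub>i\<in>{..<n}. c i \<odot>\<^bsub>M\<^esub> e i)"
    if v: "v \<in> carrier M" for v
  proof -
    obtain c where c: "c \<in> {..<n} \<rightarrow> carrier B" "v = (\<Oplus>\<^bsub>M\<^esub>i\<in>{..<n}. c i \<odot>\<^bsub>M\<^esub> e i)"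
      using span[OF v] by blast
    show ?thesis
    proof (rule ex1I)
      have "(\<Oplus>\<^bsub>M\<^esub>i\<in>{..<n}. restrict c {..<n} i \<odot>\<^bsub>M\<^esub> e i) = (\<Oplus>\<^bsub>M\<^esub>i\<in>{..<n}. c i \<odot>\<^bsub>M\<^esub> e i)"
        using c e' by (intro M.finsum_cong') auto
      then show "restrict c {..<n} \<in> {..<n} \<rightarrow>\<^sub>E carrier B \<and>
          v = (\<Oplus>\<^bsub>M\<^esub>i\<in>{..<n}. restrict c {..<n} i \<odot>\<^bsub>M\<^esub> e i)"
        using c by auto
    next
      fix d assume d: "d \<in> {..<n} \<rightarrow>\<^sub>E carrier B \<and> v = (\<Oplus>\<^bsub>M\<^esub>i\<in>{..<n}. d i \<odot>\<^bsub>M\<^esub> e i)"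
      have "d k = c k" if "k < n" for k
      proof -
        obtain l where l: "linear_form B M l" "\<forall>i<n. l (e i) = (if i = k then \<one>\<^bsub>B\<^esub> else \<zero>\<^bsub>B\<^esub>)"
          using dual[OF \<open>k < n\<close>] by blast
        have "d \<in> {..<n} \<rightarrow> carrier B" using d by (auto simp: PiE_def)
        from coeff[OF l this that] coeff[OF l c(1) that] c(2) d show ?thesis by metis
      qed
      then show "d = restrict c {..<n}" using d by (auto simp: PiE_def extensional_def)
    qed
  qed
  then show ?thesis using e by (simp add: is_basis_def)
qed

lemma (in module) span_submodule:
  fixes n :: nat
  assumes e: "e \<in> {..<n} \<rightarrow> carrier M"
  shows "submodule {\<Oplus>\<^bsub>M\<^esub>i\<in>{..<n}. c i \<odot>\<^bsub>M\<^esub> e i | c. c \<in> {..<n} \<rightarrow> carrier R} R M" (is "submodule ?N R M")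
    and "k < n \<Longrightarrow> e k \<in> {\<Oplus>\<^bsub>M\<^esub>i\<in>{..<n}. c i \<odot>\<^bsub>M\<^esub> e i | c. c \<in> {..<n} \<rightarrow> carrier R}"
proof -
  have e': "e i \<in> carrier M" if "i < n" for i using e that by auto
  have add: "x \<oplus>\<^bsub>M\<^esub> y \<in> ?N" if xy: "x \<in> ?N" "y \<in> ?N" for x y
  proof -
    obtain c d where c: "c \<in> {..<n} \<rightarrow> carrier R" "x = (\<Oplus>\<^bsub>M\<^esub>i\<in>{..<n}. c i \<odot>\<^bsub>M\<^esub> e i)"
      and d: "d \<in> {..<n} \<rightarrow> carrier R" "y = (\<Oplus>\<^bsub>M\<^esub>i\<in>{..<n}. d i \<odot>\<^bsub>M\<^esub> e i)"
      using xy by blast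
    have "x \<oplus>\<^bsub>M\<^esub> y = (\<Oplus>\<^bsub>M\<^esub>i\<in>{..<n}. c i \<odot>\<^bsub>M\<^esub> e i \<oplus>\<^bsub>M\<^esub> d i \<odot>\<^bsub>M\<^esub> e i)"
      unfolding c d using c d e' by (intro M.finsum_addf[symmetric]) auto
    also have "\<dots> = (\<Oplus>\<^bsub>M\<^esub>i\<in>{..<n}. (c i \<oplus> d i) \<odot>\<^bsub>M\<^esub> e i)"
      using c d e' by (intro M.finsum_cong') (auto simp: smult_l_distr Pi_iff)
    finally show ?thesis using c d by (intro CollectI exI[of _ "\<lambda>i. c i \<oplus> d i"]) auto
  qed
  have smult: "b \<odot>\<^bsub>M\<^esub> x \<in> ?N" if b: "b \<in> carrier R" and x: "x \<in> ?N" for b x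
  proof -
    obtain c where c: "c \<in> {..<n} \<rightarrow> carrier R" "x = (\<Oplus>\<^bsub>M\<^esub>i\<in>{..<n}. c i \<odot>\<^bsub>M\<^esub> e i)"
      using x by blast
    have "b \<odot>\<^bsub>M\<^esub> x = (\<Oplus>\<^bsub>M\<^esub>i\<in>{..<n}. b \<odot>\<^bsub>M\<^esub> (c i \<odot>\<^bsub>M\<^esub> e i))"
      unfolding c using c b e' by (intro finsum_smult_ldistr) auto
    also have "\<dots> = (\<Oplus>\<^bsub>M\<^esub>i\<in>{..<n}. (b \<otimes> c i) \<odot>\<^bsub>M\<^esub> e i)"
      using c b e' by (intro M.finsum_cong') (auto simp: smult_assoc1 Pi_iff)
    finally show ?thesis using c b by (intro CollectI exI[of _ "\<lambda>i. b \<otimes> c i"]) auto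
  qed
  have unit: "e k \<in> ?N" if "k < n" for k
  proof -
    have "(\<Oplus>\<^bsub>M\<^esub>i\<in>{..<n}. (if k = i then \<one> else \<zero>) \<odot>\<^bsub>M\<^esub> e i)
        = (\<Oplus>\<^bsub>M\<^esub>i\<in>{..<n}. if k = i then e i else \<zero>\<^bsub>M\<^esub>)"
      using e' by (intro M.finsum_cong') auto
    also have "\<dots> = e k" using e' that by (intro M.finsum_singleton) auto
    finally show ?thesis by (intro CollectI exI[of _ "\<lambda>i. if k = i then \<one> else \<zero>"]) auto
  qed
  then show "k < n \<Longrightarrow> e k \<in> ?N" .
  have sub: "?N \<subseteq> carrier M" using e' by (auto intro!: M.finsum_closed simp: Pi_iff)
  show "submodule ?N R M"
  proof (rule submoduleI[OF sub _ _ add smult])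
    have "(\<Oplus>\<^bsub>M\<^esub>i\<in>{..<n}. \<zero> \<odot>\<^bsub>M\<^esub> e i) = (\<Oplus>\<^bsub>M\<^esub>i\<in>{..<n}. \<zero>\<^bsub>M\<^esub>)"
      using e' by (intro M.finsum_cong') auto
    also have "\<dots> = \<zero>\<^bsub>M\<^esub>" by simp
    finally show "\<zero>\<^bsub>M\<^esub> \<in> ?N" by (intro CollectI exI[of _ "\<lambda>_. \<zero>"]) auto
    show "\<ominus>\<^bsub>M\<^esub> a \<in> ?N" if a: "a \<in> ?N" for a
    proof -
      have "(\<ominus> \<one>) \<odot>\<^bsub>M\<^esub> a = \<ominus>\<^bsub>M\<^esub> a" using a sub by (subst smult_l_minus) auto
      then show ?thesis using smult[of "\<ominus> \<one>" a] a by simp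
    qed
  qed
qed

lemma alg_hom_preimage_submodule:
  assumes "algebra B A" "algebra B C" and h: "h \<in> alg_hom B A C" and N: "submodule N B C"
  shows "submodule {a \<in> carrier A. h a \<in> N} B A"
proof -
  interpret A: algebra B A by fact
  interpret C: algebra B C by fact
  interpret h: ring_hom_cring A C h by (rule alg_hom_ring_hom_cring[OF assms(1-3)])
  note Ncl = C.submoduleE[OF N]
  have N0: "\<zero>\<^bsub>C\<^esub> \<in> N"
  proof -
    obtain x where "x \<in> N" using Ncl(2) by blast
    then have "\<zero>\<^bsub>B\<^esub> \<odot>\<^bsub>C\<^esub> x \<in> N" "x \<in> carrier C" using Ncl by auto
    then show ?thesis by simp
  qed
  show ?thesis
    using N0 Ncl by (intro A.submoduleI) (auto simp: alg_homD(6)[OF h])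
qed

section \<open>Monoid algebras\<close>

context comm_monoid
begin

lemma finprod_swap:
  assumes "finite I" "finite J" "\<And>i j. i \<in> I \<Longrightarrow> j \<in> J \<Longrightarrow> f i j \<in> carrier G"
  shows "(\<Otimes>i\<in>I. \<Otimes>j\<in>J. f i j) = (\<Otimes>j\<in>J. \<Otimes>i\<in>I. f i j)"
  using assms(1,3)
proof (induction I rule: finite_induct)
  case (insert i I)
  then have "(\<Otimes>j\<in>J. \<Otimes>i\<in>insert i I. f i j) = (\<Otimes>j\<in>J. f i j \<otimes> (\<Otimes>i\<in>I. f i j))"
    by (intro finprod_cong') (auto intro!: finprod_closed)
  also have "\<dots> = (\<Otimes>j\<in>J. f i j) \<otimes> (\<Otimes>j\<in>J. \<Otimes>i\<in>I. f i j)"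
    using insert by (intro finprod_multf) (auto intro!: finprod_closed)
  finally show ?case
    using insert by (subst finprod_insert) (auto intro!: finprod_closed)
qed simp

lemma finprod_Times:
  assumes "finite I" "finite J" "\<And>i j. i \<in> I \<Longrightarrow> j \<in> J \<Longrightarrow> f (i, j) \<in> carrier G"
  shows "(\<Otimes>r\<in>I \<times> J. f r) = (\<Otimes>i\<in>I. \<Otimes>j\<in>J. f (i, j))"
  using assms(1,3)
proof (induction I rule: finite_induct)
  case (insert i I)
  have "(\<Otimes>r\<in>insert i I \<times> J. f r) = (\<Otimes>r\<in>{i} \<times> J \<union> I \<times> J. f r)"
    by (rule arg_cong[where f = "finprod G f"]) auto
  also have "\<dots> = (\<Otimes>r\<in>{i} \<times> J. f r) \<otimes> (\<Otimes>r\<in>I \<times> J. f r)"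
    using insert assms(2) by (intro finprod_Un_disjoint) auto
  also have "(\<Otimes>r\<in>{i} \<times> J. f r) = (\<Otimes>r\<in>Pair i ` J. f r)"
    by (rule arg_cong[where f = "finprod G f"]) auto
  also have "\<dots> = (\<Otimes>j\<in>J. f (i, j))"
    using insert by (intro finprod_reindex) (auto simp: inj_on_def)
  finally show ?case
    using insert by (subst finprod_insert) (auto intro!: finprod_closed)
qed simp

end

text \<open>The linear extension of a function \<open>w\<close> on the monoid to the monoid algebra, evaluated at \<open>f\<close>. Elements of the
monoid algebra are determined by their pairings, and the pairing of a product is an iterated pairing
(\<open>pairing_mult\<close>). So associativity and commutativity of the convolution reduce to those of the monoid.\<close>

definition pairing :: "('b, 'm) ring_scheme \<Rightarrow> ('c \<Rightarrow> 'b) \<Rightarrow> ('c \<Rightarrow> 'b) \<Rightarrow> 'b"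
  where "pairing B w f = (\<Oplus>\<^bsub>B\<^esub>p\<in>{p. f p \<noteq> \<zero>\<^bsub>B\<^esub>}. f p \<otimes>\<^bsub>B\<^esub> w p)"

locale monoid_alg = B?: cring B + M: comm_monoid M
  for B :: "('b, 'm) ring_scheme" (structure) and M :: "('c, 'k) monoid_scheme"
begin

abbreviation F where "F \<equiv> monoid_algebra B M"

lemma monoid_algebra_carrier:
  "f \<in> carrier F \<longleftrightarrow> (\<forall>m. f m \<in> carrier B) \<and> finite {m. f m \<noteq> \<zero>} \<and> {m. f m \<noteq> \<zero>} \<subseteq> carrier M"
  by (simp add: monoid_algebra_def)

lemma monoid_algebra_simps:
  "zero F = (\<lambda>m. \<zero>)" "(f \<oplus>\<^bsub>F\<^esub> g) m = f m \<oplus> g m" "(b \<odot>\<^bsub>F\<^esub> f) m = b \<otimes> f m"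
  "one F = basis_elem B \<one>\<^bsub>M\<^esub>"
  by (simp_all add: monoid_algebra_def basis_elem_def)

lemma basis_elem_range [simp]: "basis_elem B m p \<in> carrier B"
  by (simp add: basis_elem_def)

lemma monoid_algebra_closed:
  shows "zero F \<in> carrier F"
    and "\<lbrakk>f \<in> carrier F; g \<in> carrier F\<rbrakk> \<Longrightarrow> f \<oplus>\<^bsub>F\<^esub> g \<in> carrier F"
    and "\<lbrakk>b \<in> carrier B; f \<in> carrier F\<rbrakk> \<Longrightarrow> b \<odot>\<^bsub>F\<^esub> f \<in> carrier F"
    and "t \<in> carrier M \<Longrightarrow> basis_elem B t \<in> carrier F"
proof -
  show "zero F \<in> carrier F" by (simp add: monoid_algebra_carrier monoid_algebra_simps)
  show "f \<oplus>\<^bsub>F\<^esub> g \<in> carrier F" if fg: "f \<in> carrier F" "g \<in> carrier F"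
  proof -
    have "{m. f m \<oplus> g m \<noteq> \<zero>} \<subseteq> {m. f m \<noteq> \<zero>} \<union> {m. g m \<noteq> \<zero>}" by auto
    moreover have "finite ({m. f m \<noteq> \<zero>} \<union> {m. g m \<noteq> \<zero>})"
      "{m. f m \<noteq> \<zero>} \<union> {m. g m \<noteq> \<zero>} \<subseteq> carrier M"
      using fg by (auto simp: monoid_algebra_carrier)
    ultimately have "finite {m. f m \<oplus> g m \<noteq> \<zero>}" "{m. f m \<oplus> g m \<noteq> \<zero>} \<subseteq> carrier M"
      by (meson finite_subset subset_trans)+
    then show ?thesis using fg by (simp add: monoid_algebra_carrier monoid_algebra_simps)
  qed
  show "b \<odot>\<^bsub>F\<^esub> f \<in> carrier F" if bf: "b \<in> carrier B" "f \<in> carrier F"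
  proof -
    have "{m. b \<otimes> f m \<noteq> \<zero>} \<subseteq> {m. f m \<noteq> \<zero>}" using bf by auto
    moreover have "finite {m. f m \<noteq> \<zero>}" "{m. f m \<noteq> \<zero>} \<subseteq> carrier M"
      using bf by (auto simp: monoid_algebra_carrier)
    ultimately have "finite {m. b \<otimes> f m \<noteq> \<zero>}" "{m. b \<otimes> f m \<noteq> \<zero>} \<subseteq> carrier M"
      by (meson finite_subset subset_trans)+
    then show ?thesis using bf by (simp add: monoid_algebra_carrier monoid_algebra_simps)
  qed
  show "basis_elem B t \<in> carrier F" if "t \<in> carrier M"
  proof -
    have "{m. basis_elem B t m \<noteq> \<zero>} \<subseteq> {t}" by (auto simp: basis_elem_def)
    then have "finite {m. basis_elem B t m \<noteq> \<zero>}" "{m. basis_elem B t m \<noteq> \<zero>} \<subseteq> carrier M"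
      using that by (auto dest: finite_subset)
    then show ?thesis by (auto simp: monoid_algebra_carrier basis_elem_def)
  qed
qed

lemma pairing_over:
  assumes "f \<in> carrier F" "w \<in> carrier M \<rightarrow> carrier B"
    and "finite P" "{p. f p \<noteq> \<zero>} \<subseteq> P" "P \<subseteq> carrier M"
  shows "pairing B w f = (\<Oplus>p\<in>P. f p \<otimes> w p)"
  unfolding pairing_def
  using assms by (intro add.finprod_mono_neutral_cong_left) (auto simp: monoid_algebra_carrier Pi_iff subset_iff)

lemma pairing_closed:
  "\<lbrakk>f \<in> carrier F; w \<in> carrier M \<rightarrow> carrier B\<rbrakk> \<Longrightarrow> pairing B w f \<in> carrier B"
  unfolding pairing_def by (intro finsum_closed) (auto simp: monoid_algebra_carrier Pi_iff)

lemma pairing_cong: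
  assumes "f \<in> carrier F" "w \<in> carrier M \<rightarrow> carrier B" "\<And>p. p \<in> carrier M \<Longrightarrow> w p = w' p"
  shows "pairing B w f = pairing B w' f"
  unfolding pairing_def
  using assms by (intro finsum_cong') (auto simp: monoid_algebra_carrier Pi_iff subset_iff)

lemma pairing_linear_form:
  assumes w: "w \<in> carrier M \<rightarrow> carrier B"
  shows "linear_form B F (pairing B w)"
  unfolding linear_form_def
proof (intro conjI ballI funcsetI)
  fix f assume f: "f \<in> carrier F"
  show "pairing B w f \<in> carrier B" using f w by (rule pairing_closed)
  show "pairing B w (b \<odot>\<^bsub>F\<^esub> f) = b \<otimes> pairing B w f" if b: "b \<in> carrier B" for b
  proof -
    let ?P = "{p. f p \<noteq> \<zero>}"
    have P: "finite ?P" "?P \<subseteq> carrier M" and fc: "\<And>p. f p \<in> carrier B" and wc: "\<And>p. p \<in> ?P \<Longrightarrow> w p \<in> carrier B"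
      using f w by (auto simp: monoid_algebra_carrier Pi_iff subset_iff)
    have "pairing B w (b \<odot>\<^bsub>F\<^esub> f) = (\<Oplus>p\<in>?P. (b \<odot>\<^bsub>F\<^esub> f) p \<otimes> w p)"
      using P w f b monoid_algebra_closed by (intro pairing_over) (auto simp: monoid_algebra_simps fc)
    also have "\<dots> = (\<Oplus>p\<in>?P. b \<otimes> (f p \<otimes> w p))"
      using fc wc b by (intro finsum_cong') (auto simp: monoid_algebra_simps m_assoc)
    also have "\<dots> = b \<otimes> pairing B w f"
      unfolding pairing_def using P fc wc b by (intro finsum_rdistr[symmetric]) auto
    finally show ?thesis .
  qed
  fix g assume g: "g \<in> carrier F"
  show "pairing B w (f \<oplus>\<^bsub>F\<^esub> g) = pairing B w f \<oplus> pairing B w g"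
  proof -
    let ?P = "{p. f p \<noteq> \<zero>} \<union> {p. g p \<noteq> \<zero>}"
    have P: "finite ?P" "?P \<subseteq> carrier M" and fc: "\<And>p. f p \<in> carrier B" "\<And>p. g p \<in> carrier B"
      and wc: "\<And>p. p \<in> ?P \<Longrightarrow> w p \<in> carrier B"
      using f g w by (auto simp: monoid_algebra_carrier Pi_iff subset_iff)
    have "pairing B w (f \<oplus>\<^bsub>F\<^esub> g) = (\<Oplus>p\<in>?P. (f \<oplus>\<^bsub>F\<^esub> g) p \<otimes> w p)"
      using P w f g monoid_algebra_closed by (intro pairing_over) (auto simp: monoid_algebra_simps fc)
    also have "\<dots> = (\<Oplus>p\<in>?P. f p \<otimes> w p \<oplus> g p \<otimes> w p)"
      using fc wc by (intro finsum_cong') (auto simp: monoid_algebra_simps l_distr Pi_iff)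
    also have "\<dots> = (\<Oplus>p\<in>?P. f p \<otimes> w p) \<oplus> (\<Oplus>p\<in>?P. g p \<otimes> w p)"
      using fc wc by (intro finsum_addf) auto
    also have "(\<Oplus>p\<in>?P. f p \<otimes> w p) = pairing B w f"
      using P w f by (intro pairing_over[symmetric]) auto
    also have "(\<Oplus>p\<in>?P. g p \<otimes> w p) = pairing B w g"
      using P w g by (intro pairing_over[symmetric]) auto
    finally show ?thesis .
  qed
qed

lemma pairing_basis_elem:
  assumes "t \<in> carrier M" "w \<in> carrier M \<rightarrow> carrier B"
  shows "pairing B w (basis_elem B t) = w t"
proof -
  have "pairing B w (basis_elem B t) = (\<Oplus>p\<in>{t}. basis_elem B t p \<otimes> w p)"
    using assms by (intro pairing_over monoid_algebra_closed) (auto simp: basis_elem_def)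
  moreover have "w t \<in> carrier B" using assms by auto
  ultimately show ?thesis by (simp add: basis_elem_def)
qed

lemma pairing_indicator:
  assumes "f \<in> carrier F" "m \<in> carrier M"
  shows "pairing B (basis_elem B m) f = f m"
proof -
  let ?P = "insert m {p. f p \<noteq> \<zero>}"
  have fc: "\<And>p. f p \<in> carrier B" using assms by (auto simp: monoid_algebra_carrier)
  have "pairing B (basis_elem B m) f = (\<Oplus>p\<in>?P. f p \<otimes> basis_elem B m p)"
    using assms by (intro pairing_over) (auto simp: monoid_algebra_carrier basis_elem_def)
  also have "\<dots> = (\<Oplus>p\<in>?P. if m = p then f p else \<zero>)"
    using fc by (intro finsum_cong') (auto simp: basis_elem_def)
  also have "\<dots> = f m"
    using assms by (intro finsum_singleton) (auto simp: monoid_algebra_carrier)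
  finally show ?thesis .
qed

lemma monoid_algebra_eqI:
  assumes f: "f \<in> carrier F" and g: "g \<in> carrier F"
    and eq: "\<And>w. w \<in> carrier M \<rightarrow> carrier B \<Longrightarrow> pairing B w f = pairing B w g"
  shows "f = g"
proof
  fix m
  show "f m = g m"
  proof (cases "m \<in> carrier M")
    case True
    have "basis_elem B m \<in> carrier M \<rightarrow> carrier B" by (auto simp: basis_elem_def)
    from eq[OF this] show ?thesis using True f g by (simp add: pairing_indicator)
  next
    case False
    then show ?thesis using f g by (metis (mono_tags, lifting) monoid_algebra_carrier mem_Collect_eq subsetD)
  qed
qed

text \<open>Summing over arbitrary finite sets that contain the supports makes the index set of the convolution independent of
the coefficient \<open>m\<close>; the indicator \<open>basis_elem B m\<close> selects the factorizations of \<open>m\<close>.\<close>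

lemma monoid_algebra_mult_coeff:
  assumes f: "f \<in> carrier F" and g: "g \<in> carrier F"
    and P: "finite P" "{p. f p \<noteq> \<zero>} \<subseteq> P" and Q: "finite Q" "{q. g q \<noteq> \<zero>} \<subseteq> Q"
  shows "(f \<otimes>\<^bsub>F\<^esub> g) m = (\<Oplus>p\<in>P. \<Oplus>q\<in>Q. f p \<otimes> g q \<otimes> basis_elem B m (p \<otimes>\<^bsub>M\<^esub> q))"
proof -
  have c: "\<And>p. f p \<in> carrier B" "\<And>p. g p \<in> carrier B"
    using f g by (auto simp: monoid_algebra_carrier basis_elem_def)
  have "(f \<otimes>\<^bsub>F\<^esub> g) m = (\<Oplus>r\<in>{(p, q). f p \<noteq> \<zero> \<and> g q \<noteq> \<zero> \<and> p \<otimes>\<^bsub>M\<^esub> q = m}. f (fst r) \<otimes> g (snd r))"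
    by (simp add: monoid_algebra_def)
  also have "\<dots> = (\<Oplus>r\<in>P \<times> Q. f (fst r) \<otimes> g (snd r) \<otimes> basis_elem B m (fst r \<otimes>\<^bsub>M\<^esub> snd r))"
    using P Q c by (intro add.finprod_mono_neutral_cong_left) (auto simp: basis_elem_def)
  also have "\<dots> = (\<Oplus>p\<in>P. \<Oplus>q\<in>Q. f p \<otimes> g q \<otimes> basis_elem B m (p \<otimes>\<^bsub>M\<^esub> q))"
    using P Q c by (subst add.finprod_Times) auto
  finally show ?thesis .
qed

lemma monoid_algebra_mult_closed:
  assumes f: "f \<in> carrier F" and g: "g \<in> carrier F"
  shows "f \<otimes>\<^bsub>F\<^esub> g \<in> carrier F"
proof -
  let ?P = "{p. f p \<noteq> \<zero>}" and ?Q = "{q. g q \<noteq> \<zero>}"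
  have PQ: "finite ?P" "?P \<subseteq> carrier M" "finite ?Q" "?Q \<subseteq> carrier M"
    and c: "\<And>p. f p \<in> carrier B" "\<And>p. g p \<in> carrier B"
    using f g by (auto simp: monoid_algebra_carrier basis_elem_def)
  note coeff = monoid_algebra_mult_coeff[OF f g PQ(1) order_refl PQ(3) order_refl]
  have "(f \<otimes>\<^bsub>F\<^esub> g) m = \<zero>" if "m \<notin> (\<lambda>(p, q). p \<otimes>\<^bsub>M\<^esub> q) ` (?P \<times> ?Q)" for m
  proof -
    have "basis_elem B m (p \<otimes>\<^bsub>M\<^esub> q) = \<zero>" if "p \<in> ?P" "q \<in> ?Q" for p q
      using that \<open>m \<notin> _\<close> by (force simp: basis_elem_def)
    then show ?thesis unfolding coeff using c
      by (intro add.finprod_one_eqI) auto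
  qed
  then have "{m. (f \<otimes>\<^bsub>F\<^esub> g) m \<noteq> \<zero>} \<subseteq> (\<lambda>(p, q). p \<otimes>\<^bsub>M\<^esub> q) ` (?P \<times> ?Q)" by blast
  moreover have "finite ((\<lambda>(p, q). p \<otimes>\<^bsub>M\<^esub> q) ` (?P \<times> ?Q))"
    "(\<lambda>(p, q). p \<otimes>\<^bsub>M\<^esub> q) ` (?P \<times> ?Q) \<subseteq> carrier M"
    using PQ by auto
  ultimately have "finite {m. (f \<otimes>\<^bsub>F\<^esub> g) m \<noteq> \<zero>}" "{m. (f \<otimes>\<^bsub>F\<^esub> g) m \<noteq> \<zero>} \<subseteq> carrier M"
    by (meson finite_subset subset_trans)+
  moreover have "(f \<otimes>\<^bsub>F\<^esub> g) m \<in> carrier B" for m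
    unfolding coeff using c by (intro finsum_closed) auto
  ultimately show ?thesis by (simp add: monoid_algebra_carrier)
qed

lemma pairing_nested:
  assumes "f \<in> carrier F" "g \<in> carrier F" "\<And>p q. \<lbrakk>p \<in> carrier M; q \<in> carrier M\<rbrakk> \<Longrightarrow> v p q \<in> carrier B"
  shows "pairing B (\<lambda>p. pairing B (\<lambda>q. v p q) g) f
    = (\<Oplus>p\<in>{p. f p \<noteq> \<zero>}. \<Oplus>q\<in>{q. g q \<noteq> \<zero>}. f p \<otimes> g q \<otimes> v p q)"
  unfolding pairing_def
proof (rule finsum_cong'[OF refl])
  have c: "finite {q. g q \<noteq> \<zero>}" "\<And>p. f p \<in> carrier B" "\<And>q. g q \<in> carrier B"
    "\<And>p q. f p \<noteq> \<zero> \<Longrightarrow> g q \<noteq> \<zero> \<Longrightarrow> v p q \<in> carrier B"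
    using assms by (auto simp: monoid_algebra_carrier subset_iff)
  then show "(\<lambda>p. \<Oplus>q\<in>{q. g q \<noteq> \<zero>}. f p \<otimes> g q \<otimes> v p q) \<in> {p. f p \<noteq> \<zero>} \<rightarrow> carrier B"
    by (auto intro!: finsum_closed)
  show "f p \<otimes> (\<Oplus>q\<in>{q. g q \<noteq> \<zero>}. g q \<otimes> v p q) = (\<Oplus>q\<in>{q. g q \<noteq> \<zero>}. f p \<otimes> g q \<otimes> v p q)"
    if "p \<in> {p. f p \<noteq> \<zero>}" for p
  proof -
    have "f p \<otimes> (\<Oplus>q\<in>{q. g q \<noteq> \<zero>}. g q \<otimes> v p q) = (\<Oplus>q\<in>{q. g q \<noteq> \<zero>}. f p \<otimes> (g q \<otimes> v p q))"
      using c that by (intro finsum_rdistr) auto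
    also have "\<dots> = (\<Oplus>q\<in>{q. g q \<noteq> \<zero>}. f p \<otimes> g q \<otimes> v p q)"
      using c that by (intro finsum_cong') (auto simp: m_assoc)
    finally show ?thesis .
  qed
qed

lemma pairing_mult:
  assumes f: "f \<in> carrier F" and g: "g \<in> carrier F" and w: "w \<in> carrier M \<rightarrow> carrier B"
  shows "pairing B w (f \<otimes>\<^bsub>F\<^esub> g) = pairing B (\<lambda>p. pairing B (\<lambda>q. w (p \<otimes>\<^bsub>M\<^esub> q)) g) f"
proof -
  let ?P = "{p. f p \<noteq> \<zero>}" and ?Q = "{q. g q \<noteq> \<zero>}" and ?h = "f \<otimes>\<^bsub>F\<^esub> g"
  let ?S = "{m. ?h m \<noteq> \<zero>} \<union> (\<lambda>(p, q). p \<otimes>\<^bsub>M\<^esub> q) ` (?P \<times> ?Q)"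
  have h: "?h \<in> carrier F" using f g by (rule monoid_algebra_mult_closed)
  have PQ: "finite ?P" "?P \<subseteq> carrier M" "finite ?Q" "?Q \<subseteq> carrier M"
    and c: "\<And>p. f p \<in> carrier B" "\<And>p. g p \<in> carrier B"
    using f g by (auto simp: monoid_algebra_carrier basis_elem_def)
  have S: "finite ?S" "?S \<subseteq> carrier M" using h PQ by (auto simp: monoid_algebra_carrier)
  then have wc: "\<And>m. m \<in> ?S \<Longrightarrow> w m \<in> carrier B" using w by auto
  note coeff = monoid_algebra_mult_coeff[OF f g PQ(1) order_refl PQ(3) order_refl]
  have "pairing B w ?h = (\<Oplus>m\<in>?S. ?h m \<otimes> w m)"
    using h w S by (intro pairing_over) auto
  also have "\<dots> = (\<Oplus>m\<in>?S. \<Oplus>p\<in>?P. \<Oplus>q\<in>?Q. f p \<otimes> g q \<otimes> basis_elem B m (p \<otimes>\<^bsub>M\<^esub> q) \<otimes> w m)"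
  proof (rule finsum_cong'[OF refl])
    fix m assume m: "m \<in> ?S"
    show "?h m \<otimes> w m = (\<Oplus>p\<in>?P. \<Oplus>q\<in>?Q. f p \<otimes> g q \<otimes> basis_elem B m (p \<otimes>\<^bsub>M\<^esub> q) \<otimes> w m)"
      unfolding coeff using c wc[OF m] PQ
      by (subst finsum_ldistr, auto intro!: finsum_closed finsum_cong' finsum_ldistr)
  qed (use c wc in \<open>auto intro!: finsum_closed\<close>)
  also have "\<dots> = (\<Oplus>p\<in>?P. \<Oplus>q\<in>?Q. \<Oplus>m\<in>?S. f p \<otimes> g q \<otimes> basis_elem B m (p \<otimes>\<^bsub>M\<^esub> q) \<otimes> w m)"
    using S PQ c wc
    by (subst add.finprod_swap, (auto intro!: finsum_closed)[3])
      (intro finsum_cong' refl add.finprod_swap, auto intro!: finsum_closed)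
  also have "\<dots> = (\<Oplus>p\<in>?P. \<Oplus>q\<in>?Q. f p \<otimes> g q \<otimes> w (p \<otimes>\<^bsub>M\<^esub> q))"
  proof (intro finsum_cong' refl)
    fix p q assume pq: "p \<in> ?P" "q \<in> ?Q"
    have "(\<Oplus>m\<in>?S. f p \<otimes> g q \<otimes> basis_elem B m (p \<otimes>\<^bsub>M\<^esub> q) \<otimes> w m)
        = (\<Oplus>m\<in>?S. if p \<otimes>\<^bsub>M\<^esub> q = m then f p \<otimes> g q \<otimes> w m else \<zero>)"
      using c wc by (intro finsum_cong') (auto simp: basis_elem_def)
    also have "\<dots> = f p \<otimes> g q \<otimes> w (p \<otimes>\<^bsub>M\<^esub> q)"
      using c wc S pq by (intro finsum_singleton) force+
    finally show "(\<Oplus>m\<in>?S. f p \<otimes> g q \<otimes> basis_elem B m (p \<otimes>\<^bsub>M\<^esub> q) \<otimes> w m)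
        = f p \<otimes> g q \<otimes> w (p \<otimes>\<^bsub>M\<^esub> q)" .
  next
    have wpq: "w (p \<otimes>\<^bsub>M\<^esub> q) \<in> carrier B" if "p \<in> ?P" "q \<in> ?Q" for p q
      using that w PQ by auto
    then show "(\<lambda>q. f p \<otimes> g q \<otimes> w (p \<otimes>\<^bsub>M\<^esub> q)) \<in> ?Q \<rightarrow> carrier B" if "p \<in> ?P" for p
      using that c by auto
    from wpq show "(\<lambda>p. \<Oplus>q\<in>?Q. f p \<otimes> g q \<otimes> w (p \<otimes>\<^bsub>M\<^esub> q)) \<in> ?P \<rightarrow> carrier B"
      using c by (auto intro!: finsum_closed)
  qed
  also have "\<dots> = pairing B (\<lambda>p. pairing B (\<lambda>q. w (p \<otimes>\<^bsub>M\<^esub> q)) g) f"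
    using f g w by (intro pairing_nested[symmetric]) auto
  finally show ?thesis .
qed

lemma pairing_swap:
  assumes f: "f \<in> carrier F" and g: "g \<in> carrier F"
    and v: "\<And>p q. \<lbrakk>p \<in> carrier M; q \<in> carrier M\<rbrakk> \<Longrightarrow> v p q \<in> carrier B"
  shows "pairing B (\<lambda>p. pairing B (\<lambda>q. v p q) g) f = pairing B (\<lambda>q. pairing B (\<lambda>p. v p q) f) g"
proof -
  have c: "finite {p. f p \<noteq> \<zero>}" "finite {q. g q \<noteq> \<zero>}" "\<And>p. f p \<in> carrier B" "\<And>q. g q \<in> carrier B"
    "\<And>p q. f p \<noteq> \<zero> \<Longrightarrow> g q \<noteq> \<zero> \<Longrightarrow> v p q \<in> carrier B"
    using assms by (auto simp: monoid_algebra_carrier subset_iff)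
  have "pairing B (\<lambda>p. pairing B (\<lambda>q. v p q) g) f
      = (\<Oplus>p\<in>{p. f p \<noteq> \<zero>}. \<Oplus>q\<in>{q. g q \<noteq> \<zero>}. f p \<otimes> g q \<otimes> v p q)"
    by (rule pairing_nested[OF assms])
  also have "\<dots> = (\<Oplus>q\<in>{q. g q \<noteq> \<zero>}. \<Oplus>p\<in>{p. f p \<noteq> \<zero>}. f p \<otimes> g q \<otimes> v p q)"
    using c by (intro add.finprod_swap) auto
  also have "\<dots> = (\<Oplus>q\<in>{q. g q \<noteq> \<zero>}. \<Oplus>p\<in>{p. f p \<noteq> \<zero>}. g q \<otimes> f p \<otimes> v p q)"
    using c by (intro finsum_cong' refl) (auto intro!: finsum_closed simp: m_comm)
  also have "\<dots> = pairing B (\<lambda>q. pairing B (\<lambda>p. v p q) f) g"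
    using v by (intro pairing_nested[OF g f, symmetric]) auto
  finally show ?thesis .
qed

lemma basis_elem_mult:
  assumes "s \<in> carrier M" "t \<in> carrier M"
  shows "basis_elem B s \<otimes>\<^bsub>F\<^esub> basis_elem B t = basis_elem B (s \<otimes>\<^bsub>M\<^esub> t)"
  using assms
  by (intro monoid_algebra_eqI) (auto simp: monoid_algebra_closed monoid_algebra_mult_closed
      pairing_mult pairing_basis_elem pairing_closed Pi_iff)

lemma monoid_algebra: "algebra B F"
proof (rule algebraI)
  show "cring B" by (rule is_cring)
  have pair_fun: "(\<lambda>p. pairing B (\<lambda>q. w (p \<otimes>\<^bsub>M\<^esub> q)) g) \<in> carrier M \<rightarrow> carrier B"
    if "w \<in> carrier M \<rightarrow> carrier B" "g \<in> carrier F" for w g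
    using that by (auto intro!: pairing_closed)
  note closed = monoid_algebra_closed monoid_algebra_mult_closed
  note lin = pairing_linear_form[THEN linear_formD(2)] pairing_linear_form[THEN linear_formD(3)]
  have coeff_closed: "f m \<in> carrier B" if "f \<in> carrier F" for f m
    using that by (simp add: monoid_algebra_carrier)
  note pointwise = monoid_algebra_simps coeff_closed
  show "cring F"
  proof (rule cringI)
    show "abelian_group F"
    proof (rule abelian_groupI)
      fix f assume f: "f \<in> carrier F"
      show "\<exists>g\<in>carrier F. g \<oplus>\<^bsub>F\<^esub> f = zero F"
      proof (rule bexI)
        show "(\<ominus> \<one>) \<odot>\<^bsub>F\<^esub> f \<oplus>\<^bsub>F\<^esub> f = zero F"
          using f by (auto simp: pointwise l_minus l_neg)
      qed (use f in \<open>auto intro: closed\<close>)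
    next
      fix f g h assume f: "f \<in> carrier F" and g: "g \<in> carrier F" and h: "h \<in> carrier F"
      show "f \<oplus>\<^bsub>F\<^esub> g \<oplus>\<^bsub>F\<^esub> h = f \<oplus>\<^bsub>F\<^esub> (g \<oplus>\<^bsub>F\<^esub> h)"
        using f g h by (intro ext) (simp add: pointwise a_assoc)
    next
      show "zero F \<in> carrier F" by (rule closed)
    qed (auto simp: pointwise a_comm intro: closed)
    show "comm_monoid F"
    proof (rule comm_monoidI)
      fix f g h assume f: "f \<in> carrier F" and g: "g \<in> carrier F" and h: "h \<in> carrier F"
      show "(f \<otimes>\<^bsub>F\<^esub> g) \<otimes>\<^bsub>F\<^esub> h = f \<otimes>\<^bsub>F\<^esub> (g \<otimes>\<^bsub>F\<^esub> h)"
      proof (rule monoid_algebra_eqI)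
        fix w assume w: "w \<in> carrier M \<rightarrow> carrier B"
        have "pairing B w ((f \<otimes>\<^bsub>F\<^esub> g) \<otimes>\<^bsub>F\<^esub> h)
            = pairing B (\<lambda>p. pairing B (\<lambda>q. pairing B (\<lambda>r. w ((p \<otimes>\<^bsub>M\<^esub> q) \<otimes>\<^bsub>M\<^esub> r)) h) g) f"
          using f g h w by (simp add: pairing_mult closed pair_fun)
        also have "\<dots> = pairing B (\<lambda>p. pairing B (\<lambda>q. pairing B (\<lambda>r. w (p \<otimes>\<^bsub>M\<^esub> (q \<otimes>\<^bsub>M\<^esub> r))) h) g) f"
          using f g h w by (intro pairing_cong) (auto intro!: pairing_closed simp: M.m_assoc)
        also have "\<dots> = pairing B (\<lambda>p. pairing B (\<lambda>s. w (p \<otimes>\<^bsub>M\<^esub> s)) (g \<otimes>\<^bsub>F\<^esub> h)) f"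
          using f g h w
          by (intro pairing_cong pairing_mult[symmetric]) (auto intro!: pairing_closed)
        also have "\<dots> = pairing B w (f \<otimes>\<^bsub>F\<^esub> (g \<otimes>\<^bsub>F\<^esub> h))"
          using f g h w by (simp add: pairing_mult closed)
        finally show "pairing B w ((f \<otimes>\<^bsub>F\<^esub> g) \<otimes>\<^bsub>F\<^esub> h) = pairing B w (f \<otimes>\<^bsub>F\<^esub> (g \<otimes>\<^bsub>F\<^esub> h))" .
      qed (use f g h in \<open>auto intro: closed\<close>)
    next
      fix f g assume f: "f \<in> carrier F" and g: "g \<in> carrier F"
      show "f \<otimes>\<^bsub>F\<^esub> g = g \<otimes>\<^bsub>F\<^esub> f"
      proof (rule monoid_algebra_eqI)
        fix w assume w: "w \<in> carrier M \<rightarrow> carrier B"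
        have "pairing B w (f \<otimes>\<^bsub>F\<^esub> g) = pairing B (\<lambda>q. pairing B (\<lambda>p. w (p \<otimes>\<^bsub>M\<^esub> q)) f) g"
          using f g w by (simp add: pairing_mult, intro pairing_swap) auto
        also have "\<dots> = pairing B (\<lambda>q. pairing B (\<lambda>p. w (q \<otimes>\<^bsub>M\<^esub> p)) f) g"
          using f g w by (intro pairing_cong) (auto intro!: pairing_closed simp: M.m_comm)
        also have "\<dots> = pairing B w (g \<otimes>\<^bsub>F\<^esub> f)" using f g w by (simp add: pairing_mult)
        finally show "pairing B w (f \<otimes>\<^bsub>F\<^esub> g) = pairing B w (g \<otimes>\<^bsub>F\<^esub> f)" .
      qed (use f g in \<open>auto intro: closed\<close>)
    next
      fix f assume f: "f \<in> carrier F"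
      show "one F \<otimes>\<^bsub>F\<^esub> f = f"
      proof (rule monoid_algebra_eqI)
        fix w assume w: "w \<in> carrier M \<rightarrow> carrier B"
        have "pairing B w (one F \<otimes>\<^bsub>F\<^esub> f) = pairing B (\<lambda>q. w (\<one>\<^bsub>M\<^esub> \<otimes>\<^bsub>M\<^esub> q)) f"
          using f w by (simp add: monoid_algebra_simps pairing_mult closed pair_fun pairing_basis_elem)
        also have "\<dots> = pairing B w f" using f w by (intro pairing_cong) auto
        finally show "pairing B w (one F \<otimes>\<^bsub>F\<^esub> f) = pairing B w f" .
      qed (use f in \<open>auto intro: closed simp: monoid_algebra_simps\<close>)
    qed (auto simp: closed monoid_algebra_simps)
    fix f g h assume f: "f \<in> carrier F" and g: "g \<in> carrier F" and h: "h \<in> carrier F"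
    show "(f \<oplus>\<^bsub>F\<^esub> g) \<otimes>\<^bsub>F\<^esub> h = f \<otimes>\<^bsub>F\<^esub> h \<oplus>\<^bsub>F\<^esub> g \<otimes>\<^bsub>F\<^esub> h"
      using f g h by (intro monoid_algebra_eqI) (auto simp: closed pairing_mult lin pair_fun)
  qed
  fix b f g assume b: "b \<in> carrier B" and f: "f \<in> carrier F" and g: "g \<in> carrier F"
  show "b \<odot>\<^bsub>F\<^esub> f \<otimes>\<^bsub>F\<^esub> g = b \<odot>\<^bsub>F\<^esub> (f \<otimes>\<^bsub>F\<^esub> g)"
    using b f g by (intro monoid_algebra_eqI) (auto simp: closed pairing_mult lin pair_fun)
  show "b \<odot>\<^bsub>F\<^esub> (f \<oplus>\<^bsub>F\<^esub> g) = b \<odot>\<^bsub>F\<^esub> f \<oplus>\<^bsub>F\<^esub> b \<odot>\<^bsub>F\<^esub> g"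
    using b f g by (auto simp: pointwise r_distr)
next
  fix a b f assume "a \<in> carrier B" "b \<in> carrier B" "f \<in> carrier F"
  then have "f m \<in> carrier B" for m by (simp add: monoid_algebra_carrier)
  then show "(a \<oplus> b) \<odot>\<^bsub>F\<^esub> f = a \<odot>\<^bsub>F\<^esub> f \<oplus>\<^bsub>F\<^esub> b \<odot>\<^bsub>F\<^esub> f" "a \<otimes> b \<odot>\<^bsub>F\<^esub> f = a \<odot>\<^bsub>F\<^esub> (b \<odot>\<^bsub>F\<^esub> f)"
    using \<open>a \<in> carrier B\<close> \<open>b \<in> carrier B\<close> by (auto simp: monoid_algebra_simps l_distr m_assoc)
next
  fix f assume "f \<in> carrier F"
  then show "\<one> \<odot>\<^bsub>F\<^esub> f = f" by (auto simp: monoid_algebra_simps monoid_algebra_carrier)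
qed (auto simp: monoid_algebra_closed)

text \<open>An element is the combination of the basis elements in its support.\<close>

lemma monoid_algebra_induct:
  assumes f: "f \<in> carrier F" and N: "submodule N B F"
    and basis: "\<And>t. t \<in> carrier M \<Longrightarrow> basis_elem B t \<in> N"
  shows "f \<in> N"
proof -
  interpret F: algebra B F by (rule monoid_algebra)
  note Ncl = F.submoduleE[OF N]
  let ?P = "{p. f p \<noteq> \<zero>}"
  have P: "finite ?P" "?P \<subseteq> carrier M" and fc: "\<And>p. f p \<in> carrier B"
    using f by (auto simp: monoid_algebra_carrier)
  have bc: "\<And>t. t \<in> ?P \<Longrightarrow> basis_elem B t \<in> carrier F" using P monoid_algebra_closed by auto
  have "f = (\<Oplus>\<^bsub>F\<^esub>t\<in>?P. f t \<odot>\<^bsub>F\<^esub> basis_elem B t)"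
  proof (rule monoid_algebra_eqI)
    fix w assume w: "w \<in> carrier M \<rightarrow> carrier B"
    have wc: "\<And>p. p \<in> ?P \<Longrightarrow> w p \<in> carrier B" using w P by auto
    have "pairing B w (\<Oplus>\<^bsub>F\<^esub>t\<in>?P. f t \<odot>\<^bsub>F\<^esub> basis_elem B t)
        = (\<Oplus>t\<in>?P. pairing B w (f t \<odot>\<^bsub>F\<^esub> basis_elem B t))"
      using P fc bc by (intro F.linear_form_simps(4) pairing_linear_form w) auto
    also have "\<dots> = (\<Oplus>t\<in>?P. f t \<otimes> w t)"
      using P fc bc w wc by (intro finsum_cong' refl)
        (auto simp: pairing_linear_form[OF w, THEN linear_formD(3)] pairing_basis_elem)
    finally show "pairing B w f = pairing B w (\<Oplus>\<^bsub>F\<^esub>t\<in>?P. f t \<odot>\<^bsub>F\<^esub> basis_elem B t)"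
      by (simp add: pairing_def)
  qed (use f fc bc in \<open>auto intro!: F.M.finsum_closed\<close>)
  also have "\<dots> \<in> N"
  proof -
    have "(\<Oplus>\<^bsub>F\<^esub>t\<in>S. f t \<odot>\<^bsub>F\<^esub> basis_elem B t) \<in> N" if "finite S" "S \<subseteq> ?P" for S
      using that
    proof (induction S rule: finite_induct)
      case empty
      obtain x where "x \<in> N" using Ncl(2) by blast
      then have "\<zero> \<odot>\<^bsub>F\<^esub> x \<in> N" "x \<in> carrier F" using Ncl by auto
      then show ?case by simp
    next
      case (insert t S)
      then show ?case using Ncl basis fc bc P by (subst F.M.finsum_insert) auto
    qed
    then show ?thesis using P by blast
  qed
  finally show ?thesis .
qed

end

section \<open>Tensor powers\<close>

text \<open>The largest ideal inside the kernel of a linear form. To show that the form vanishes on a generated ideal it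
suffices that the generators lie in here.\<close>

lemma (in algebra) form_annihilator_ideal:
  assumes l: "linear_form R M l"
  shows "ideal {x \<in> carrier M. \<forall>h\<in>carrier M. l (h \<otimes>\<^bsub>M\<^esub> x) = \<zero>} M" (is "ideal ?K M")
proof (rule idealI)
  show "ring M" by (rule ring_axioms)
  note lD = linear_formD[OF l] linear_form_simps[OF l]
  show "subgroup ?K (add_monoid M)"
  proof (rule M.add.subgroupI)
    show "?K \<noteq> {}" using lD by (auto intro!: exI[of _ "\<zero>\<^bsub>M\<^esub>"])
    show "\<ominus>\<^bsub>M\<^esub> x \<in> ?K" if "x \<in> ?K" for x
      using that lD by (auto simp: r_minus)
    show "x \<oplus>\<^bsub>M\<^esub> y \<in> ?K" if "x \<in> ?K" "y \<in> ?K" for x y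
      using that lD by (auto simp: r_distr)
  qed auto
  show "y \<otimes>\<^bsub>M\<^esub> x \<in> ?K" if "x \<in> ?K" "y \<in> carrier M" for x y
    using that by (auto simp: m_assoc[symmetric])
  then show "x \<otimes>\<^bsub>M\<^esub> y \<in> ?K" if "x \<in> ?K" "y \<in> carrier M" for x y
    using that m_comm[of x y] by auto
qed

lemma (in algebra) form_annihilator_submodule:
  assumes l: "linear_form R M l" and x: "x \<in> carrier M"
  shows "submodule {h \<in> carrier M. l (h \<otimes>\<^bsub>M\<^esub> x) = \<zero>} R M"
proof (rule submoduleI)
  note lD = linear_formD[OF l] linear_form_simps[OF l]
  show "\<zero>\<^bsub>M\<^esub> \<in> {h \<in> carrier M. l (h \<otimes>\<^bsub>M\<^esub> x) = \<zero>}" using x lD by simp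
qed (use x linear_formD[OF l] linear_form_simps[OF l] in
    \<open>auto simp: l_minus l_distr smult_assoc2\<close>)

lemma (in module) linear_form_combination:
  assumes "finite P" "\<And>p. p \<in> P \<Longrightarrow> c p \<in> carrier R" "\<And>p. p \<in> P \<Longrightarrow> linear_form R M (l p)"
  shows "linear_form R M (\<lambda>x. \<Oplus>p\<in>P. c p \<otimes> l p x)"
proof -
  note lD = linear_formD[OF assms(3)]
  show ?thesis unfolding linear_form_def
  proof (intro conjI ballI funcsetI)
    fix x assume x: "x \<in> carrier M"
    show "(\<Oplus>p\<in>P. c p \<otimes> l p x) \<in> carrier R"
      using assms x lD by (intro R.finsum_closed) auto
    show "(\<Oplus>p\<in>P. c p \<otimes> l p (x \<oplus>\<^bsub>M\<^esub> y)) = (\<Oplus>p\<in>P. c p \<otimes> l p x) \<oplus> (\<Oplus>p\<in>P. c p \<otimes> l p y)"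
      if y: "y \<in> carrier M" for y
    proof -
      have "(\<Oplus>p\<in>P. c p \<otimes> l p (x \<oplus>\<^bsub>M\<^esub> y)) = (\<Oplus>p\<in>P. c p \<otimes> l p x \<oplus> c p \<otimes> l p y)"
        using assms x y lD by (intro R.finsum_cong') (auto simp: R.r_distr)
      also have "\<dots> = (\<Oplus>p\<in>P. c p \<otimes> l p x) \<oplus> (\<Oplus>p\<in>P. c p \<otimes> l p y)"
        using assms x y lD by (intro R.finsum_addf) auto
      finally show ?thesis .
    qed
    show "(\<Oplus>p\<in>P. c p \<otimes> l p (b \<odot>\<^bsub>M\<^esub> x)) = b \<otimes> (\<Oplus>p\<in>P. c p \<otimes> l p x)"
      if b: "b \<in> carrier R" for b
    proof -
      have "(\<Oplus>p\<in>P. c p \<otimes> l p (b \<odot>\<^bsub>M\<^esub> x)) = (\<Oplus>p\<in>P. b \<otimes> (c p \<otimes> l p x))"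
        using assms x b lD by (intro R.finsum_cong') (auto simp: R.m_lcomm)
      also have "\<dots> = b \<otimes> (\<Oplus>p\<in>P. c p \<otimes> l p x)"
        using assms x b lD by (intro R.finsum_rdistr[symmetric]) auto
      finally show ?thesis .
    qed
  qed
qed

lemma comm_monoid_product_group:
  assumes "\<And>i. i \<in> I \<Longrightarrow> comm_monoid (G i)"
  shows "comm_monoid (product_group I G)"
proof (rule comm_monoidI)
  note cm = assms[THEN comm_monoid.axioms(1)] assms
  let ?P = "product_group I G"
  show "x \<otimes>\<^bsub>?P\<^esub> y \<in> carrier ?P" if "x \<in> carrier ?P" "y \<in> carrier ?P" for x y
    using that by (auto simp: PiE_iff intro!: monoid.m_closed cm)
  show "\<one>\<^bsub>?P\<^esub> \<in> carrier ?P"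
    by (auto intro!: monoid.one_closed cm)
  show "x \<otimes>\<^bsub>?P\<^esub> y \<otimes>\<^bsub>?P\<^esub> z = x \<otimes>\<^bsub>?P\<^esub> (y \<otimes>\<^bsub>?P\<^esub> z)"
    if "x \<in> carrier ?P" "y \<in> carrier ?P" "z \<in> carrier ?P" for x y z
    using that by (auto simp: PiE_iff intro!: restrict_ext monoid.m_assoc cm)
  show "\<one>\<^bsub>?P\<^esub> \<otimes>\<^bsub>?P\<^esub> x = x" if "x \<in> carrier ?P" for x
    using that by (auto simp: PiE_iff extensional_def fun_eq_iff monoid.l_one[OF cm(1)])
  show "x \<otimes>\<^bsub>?P\<^esub> y = y \<otimes>\<^bsub>?P\<^esub> x" if "x \<in> carrier ?P" "y \<in> carrier ?P" for x y
    using that by (auto simp: PiE_iff intro!: restrict_ext comm_monoid.m_comm cm)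
qed

text \<open>The tensor power comes with three tools: multilinearity of pure tensors, generation by pure
tensors (\<open>tensor_power_induct\<close>), and the universal property for forms (\<open>tensor_power_linear_form\<close>).\<close>

locale algebra_power = A: algebra B A for B :: "('b, 'm) ring_scheme" (structure)
    and A :: "('b, 'a, 'k) module_scheme" +
  fixes n :: nat
begin

abbreviation "tuples \<equiv> {..<n} \<rightarrow>\<^sub>E carrier A"
abbreviation "TA \<equiv> tuple_algebra B A n"
abbreviation "T \<equiv> tensor_power B A n"
abbreviation "pt \<equiv> pure_tensor B A n"

lemma tuple_monoid_alg: "monoid_alg B (product_group {..<n} (\<lambda>_. A))"
  unfolding monoid_alg_def
  by (intro conjI A.R_cring comm_monoid_product_group A.comm_monoid_axioms)

sublocale TA: monoid_alg B "product_group {..<n} (\<lambda>_. A)"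
  rewrites "monoid_algebra B (product_group {..<n} (\<lambda>_. A)) = TA"
    and "carrier (product_group {..<n} (\<lambda>_. A)) = tuples"
  by (rule tuple_monoid_alg) (simp_all add: tuple_algebra_def)

sublocale TAA: algebra B TA by (rule TA.monoid_algebra)

lemma tuple_upd: "t \<in> tuples \<Longrightarrow> i < n \<Longrightarrow> a \<in> carrier A \<Longrightarrow> t(i := a) \<in> tuples"
  by (auto simp: PiE_iff extensional_def)

lemma basis_elem_upd_closed:
  "t \<in> tuples \<Longrightarrow> i < n \<Longrightarrow> a \<in> carrier A \<Longrightarrow> basis_elem B (t(i := a)) \<in> carrier TA"
  by (intro TA.monoid_algebra_closed tuple_upd)

lemma tensor_relations_cases:
  assumes "r \<in> tensor_relations B A n"
  obtains (add) t i a a' where "t \<in> tuples" "i < n" "a \<in> carrier A" "a' \<in> carrier A"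
      "r = basis_elem B (t(i := a \<oplus>\<^bsub>A\<^esub> a')) \<ominus>\<^bsub>TA\<^esub>
        (basis_elem B (t(i := a)) \<oplus>\<^bsub>TA\<^esub> basis_elem B (t(i := a')))"
    | (smult) t i a b where "t \<in> tuples" "i < n" "a \<in> carrier A" "b \<in> carrier B"
      "r = basis_elem B (t(i := b \<odot>\<^bsub>A\<^esub> a)) \<ominus>\<^bsub>TA\<^esub> b \<odot>\<^bsub>TA\<^esub> basis_elem B (t(i := a))"
  using assms unfolding tensor_relations_def Let_def by blast

lemma tensor_relations_closed: "tensor_relations B A n \<subseteq> carrier TA"
proof
  fix r assume "r \<in> tensor_relations B A n"
  then show "r \<in> carrier TA"
    by (cases rule: tensor_relations_cases) (simp_all add: basis_elem_upd_closed)
qed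

lemma tensor_ideal: "ideal (tensor_ideal B A n) TA"
  unfolding tensor_ideal_def by (rule TAA.genideal_ideal[OF tensor_relations_closed])

sublocale T: algebra B T
  unfolding tensor_power_def by (rule quot_algebra[OF TAA.algebra_axioms tensor_ideal])

abbreviation "proj \<equiv> quot_map TA (tensor_ideal B A n)"

lemma proj_hom: "proj \<in> alg_hom B TA T"
  unfolding tensor_power_def by (rule quot_map_alg_hom[OF TAA.algebra_axioms tensor_ideal])

lemma proj_surj: "proj ` carrier TA = carrier T"
  unfolding tensor_power_def by (rule quot_map_surj[OF TAA.algebra_axioms tensor_ideal])

lemma pure_tensor_proj: "pt t = proj (basis_elem B t)"
  by (simp add: pure_tensor_def quot_map_def)

lemma pure_tensor_closed: "t \<in> tuples \<Longrightarrow> pt t \<in> carrier T"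
  unfolding pure_tensor_proj by (intro alg_homD(2)[OF proj_hom] TA.monoid_algebra_closed)

lemma pure_tensor_one: "\<one>\<^bsub>T\<^esub> = pt (\<lambda>i\<in>{..<n}. \<one>\<^bsub>A\<^esub>)"
  using alg_homD(5)[OF proj_hom] unfolding pure_tensor_proj
  by (simp add: TA.monoid_algebra_simps)

lemma pure_tensor_mult:
  "s \<in> tuples \<Longrightarrow> t \<in> tuples \<Longrightarrow> pt s \<otimes>\<^bsub>T\<^esub> pt t = pt (\<lambda>i\<in>{..<n}. s i \<otimes>\<^bsub>A\<^esub> t i)"
  unfolding pure_tensor_proj
  by (simp add: alg_homD(4)[OF proj_hom, symmetric] TA.monoid_algebra_closed TA.basis_elem_mult)

lemma pure_tensor_add:
  assumes t: "t \<in> tuples" "i < n" "a \<in> carrier A" "a' \<in> carrier A"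
  shows "pt (t(i := a \<oplus>\<^bsub>A\<^esub> a')) = pt (t(i := a)) \<oplus>\<^bsub>T\<^esub> pt (t(i := a'))"
proof -
  let ?r = "basis_elem B (t(i := a)) \<oplus>\<^bsub>TA\<^esub> basis_elem B (t(i := a'))"
  have cl: "basis_elem B (t(i := a)) \<in> carrier TA" "basis_elem B (t(i := a')) \<in> carrier TA"
    "basis_elem B (t(i := a \<oplus>\<^bsub>A\<^esub> a')) \<in> carrier TA"
    using t by (simp_all add: basis_elem_upd_closed)
  have "basis_elem B (t(i := a \<oplus>\<^bsub>A\<^esub> a')) \<ominus>\<^bsub>TA\<^esub> ?r \<in> tensor_relations B A n"
    using t unfolding tensor_relations_def Let_def by blast
  then have "basis_elem B (t(i := a \<oplus>\<^bsub>A\<^esub> a')) \<ominus>\<^bsub>TA\<^esub> ?r \<in> tensor_ideal B A n"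
    unfolding tensor_ideal_def using TAA.genideal_self[OF tensor_relations_closed] by blast
  then have "proj (basis_elem B (t(i := a \<oplus>\<^bsub>A\<^esub> a'))) = proj ?r"
    using cl by (subst quot_map_eq_iff[OF TAA.algebra_axioms tensor_ideal]) simp_all
  then show ?thesis
    unfolding pure_tensor_proj using cl by (simp add: alg_homD(3)[OF proj_hom])
qed

lemma pure_tensor_smult:
  assumes t: "t \<in> tuples" "i < n" "a \<in> carrier A" "b \<in> carrier B"
  shows "pt (t(i := b \<odot>\<^bsub>A\<^esub> a)) = b \<odot>\<^bsub>T\<^esub> pt (t(i := a))"
proof -
  let ?r = "b \<odot>\<^bsub>TA\<^esub> basis_elem B (t(i := a))"
  have cl: "basis_elem B (t(i := a)) \<in> carrier TA" "basis_elem B (t(i := b \<odot>\<^bsub>A\<^esub> a)) \<in> carrier TA"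
    using t by (simp_all add: basis_elem_upd_closed)
  have "basis_elem B (t(i := b \<odot>\<^bsub>A\<^esub> a)) \<ominus>\<^bsub>TA\<^esub> ?r \<in> tensor_relations B A n"
    using t unfolding tensor_relations_def Let_def by blast
  then have "basis_elem B (t(i := b \<odot>\<^bsub>A\<^esub> a)) \<ominus>\<^bsub>TA\<^esub> ?r \<in> tensor_ideal B A n"
    unfolding tensor_ideal_def using TAA.genideal_self[OF tensor_relations_closed] by blast
  then have "proj (basis_elem B (t(i := b \<odot>\<^bsub>A\<^esub> a))) = proj ?r"
    using cl t by (subst quot_map_eq_iff[OF TAA.algebra_axioms tensor_ideal]) simp_all
  then show ?thesis
    unfolding pure_tensor_proj using cl t by (simp add: alg_homD(6)[OF proj_hom])
qed

lemma tensor_power_induct: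
  assumes v: "v \<in> carrier T" and N: "submodule N B T"
    and pure: "\<And>t. t \<in> tuples \<Longrightarrow> pt t \<in> N"
  shows "v \<in> N"
proof -
  have "f \<in> {f \<in> carrier TA. proj f \<in> N}" if "f \<in> carrier TA" for f
    by (rule TA.monoid_algebra_induct[OF that
        alg_hom_preimage_submodule[OF TAA.algebra_axioms T.algebra_axioms proj_hom N]])
      (auto simp: TA.monoid_algebra_closed pure_tensor_proj[symmetric] pure)
  moreover obtain f where "f \<in> carrier TA" "v = proj f" using v proj_surj by blast
  ultimately show ?thesis by blast
qed

text \<open>A multilinear map \<open>Q\<close> extends to the algebra of tuples and kills each multiple of a relation: multiplying a
relation by a tuple \<open>s\<close> gives a relation of the same kind, in which the entry \<open>i\<close> is multiplied by \<open>s i\<close>.\<close>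

lemma tensor_power_linear_form:
  assumes Q: "\<And>t. t \<in> tuples \<Longrightarrow> Q t \<in> carrier B"
    and Q_add: "\<And>t i a a'. \<lbrakk>t \<in> tuples; i < n; a \<in> carrier A; a' \<in> carrier A\<rbrakk> \<Longrightarrow>
      Q (t(i := a \<oplus>\<^bsub>A\<^esub> a')) = Q (t(i := a)) \<oplus> Q (t(i := a'))"
    and Q_smult: "\<And>t i a b. \<lbrakk>t \<in> tuples; i < n; a \<in> carrier A; b \<in> carrier B\<rbrakk> \<Longrightarrow>
      Q (t(i := b \<odot>\<^bsub>A\<^esub> a)) = b \<otimes> Q (t(i := a))"
  obtains l where "linear_form B T l" "\<And>t. t \<in> tuples \<Longrightarrow> l (pt t) = Q t"
proof -
  have Qf: "Q \<in> tuples \<rightarrow> carrier B" using Q by blast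
  define l where "l = pairing B Q"
  have l: "linear_form B TA l" unfolding l_def by (rule TA.pairing_linear_form[OF Qf])
  have l_basis: "l (basis_elem B t) = Q t" if "t \<in> tuples" for t
    unfolding l_def by (rule TA.pairing_basis_elem[OF that Qf])
  note lD = linear_formD[OF l] TAA.linear_form_simps[OF l]
  let ?K = "{x \<in> carrier TA. \<forall>h\<in>carrier TA. l (h \<otimes>\<^bsub>TA\<^esub> x) = \<zero>}"
  have upd_mult: "(\<lambda>k\<in>{..<n}. s k \<otimes>\<^bsub>A\<^esub> (t(i := a)) k) = (\<lambda>k\<in>{..<n}. s k \<otimes>\<^bsub>A\<^esub> t k)(i := s i \<otimes>\<^bsub>A\<^esub> a)"
    if "i < n" for s t :: "nat \<Rightarrow> 'a" and i a
    using that by auto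
  have st: "(\<lambda>k\<in>{..<n}. s k \<otimes>\<^bsub>A\<^esub> t k) \<in> tuples" if "s \<in> tuples" "t \<in> tuples" for s t
    using that by (auto simp: PiE_iff)
  note [simp] = TA.monoid_algebra_closed tuple_upd
  have K_I: "x \<in> ?K" if x: "x \<in> carrier TA"
    and bas: "\<And>s. s \<in> tuples \<Longrightarrow> l (basis_elem B s \<otimes>\<^bsub>TA\<^esub> x) = \<zero>" for x
  proof -
    have "h \<in> {h \<in> carrier TA. l (h \<otimes>\<^bsub>TA\<^esub> x) = \<zero>}" if "h \<in> carrier TA" for h
      using that TAA.form_annihilator_submodule[OF l x]
      by (rule TA.monoid_algebra_induct) (simp add: bas)
    then show ?thesis using x by blast
  qed
  have "tensor_relations B A n \<subseteq> ?K"
  proof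
    fix r assume "r \<in> tensor_relations B A n"
    then show "r \<in> ?K"
    proof (cases rule: tensor_relations_cases)
      case (add t i a a')
      show ?thesis
      proof (rule K_I)
        fix s assume s: "s \<in> tuples"
        define u where "u = (\<lambda>k\<in>{..<n}. s k \<otimes>\<^bsub>A\<^esub> t k)"
        have u: "u \<in> tuples" unfolding u_def using s add by (intro st)
        have si: "s i \<in> carrier A" using s add by auto
        have bm: "basis_elem B s \<otimes>\<^bsub>TA\<^esub> basis_elem B (t(i := c)) = basis_elem B (u(i := s i \<otimes>\<^bsub>A\<^esub> c))"
          if "c \<in> carrier A" for c
          using s add that unfolding u_def
          by (subst TA.basis_elem_mult) (simp_all only: mult_product_group upd_mult tuple_upd)
        have "l (basis_elem B s \<otimes>\<^bsub>TA\<^esub> r) = Q (u(i := s i \<otimes>\<^bsub>A\<^esub> a \<oplus>\<^bsub>A\<^esub> s i \<otimes>\<^bsub>A\<^esub> a')) \<ominus>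
            (Q (u(i := s i \<otimes>\<^bsub>A\<^esub> a)) \<oplus> Q (u(i := s i \<otimes>\<^bsub>A\<^esub> a')))"
          using s add u si
          by (simp add: TAA.minus_eq TAA.r_distr TAA.r_minus bm lD l_basis A.r_distr A.R.minus_eq)
        also have "\<dots> = \<zero>"
          using add u si by (simp add: Q_add Q tuple_upd A.R.minus_eq A.R.r_neg)
        finally show "l (basis_elem B s \<otimes>\<^bsub>TA\<^esub> r) = \<zero>" .
      qed (use add in simp)
    next
      case (smult t i a b)
      show ?thesis
      proof (rule K_I)
        fix s assume s: "s \<in> tuples"
        define u where "u = (\<lambda>k\<in>{..<n}. s k \<otimes>\<^bsub>A\<^esub> t k)"
        have u: "u \<in> tuples" unfolding u_def using s smult by (intro st)
        have si: "s i \<in> carrier A" using s smult by auto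
        have bm: "basis_elem B s \<otimes>\<^bsub>TA\<^esub> basis_elem B (t(i := c)) = basis_elem B (u(i := s i \<otimes>\<^bsub>A\<^esub> c))"
          if "c \<in> carrier A" for c
          using s smult that unfolding u_def
          by (subst TA.basis_elem_mult) (simp_all only: mult_product_group upd_mult tuple_upd)
        have sm: "f \<otimes>\<^bsub>TA\<^esub> (b \<odot>\<^bsub>TA\<^esub> g) = b \<odot>\<^bsub>TA\<^esub> (f \<otimes>\<^bsub>TA\<^esub> g)"
          if "f \<in> carrier TA" "g \<in> carrier TA" for f g
          using that smult by (metis TAA.smult_assoc2 TAA.m_comm TAA.smult_closed)
        have sA: "s i \<otimes>\<^bsub>A\<^esub> (b \<odot>\<^bsub>A\<^esub> a) = b \<odot>\<^bsub>A\<^esub> (s i \<otimes>\<^bsub>A\<^esub> a)"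
          using smult si by (metis A.smult_assoc2 A.m_comm A.smult_closed)
        have "l (basis_elem B s \<otimes>\<^bsub>TA\<^esub> r) = Q (u(i := b \<odot>\<^bsub>A\<^esub> (s i \<otimes>\<^bsub>A\<^esub> a))) \<ominus> b \<otimes> Q (u(i := s i \<otimes>\<^bsub>A\<^esub> a))"
          using s smult u si
          by (simp add: TAA.minus_eq TAA.r_distr TAA.r_minus bm lD l_basis sm sA A.R.minus_eq)
        also have "\<dots> = \<zero>"
          using smult u si by (simp add: Q_smult Q tuple_upd A.R.minus_eq A.R.r_neg)
        finally show "l (basis_elem B s \<otimes>\<^bsub>TA\<^esub> r) = \<zero>" .
      qed (use smult in simp)
    qed
  qed
  then have "tensor_ideal B A n \<subseteq> ?K"
    unfolding tensor_ideal_def by (intro TAA.genideal_minimal TAA.form_annihilator_ideal l)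
  then have "l x = \<zero>" if "x \<in> tensor_ideal B A n" for x
    using that TAA.one_closed TAA.l_one by (metis (mono_tags, lifting) mem_Collect_eq subsetD)
  from linear_form_quot[OF TAA.algebra_axioms tensor_ideal l this]
  obtain l' where "linear_form B T l'" "\<And>f. f \<in> carrier TA \<Longrightarrow> l' (proj f) = l f"
    unfolding tensor_power_def by metis
  then show thesis
    by (intro that[of l']) (auto simp: pure_tensor_proj l_basis)
qed

lemma tensor_power_product_form:
  assumes "\<And>i. i < n \<Longrightarrow> linear_form B A (f i)"
  obtains l where "linear_form B T l" "\<And>t. t \<in> tuples \<Longrightarrow> l (pt t) = (\<Otimes>i\<in>{..<n}. f i (t i))"
proof -
  note fD = linear_formD[OF assms]
  have split: "(\<Otimes>k\<in>{..<n}. f k ((t(i := a)) k)) = f i a \<otimes> (\<Otimes>k\<in>{..<n} - {i}. f k (t k))"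
    and rest: "(\<Otimes>k\<in>{..<n} - {i}. f k (t k)) \<in> carrier B"
    if "t \<in> tuples" "i < n" "a \<in> carrier A" for t i a
  proof -
    have t: "\<And>k. k < n \<Longrightarrow> t k \<in> carrier A" using that by auto
    then show rest: "(\<Otimes>k\<in>{..<n} - {i}. f k (t k)) \<in> carrier B"
      using fD by (intro A.R.finprod_closed) auto
    have "(\<Otimes>k\<in>{..<n}. f k ((t(i := a)) k)) = (\<Otimes>k\<in>insert i ({..<n} - {i}). f k ((t(i := a)) k))"
      using that by (simp add: insert_absorb)
    also have "\<dots> = f i a \<otimes> (\<Otimes>k\<in>{..<n} - {i}. f k ((t(i := a)) k))"
      using that t fD by (subst A.R.finprod_insert) auto
    also have "(\<Otimes>k\<in>{..<n} - {i}. f k ((t(i := a)) k)) = (\<Otimes>k\<in>{..<n} - {i}. f k (t k))"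
      using t fD by (intro A.R.finprod_cong') auto
    finally show "(\<Otimes>k\<in>{..<n}. f k ((t(i := a)) k)) = f i a \<otimes> (\<Otimes>k\<in>{..<n} - {i}. f k (t k))" .
  qed
  show thesis
  proof (rule tensor_power_linear_form[of "\<lambda>t. \<Otimes>i\<in>{..<n}. f i (t i)"])
    show "(\<Otimes>i\<in>{..<n}. f i (t i)) \<in> carrier B" if "t \<in> tuples" for t
      using that fD by (intro A.R.finprod_closed) auto
  qed (use that in \<open>simp_all add: split rest fD A.R.l_distr A.R.m_assoc del: fun_upd_apply\<close>)
qed

abbreviation "tf \<equiv> tensor_factor B A n"

lemma tensor_factor_alg_hom:
  assumes i: "i < n"
  shows "tf i \<in> alg_hom B A T"
proof -
  let ?u = "\<lambda>k\<in>{..<n}. \<one>\<^bsub>A\<^esub>"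
  have u: "?u \<in> tuples" by auto
  have upd: "(\<lambda>k\<in>{..<n}. if k = i then a else \<one>\<^bsub>A\<^esub>) = ?u(i := a)" for a using i by auto
  have mult: "(\<lambda>k\<in>{..<n}. (?u(i := a)) k \<otimes>\<^bsub>A\<^esub> (?u(i := a')) k) = ?u(i := a \<otimes>\<^bsub>A\<^esub> a')" for a a'
    using i by auto
  have one: "?u(i := \<one>\<^bsub>A\<^esub>) = ?u" using i by auto
  show ?thesis
    unfolding alg_hom_def ring_hom_def tensor_factor_def upd
    using i u by (auto simp: pure_tensor_closed tuple_upd pure_tensor_add pure_tensor_smult
        pure_tensor_one pure_tensor_mult mult one simp del: restrict_apply fun_upd_apply)
qed

end

section \<open>Elementary symmetric functions\<close>

text \<open>The elementary symmetric function \<open>e\<^sub>j\<close> of \<open>w 0, \<dots>, w (n - 1)\<close>.\<close>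

definition esym :: "('a, 'm) ring_scheme \<Rightarrow> nat \<Rightarrow> nat \<Rightarrow> (nat \<Rightarrow> 'a) \<Rightarrow> 'a"
  where "esym R n j w = (\<Oplus>\<^bsub>R\<^esub>S\<in>{S. S \<subseteq> {..<n} \<and> card S = j}. \<Otimes>\<^bsub>R\<^esub>i\<in>S. w i)"

lemma (in comm_monoid) finprod_group_card:
  assumes "finite I" "\<And>S. S \<subseteq> I \<Longrightarrow> g S \<in> carrier G"
  shows "finprod G g (Pow I) = (\<Otimes>j\<in>{..card I}. finprod G g {S. S \<subseteq> I \<and> card S = j})"
proof -
  have eq: "Pow I = (\<Union>j\<in>{..card I}. {S. S \<subseteq> I \<and> card S = j})"
    using assms(1) by (auto intro: card_mono)
  show ?thesis unfolding eq
    using assms by (intro finprod_UN_disjoint)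
      (auto simp: pairwise_def disjnt_def intro: finite_subset[of _ "Pow I"])
qed

context cring
begin

lemma finprod_add:
  assumes "finite I" "x \<in> I \<rightarrow> carrier R" "y \<in> I \<rightarrow> carrier R"
  shows "(\<Otimes>i\<in>I. x i \<oplus> y i) = (\<Oplus>S\<in>Pow I. (\<Otimes>i\<in>I - S. x i) \<otimes> (\<Otimes>i\<in>S. y i))"
  using assms
proof (induction I rule: finite_induct)
  case (insert a I)
  let ?g = "\<lambda>I S. (\<Otimes>i\<in>I - S. x i) \<otimes> (\<Otimes>i\<in>S. y i)"
  have cl: "x a \<in> carrier R" "y a \<in> carrier R" "x \<in> I \<rightarrow> carrier R" "y \<in> I \<rightarrow> carrier R"
    using insert by auto
  have fin: "finite S" if "S \<subseteq> I" for S using finite_subset[OF that insert(1)] .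
  have gcl: "?g I S \<in> carrier R" if "S \<subseteq> I" for S
    using that cl by (intro m_closed finprod_closed) auto
  have gcl': "?g (insert a I) S \<in> carrier R" if "S \<subseteq> insert a I" for S
    using that insert.prems by (intro m_closed finprod_closed) auto
  have g1: "?g (insert a I) S = x a \<otimes> ?g I S" if S: "S \<subseteq> I" for S
  proof -
    have "insert a I - S = insert a (I - S)" using S insert by auto
    moreover have "(\<Otimes>i\<in>insert a (I - S). x i) = x a \<otimes> (\<Otimes>i\<in>I - S. x i)"
      using insert cl by (intro finprod_insert) auto
    ultimately show ?thesis
      using cl S by (simp add: m_assoc finprod_closed Pi_iff subset_iff)
  qed
  have g2: "?g (insert a I) (insert a S) = y a \<otimes> ?g I S" if S: "S \<subseteq> I" for S
  proof -
    have "insert a I - insert a S = I - S" using S insert by auto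
    moreover have "(\<Otimes>i\<in>insert a S. y i) = y a \<otimes> (\<Otimes>i\<in>S. y i)"
      using insert cl S fin[OF S] by (intro finprod_insert) auto
    ultimately show ?thesis
      using cl S by (simp add: m_lcomm finprod_closed Pi_iff subset_iff)
  qed
  have inj: "inj_on (insert a) (Pow I)"
    using insert(2) by (auto simp: inj_on_def)
  have Gcl: "?g (insert a I) \<in> Pow I \<rightarrow> carrier R" "?g (insert a I) \<in> insert a ` Pow I \<rightarrow> carrier R"
    by (rule Pi_I, rule gcl', blast)+
  have "(\<Oplus>S\<in>Pow (insert a I). ?g (insert a I) S)
      = (\<Oplus>S\<in>Pow I. ?g (insert a I) S) \<oplus> (\<Oplus>S\<in>insert a ` Pow I. ?g (insert a I) S)"
    unfolding Pow_insert using insert(1,2) by (intro finsum_Un_disjoint Gcl) auto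
  also have "(\<Oplus>S\<in>insert a ` Pow I. ?g (insert a I) S) = (\<Oplus>S\<in>Pow I. ?g (insert a I) (insert a S))"
    using Gcl(2) inj by (rule finsum_reindex)
  also have "\<dots> = (\<Oplus>S\<in>Pow I. y a \<otimes> ?g I S)"
    using g2 cl gcl by (intro finsum_cong') auto
  also have "\<dots> = y a \<otimes> (\<Oplus>S\<in>Pow I. ?g I S)"
    using insert(1) cl gcl by (intro finsum_rdistr[symmetric]) auto
  also have "(\<Oplus>S\<in>Pow I. ?g (insert a I) S) = (\<Oplus>S\<in>Pow I. x a \<otimes> ?g I S)"
    using g1 cl gcl by (intro finsum_cong') auto
  also have "\<dots> = x a \<otimes> (\<Oplus>S\<in>Pow I. ?g I S)"
    using insert(1) cl gcl by (intro finsum_rdistr[symmetric]) auto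
  also have "x a \<otimes> (\<Oplus>S\<in>Pow I. ?g I S) \<oplus> y a \<otimes> (\<Oplus>S\<in>Pow I. ?g I S)
      = (x a \<oplus> y a) \<otimes> (\<Otimes>i\<in>I. x i \<oplus> y i)"
    using insert.IH cl gcl by (simp add: l_distr finsum_closed Pi_iff)
  also have "\<dots> = (\<Otimes>i\<in>insert a I. x i \<oplus> y i)"
    using insert(1,2) cl by (intro finprod_insert[symmetric]) auto
  finally show ?case ..
qed simp

lemma esym_closed: "w \<in> {..<n} \<rightarrow> carrier R \<Longrightarrow> esym R n j w \<in> carrier R"
  unfolding esym_def by (intro finsum_closed) (auto intro!: finprod_closed)

lemma esym_0: "esym R n 0 w = \<one>"
proof -
  have "S \<subseteq> {..<n} \<and> card S = 0 \<longleftrightarrow> S = {}" for S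
    by (metis card_0_eq card.empty empty_subsetI finite_lessThan finite_subset)
  then have "{S. S \<subseteq> {..<n} \<and> card S = 0} = {{}}" by simp
  then show ?thesis by (simp add: esym_def)
qed

lemma esym_eq_zero: "n < j \<Longrightarrow> esym R n j w = \<zero>"
proof -
  assume "n < j"
  have "card S \<le> n" if "S \<subseteq> {..<n}" for S
    using card_mono[OF finite_lessThan that] by simp
  with \<open>n < j\<close> have eq: "{S. S \<subseteq> {..<n} \<and> card S = j} = {}"
    by (metis (mono_tags, lifting) Collect_empty_eq leD)
  show ?thesis unfolding esym_def eq by simp
qed

lemma esym_cong:
  assumes "w \<in> {..<n} \<rightarrow> carrier R" "\<And>i. i < n \<Longrightarrow> w i = w' i"
  shows "esym R n j w = esym R n j w'"
  unfolding esym_def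
proof (rule finsum_cong'[OF refl])
  have "w' \<in> {..<n} \<rightarrow> carrier R" using assms by (simp add: Pi_iff)
  then show "(\<lambda>S. \<Otimes>i\<in>S. w' i) \<in> {S. S \<subseteq> {..<n} \<and> card S = j} \<rightarrow> carrier R"
    by (auto intro!: finprod_closed)
  fix S assume "S \<in> {S. S \<subseteq> {..<n} \<and> card S = j}"
  then show "(\<Otimes>i\<in>S. w i) = (\<Otimes>i\<in>S. w' i)"
    using assms by (intro finprod_cong) (auto simp: simp_implies_def)
qed

lemma esym_scale:
  assumes "w \<in> {..<n} \<rightarrow> carrier R" "b \<in> carrier R"
  shows "esym R n j (\<lambda>i. b \<otimes> w i) = b [^] j \<otimes> esym R n j w"
proof -
  have "esym R n j (\<lambda>i. b \<otimes> w i)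
      = (\<Oplus>S\<in>{S. S \<subseteq> {..<n} \<and> card S = j}. b [^] j \<otimes> (\<Otimes>i\<in>S. w i))"
    unfolding esym_def
  proof (rule finsum_cong'[OF refl])
    fix S assume S: "S \<in> {S. S \<subseteq> {..<n} \<and> card S = j}"
    then have "finite S" by (metis (mono_tags, lifting) finite_lessThan finite_subset mem_Collect_eq)
    moreover have "w \<in> S \<rightarrow> carrier R" using S assms by auto
    ultimately show "(\<Otimes>i\<in>S. b \<otimes> w i) = b [^] j \<otimes> (\<Otimes>i\<in>S. w i)"
      using S assms by (subst finprod_multf) (auto simp: finprod_const)
  qed (use assms in \<open>auto intro!: finprod_closed\<close>)
  also have "\<dots> = b [^] j \<otimes> esym R n j w"
  proof -
    have "finite {S. S \<subseteq> {..<n} \<and> card S = j}" by (rule finite_subset[of _ "Pow {..<n}"]) auto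
    then show ?thesis
      unfolding esym_def using assms by (intro finsum_rdistr[symmetric]) (auto intro!: finprod_closed)
  qed
  finally show ?thesis .
qed

end

lemma (in ring_hom_cring) hom_esym:
  assumes w: "w \<in> {..<n} \<rightarrow> carrier R"
  shows "h (esym R n j w) = esym S n j (h \<circ> w)"
proof -
  have "h (esym R n j w) = (\<Oplus>\<^bsub>S\<^esub>A\<in>{A. A \<subseteq> {..<n} \<and> card A = j}. (h \<circ> (\<lambda>A. \<Otimes>i\<in>A. w i)) A)"
    unfolding esym_def using w
    by (subst hom_finsum) (auto intro!: R.finprod_closed)
  also have "\<dots> = esym S n j (h \<circ> w)"
    unfolding esym_def
  proof (rule S.finsum_cong'[OF refl])
    fix A assume "A \<in> {A. A \<subseteq> {..<n} \<and> card A = j}"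
    then show "(h \<circ> (\<lambda>A. \<Otimes>i\<in>A. w i)) A = (\<Otimes>\<^bsub>S\<^esub>i\<in>A. (h \<circ> w) i)"
      using w by (simp add: comp_def, subst hom_finprod) (auto simp: comp_def)
  next
    have "h (w i) \<in> carrier S" if "i < n" for i using that w by auto
    then show "(\<lambda>A. \<Otimes>\<^bsub>S\<^esub>i\<in>A. (h \<circ> w) i) \<in> {A. A \<subseteq> {..<n} \<and> card A = j} \<rightarrow> carrier S"
      by (auto intro!: S.finprod_closed)
  qed
  finally show ?thesis .
qed

context UP_cring
begin

lemma finprod_monom:
  assumes "finite S" "w \<in> S \<rightarrow> carrier R"
  shows "(\<Otimes>\<^bsub>P\<^esub>i\<in>S. monom P (w i) k) = monom P (\<Otimes>i\<in>S. w i) (k * card S)"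
  using assms
proof (induction S rule: finite_induct)
  case empty
  show ?case by (simp only: P.finprod_empty R.finprod_empty card.empty mult_0_right monom_one)
next
  case (insert a S)
  then have w: "w a \<in> carrier R" "w \<in> S \<rightarrow> carrier R" by auto
  then have prod: "(\<Otimes>i\<in>S. w i) \<in> carrier R" by (intro R.finprod_closed)
  have "(\<Otimes>\<^bsub>P\<^esub>i\<in>insert a S. monom P (w i) k) = monom P (w a) k \<otimes>\<^bsub>P\<^esub> (\<Otimes>\<^bsub>P\<^esub>i\<in>S. monom P (w i) k)"
    using insert(1,2) w by (intro P.finprod_insert) (simp_all add: Pi_iff)
  also have "\<dots> = monom P (w a \<otimes> (\<Otimes>i\<in>S. w i)) (k + k * card S)"
    unfolding insert.IH[OF w(2)] by (rule monom_mult[OF w(1) prod, symmetric])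
  also have "w a \<otimes> (\<Otimes>i\<in>S. w i) = (\<Otimes>i\<in>insert a S. w i)"
    using insert(1,2) w by (intro R.finprod_insert[symmetric])
  finally show ?case unfolding card_insert_disjoint[OF insert(1,2)] mult_Suc_right .
qed

definition esym_poly :: "nat \<Rightarrow> (nat \<Rightarrow> 'a) \<Rightarrow> nat \<Rightarrow> 'a"
  where "esym_poly n w = (\<Otimes>\<^bsub>P\<^esub>i\<in>{..<n}. \<one>\<^bsub>P\<^esub> \<oplus>\<^bsub>P\<^esub> monom P (w i) 1)"

text \<open>With \<open>p = 1\<close>, \<open>k = 1\<close> this is the generating polynomial of the elementary symmetric functions. With \<open>p = X\<close>, \<open>k = 0\<close>
it is Vieta's formula. With \<open>p = 1 + b s\<close>, \<open>k = 1\<close> it describes the effect of a translation by \<open>b\<close>.\<close>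

lemma finprod_add_monom:
  assumes p: "p \<in> carrier P" and w: "w \<in> {..<n} \<rightarrow> carrier R"
  shows "(\<Otimes>\<^bsub>P\<^esub>i\<in>{..<n}. p \<oplus>\<^bsub>P\<^esub> monom P (w i) k)
    = (\<Oplus>\<^bsub>P\<^esub>j\<in>{..n}. p [^]\<^bsub>P\<^esub> (n - j) \<otimes>\<^bsub>P\<^esub> monom P (esym R n j w) (k * j))"
proof -
  let ?g = "\<lambda>S. p [^]\<^bsub>P\<^esub> (n - card S) \<otimes>\<^bsub>P\<^esub> monom P (\<Otimes>i\<in>S. w i) (k * card S)"
  have prod_cl: "(\<Otimes>i\<in>S. w i) \<in> carrier R" if "S \<subseteq> {..<n}" for S
    using that w by (intro R.finprod_closed) auto
  have "(\<Otimes>\<^bsub>P\<^esub>i\<in>{..<n}. p \<oplus>\<^bsub>P\<^esub> monom P (w i) k)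
      = (\<Oplus>\<^bsub>P\<^esub>S\<in>Pow {..<n}. (\<Otimes>\<^bsub>P\<^esub>i\<in>{..<n} - S. p) \<otimes>\<^bsub>P\<^esub> (\<Otimes>\<^bsub>P\<^esub>i\<in>S. monom P (w i) k))"
    using p w by (intro P.finprod_add) (simp_all add: Pi_iff)
  also have "\<dots> = (\<Oplus>\<^bsub>P\<^esub>S\<in>Pow {..<n}. ?g S)"
  proof (rule P.finsum_cong'[OF refl])
    fix S assume "S \<in> Pow {..<n}"
    then have S: "S \<subseteq> {..<n}" "finite S" by (simp_all add: finite_subset[OF _ finite_lessThan])
    have "w \<in> S \<rightarrow> carrier R" using S w by auto
    then show "(\<Otimes>\<^bsub>P\<^esub>i\<in>{..<n} - S. p) \<otimes>\<^bsub>P\<^esub> (\<Otimes>\<^bsub>P\<^esub>i\<in>S. monom P (w i) k) = ?g S"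
      using S p by (simp add: P.finprod_const finprod_monom card_Diff_subset)
  qed (use p prod_cl in \<open>simp add: Pi_iff\<close>)
  also have "\<dots> = (\<Oplus>\<^bsub>P\<^esub>j\<in>{..n}. \<Oplus>\<^bsub>P\<^esub>S\<in>{S. S \<subseteq> {..<n} \<and> card S = j}. ?g S)"
    using p prod_cl by (subst P.add.finprod_group_card) simp_all
  also have "\<dots> = (\<Oplus>\<^bsub>P\<^esub>j\<in>{..n}. p [^]\<^bsub>P\<^esub> (n - j) \<otimes>\<^bsub>P\<^esub> monom P (esym R n j w) (k * j))"
  proof (rule P.finsum_cong'[OF refl])
    show "(\<lambda>j. p [^]\<^bsub>P\<^esub> (n - j) \<otimes>\<^bsub>P\<^esub> monom P (esym R n j w) (k * j)) \<in> {..n} \<rightarrow> carrier P"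
      using p R.esym_closed[OF w] by (simp add: Pi_iff)
    fix j
    let ?A = "{S. S \<subseteq> {..<n} \<and> card S = j}"
    have fin: "finite ?A" by (rule finite_subset[of _ "Pow {..<n}"]) auto
    have "(\<Oplus>\<^bsub>P\<^esub>S\<in>?A. ?g S) = (\<Oplus>\<^bsub>P\<^esub>S\<in>?A. p [^]\<^bsub>P\<^esub> (n - j) \<otimes>\<^bsub>P\<^esub> monom P (\<Otimes>i\<in>S. w i) (k * j))"
      using p prod_cl by (intro P.finsum_cong') (simp_all add: Pi_iff)
    also have "\<dots> = p [^]\<^bsub>P\<^esub> (n - j) \<otimes>\<^bsub>P\<^esub> (\<Oplus>\<^bsub>P\<^esub>S\<in>?A. monom P (\<Otimes>i\<in>S. w i) (k * j))"
      using p prod_cl fin by (intro P.finsum_rdistr[symmetric]) (simp_all add: Pi_iff)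
    also have "(\<Oplus>\<^bsub>P\<^esub>S\<in>?A. monom P (\<Otimes>i\<in>S. w i) (k * j)) = monom P (esym R n j w) (k * j)"
    proof (rule up_eqI)
      have esym_if: "(\<Oplus>S\<in>?A. if k * j = m then \<Otimes>i\<in>S. w i else \<zero>) = (if k * j = m then esym R n j w else \<zero>)" for m
        by (simp add: esym_def)
      show "coeff P (\<Oplus>\<^bsub>P\<^esub>S\<in>?A. monom P (\<Otimes>i\<in>S. w i) (k * j)) m = coeff P (monom P (esym R n j w) (k * j)) m" for m
      proof -
        have "coeff P (\<Oplus>\<^bsub>P\<^esub>S\<in>?A. monom P (\<Otimes>i\<in>S. w i) (k * j)) m
            = (\<Oplus>S\<in>?A. coeff P (monom P (\<Otimes>i\<in>S. w i) (k * j)) m)"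
          using prod_cl by (intro coeff_finsum fin) (simp add: Pi_iff)
        also have "\<dots> = (\<Oplus>S\<in>?A. if k * j = m then \<Otimes>i\<in>S. w i else \<zero>)"
          using prod_cl by (intro R.finsum_cong') (simp_all add: Pi_iff)
        also have "\<dots> = coeff P (monom P (esym R n j w) (k * j)) m"
          using R.esym_closed[OF w] by (simp add: esym_if)
        finally show ?thesis .
      qed
    qed (use prod_cl R.esym_closed[OF w] in \<open>simp_all add: Pi_iff P.finsum_closed\<close>)
    finally show "(\<Oplus>\<^bsub>P\<^esub>S\<in>?A. ?g S) = p [^]\<^bsub>P\<^esub> (n - j) \<otimes>\<^bsub>P\<^esub> monom P (esym R n j w) (k * j)" .
  qed
  finally show ?thesis .
qed

lemma coeff_esym_poly:
  assumes w: "w \<in> {..<n} \<rightarrow> carrier R"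
  shows "coeff P (esym_poly n w) j = esym R n j w"
proof -
  note cl = R.esym_closed[OF w]
  have "esym_poly n w = (\<Oplus>\<^bsub>P\<^esub>i\<in>{..n}. monom P (esym R n i w) i)"
    unfolding esym_poly_def using cl
    by (subst finprod_add_monom[OF P.one_closed w]) (intro P.finsum_cong', simp_all add: Pi_iff)
  then have "coeff P (esym_poly n w) j = (\<Oplus>i\<in>{..n}. if j = i then esym R n i w else \<zero>)"
    using cl by (simp add: coeff_finsum Pi_iff) (intro R.finsum_cong', simp_all add: Pi_iff)
  also have "\<dots> = esym R n j w"
  proof (cases "j \<le> n")
    case True
    then show ?thesis using cl by (intro R.finsum_singleton) (simp_all add: Pi_iff)
  next
    case False
    then have "(\<Oplus>i\<in>{..n}. if j = i then esym R n i w else \<zero>) = (\<Oplus>i\<in>{..n}. \<zero>)"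
      by (intro R.finsum_cong') simp_all
    then show ?thesis using False by (simp add: R.esym_eq_zero)
  qed
  finally show ?thesis .
qed

lemma esym_poly_closed: "w \<in> {..<n} \<rightarrow> carrier R \<Longrightarrow> esym_poly n w \<in> carrier P"
  unfolding esym_poly_def by (intro P.finprod_closed) (simp add: Pi_iff)

lemma esym_poly_eq_one_iff:
  assumes w: "w \<in> {..<n} \<rightarrow> carrier R"
  shows "esym_poly n w = \<one>\<^bsub>P\<^esub> \<longleftrightarrow> (\<forall>j>0. esym R n j w = \<zero>)"
proof
  assume "esym_poly n w = \<one>\<^bsub>P\<^esub>"
  then show "\<forall>j>0. esym R n j w = \<zero>" by (simp add: coeff_esym_poly[OF w, symmetric])
next
  assume "\<forall>j>0. esym R n j w = \<zero>"
  then show "esym_poly n w = \<one>\<^bsub>P\<^esub>"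
    using w by (intro up_eqI) (simp_all add: coeff_esym_poly R.esym_0 esym_poly_closed)
qed

text \<open>Here \<open>(1 + w\<^sub>i s)(1 + v\<^sub>i s) = 1 + (w\<^sub>i + v\<^sub>i) s\<close> because \<open>w\<^sub>i v\<^sub>i = 0\<close>.\<close>

lemma esym_poly_add:
  assumes w: "w \<in> {..<n} \<rightarrow> carrier R" and v: "v \<in> {..<n} \<rightarrow> carrier R"
    and orth: "\<And>i. i < n \<Longrightarrow> w i \<otimes> v i = \<zero>"
  shows "esym_poly n (\<lambda>i. w i \<oplus> v i) = esym_poly n w \<otimes>\<^bsub>P\<^esub> esym_poly n v"
proof -
  have "esym_poly n w \<otimes>\<^bsub>P\<^esub> esym_poly n v = (\<Otimes>\<^bsub>P\<^esub>i\<in>{..<n}.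
      (\<one>\<^bsub>P\<^esub> \<oplus>\<^bsub>P\<^esub> monom P (w i) 1) \<otimes>\<^bsub>P\<^esub> (\<one>\<^bsub>P\<^esub> \<oplus>\<^bsub>P\<^esub> monom P (v i) 1))"
    unfolding esym_poly_def using w v by (intro P.finprod_multf[symmetric]) (simp_all add: Pi_iff)
  also have "\<dots> = esym_poly n (\<lambda>i. w i \<oplus> v i)"
    unfolding esym_poly_def
  proof (rule P.finprod_cong'[OF refl])
    fix i assume i: "i \<in> {..<n}"
    then have c: "w i \<in> carrier R" "v i \<in> carrier R" using w v by auto
    have "monom P (w i) 1 \<otimes>\<^bsub>P\<^esub> monom P (v i) 1 = \<zero>\<^bsub>P\<^esub>"
      using c i orth by (simp add: monom_mult[symmetric] del: monom_mult)
    then show "(\<one>\<^bsub>P\<^esub> \<oplus>\<^bsub>P\<^esub> monom P (w i) 1) \<otimes>\<^bsub>P\<^esub> (\<one>\<^bsub>P\<^esub> \<oplus>\<^bsub>P\<^esub> monom P (v i) 1)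
        = \<one>\<^bsub>P\<^esub> \<oplus>\<^bsub>P\<^esub> monom P (w i \<oplus> v i) 1"
      using c by (simp add: P.l_distr P.r_distr P.a_ac del: monom_mult)
  qed (use w v in \<open>simp add: Pi_iff\<close>)
  finally show ?thesis ..
qed

end

context cring
begin

lemma esym_add_zero:
  assumes w: "w \<in> {..<n} \<rightarrow> carrier R" and v: "v \<in> {..<n} \<rightarrow> carrier R"
    and orth: "\<And>i. i < n \<Longrightarrow> w i \<otimes> v i = \<zero>"
    and "\<forall>j>0. esym R n j w = \<zero>" "\<forall>j>0. esym R n j v = \<zero>"
  shows "\<forall>j>0. esym R n j (\<lambda>i. w i \<oplus> v i) = \<zero>"
proof -
  interpret P: UP_cring R "UP R" by (simp add: UP_cring_def is_cring)
  have "(\<lambda>i. w i \<oplus> v i) \<in> {..<n} \<rightarrow> carrier R" using w v by auto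
  moreover have "P.esym_poly n (\<lambda>i. w i \<oplus> v i) = \<one>\<^bsub>UP R\<^esub>"
    using P.esym_poly_add[OF w v orth] assms(4,5) P.esym_poly_eq_one_iff[OF w] P.esym_poly_eq_one_iff[OF v]
    by simp
  ultimately show ?thesis by (simp add: P.esym_poly_eq_one_iff)
qed

lemma esym_translate:
  assumes b: "b \<in> carrier R" and w: "w \<in> {..<n} \<rightarrow> carrier R"
    and zero: "\<forall>j>0. esym R n j w = \<zero>"
  shows "esym R n j (\<lambda>i. b \<oplus> w i) = esym R n j (\<lambda>i. b)"
proof -
  interpret P: UP_cring R "UP R" by (simp add: UP_cring_def is_cring)
  let ?p = "\<one>\<^bsub>UP R\<^esub> \<oplus>\<^bsub>UP R\<^esub> monom (UP R) b 1"
  have p: "?p \<in> carrier (UP R)" using b by simp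
  have wc: "\<And>i. i < n \<Longrightarrow> w i \<in> carrier R" using w by auto
  have "P.esym_poly n (\<lambda>i. b \<oplus> w i) = (\<Otimes>\<^bsub>UP R\<^esub>i\<in>{..<n}. ?p \<oplus>\<^bsub>UP R\<^esub> monom (UP R) (w i) 1)"
    unfolding P.esym_poly_def using b w wc
    by (intro P.P.finprod_cong') (simp_all add: P.P.a_assoc Pi_iff)
  also have "\<dots> = (\<Oplus>\<^bsub>UP R\<^esub>j\<in>{..n}. ?p [^]\<^bsub>UP R\<^esub> (n - j) \<otimes>\<^bsub>UP R\<^esub> monom (UP R) (esym R n j w) (1 * j))"
    using p w by (rule P.finprod_add_monom)
  also have "\<dots> = (\<Oplus>\<^bsub>UP R\<^esub>j\<in>{..n}. if 0 = j then ?p [^]\<^bsub>UP R\<^esub> (n - j) else \<zero>\<^bsub>UP R\<^esub>)"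
    using zero p by (intro P.P.finsum_cong') (simp_all add: esym_0 Pi_iff)
  also have "\<dots> = ?p [^]\<^bsub>UP R\<^esub> n"
    using p by (subst P.P.finsum_singleton) (simp_all add: Pi_iff)
  also have "\<dots> = P.esym_poly n (\<lambda>i. b)"
    unfolding P.esym_poly_def using p by (subst P.P.finprod_const) simp_all
  finally have "P.esym_poly n (\<lambda>i. b \<oplus> w i) = P.esym_poly n (\<lambda>i. b)" .
  then have "coeff (UP R) (P.esym_poly n (\<lambda>i. b \<oplus> w i)) j = coeff (UP R) (P.esym_poly n (\<lambda>i. b)) j"
    by simp
  then show ?thesis using b wc by (subst (asm) (1 2) P.coeff_esym_poly) (simp_all add: Pi_iff)
qed

text \<open>The coefficients of \<open>(X - b)\<^sup>n\<close> are, up to sign, the elementary symmetric functions of \<open>n\<close> copies of \<open>b\<close>. This form,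
unlike a binomial coefficient, is what \<open>esym_translate\<close> produces on the side of the conjugates.\<close>

lemma coeff_linear_power:
  assumes b: "b \<in> carrier R" and "j \<le> n"
  shows "(\<ominus> \<one>) [^] j \<otimes>
    coeff (UP R) ((monom (UP R) \<one> 1 \<ominus>\<^bsub>UP R\<^esub> monom (UP R) b 0) [^]\<^bsub>UP R\<^esub> n) (n - j) = esym R n j (\<lambda>i. b)"
proof -
  interpret P: UP_cring R "UP R" by (simp add: UP_cring_def is_cring)
  let ?X = "monom (UP R) \<one> 1"
  have w: "(\<lambda>i. \<ominus> b) \<in> {..<n} \<rightarrow> carrier R" using b by auto
  note cl = esym_closed[OF w]
  have "(?X \<ominus>\<^bsub>UP R\<^esub> monom (UP R) b 0) [^]\<^bsub>UP R\<^esub> n = (\<Otimes>\<^bsub>UP R\<^esub>i\<in>{..<n}. ?X \<oplus>\<^bsub>UP R\<^esub> monom (UP R) (\<ominus> b) 0)"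
    using b by (subst P.P.finprod_const) (simp_all add: P.P.minus_eq P.monom_a_inv)
  also have "\<dots> = (\<Oplus>\<^bsub>UP R\<^esub>i\<in>{..n}. ?X [^]\<^bsub>UP R\<^esub> (n - i) \<otimes>\<^bsub>UP R\<^esub> monom (UP R) (esym R n i (\<lambda>i. \<ominus> b)) (0 * i))"
    by (rule P.finprod_add_monom) (use w in simp_all)
  also have "\<dots> = (\<Oplus>\<^bsub>UP R\<^esub>i\<in>{..n}. monom (UP R) (esym R n i (\<lambda>i. \<ominus> b)) (n - i))"
    using cl by (intro P.P.finsum_cong') (simp_all add: P.monom_pow P.monom_mult[symmetric] Pi_iff del: P.monom_mult)
  finally have "coeff (UP R) ((?X \<ominus>\<^bsub>UP R\<^esub> monom (UP R) b 0) [^]\<^bsub>UP R\<^esub> n) (n - j)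
      = (\<Oplus>i\<in>{..n}. coeff (UP R) (monom (UP R) (esym R n i (\<lambda>i. \<ominus> b)) (n - i)) (n - j))"
    using cl by (simp add: P.coeff_finsum Pi_iff)
  also have "\<dots> = (\<Oplus>i\<in>{..n}. if j = i then esym R n i (\<lambda>i. \<ominus> b) else \<zero>)"
    using cl \<open>j \<le> n\<close> by (intro finsum_cong') auto
  also have "\<dots> = esym R n j (\<lambda>i. \<ominus> b)"
    using cl \<open>j \<le> n\<close> by (intro finsum_singleton) auto
  also have "(\<ominus> \<one>) [^] j \<otimes> \<dots> = esym R n j (\<lambda>i. (\<ominus> \<one>) \<otimes> \<ominus> b)"
    using w by (subst esym_scale) auto
  also have "\<dots> = esym R n j (\<lambda>i. b)"
    using b by (intro esym_cong) (auto simp: l_minus r_minus)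
  finally show ?thesis .
qed

end

section \<open>The characteristic polynomial of a scalar plus a rank one map\<close>

lemma (in abelian_group) minus_add_distrib:
  "x \<in> carrier G \<Longrightarrow> y \<in> carrier G \<Longrightarrow> z \<in> carrier G \<Longrightarrow> x \<ominus> (y \<oplus> z) = x \<ominus> y \<ominus> z"
  by (simp add: minus_eq minus_add a_assoc)

context ring
begin

definition perm_sign :: "(nat \<Rightarrow> nat) \<Rightarrow> 'a"
  where "perm_sign p = (if evenperm p then \<one> else \<ominus> \<one>)"

lemma perm_sign_closed [simp]: "perm_sign p \<in> carrier R"
  by (simp add: perm_sign_def)

text \<open>Composition with a transposition exchanges even and odd permutations. Since \<open>2\<close> may be a zero divisor, the sum is
split into its even and odd part instead of being compared with its negative.\<close>

lemma finsum_perm_sign: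
  assumes S: "finite S" "2 \<le> card S"
  shows "(\<Oplus>p\<in>{p. p permutes S}. perm_sign p) = \<zero>"
proof -
  obtain a b where ab: "a \<in> S" "b \<in> S" "a \<noteq> b"
    using S by (metis card_le_Suc0_iff_eq not_less_eq_eq numeral_2_eq_2)
  let ?E = "{p. p permutes S \<and> evenperm p}" and ?O = "{p. p permutes S \<and> \<not> evenperm p}"
  let ?f = "\<lambda>p. transpose a b \<circ> p"
  have fin: "finite ?E" "finite ?O" using finite_permutations[OF S(1)] by auto
  have ff: "?f (?f p) = p" for p by (simp add: fun_eq_iff)
  have perm: "?f p permutes S" if "p permutes S" for p
    using that ab by (intro permutes_compose permutes_swap_id)
  have even: "evenperm (?f p) \<longleftrightarrow> \<not> evenperm p" if "p permutes S" for p
  proof -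
    have "permutation p" using that S(1) by (metis permutation_permutes)
    then show ?thesis using ab by (simp add: evenperm_comp permutation_swap_id evenperm_swap)
  qed
  have image: "?O = ?f ` ?E"
  proof (intro equalityI subsetI)
    fix q assume q: "q \<in> ?O"
    then have "?f q \<in> ?E" using perm[of q] even[of q] by simp
    then show "q \<in> ?f ` ?E" using ff[of q] by (metis (no_types, lifting) image_eqI)
  next
    fix q assume "q \<in> ?f ` ?E"
    then obtain p where "p permutes S" "evenperm p" "q = ?f p" by auto
    then show "q \<in> ?O" using perm[of p] even[of p] by simp
  qed
  have inj: "inj_on ?f ?E" by (metis (no_types, lifting) ff inj_onI)
  have union: "{p. p permutes S} = ?E \<union> ?O" by blast
  have disj: "?E \<inter> ?O = {}" by blast
  have "(\<Oplus>p\<in>{p. p permutes S}. perm_sign p) = (\<Oplus>p\<in>?E. perm_sign p) \<oplus> (\<Oplus>p\<in>?O. perm_sign p)"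
    unfolding union by (rule finsum_Un_disjoint[OF fin disj]) simp_all
  also have "(\<Oplus>p\<in>?O. perm_sign p) = (\<Oplus>p\<in>?E. perm_sign (?f p))"
    unfolding image using inj by (intro finsum_reindex) simp_all
  also have "\<dots> = (\<Oplus>p\<in>?E. \<ominus> \<one>)"
    using even by (intro finsum_cong') (auto simp: perm_sign_def)
  also have "(\<Oplus>p\<in>?E. perm_sign p) = (\<Oplus>p\<in>?E. \<one>)"
    by (intro finsum_cong') (auto simp: perm_sign_def)
  also have "(\<Oplus>p\<in>?E. \<one>) \<oplus> (\<Oplus>p\<in>?E. \<ominus> \<one>) = (\<Oplus>p\<in>?E. \<one> \<oplus> \<ominus> \<one>)"
    by (intro finsum_addf[symmetric]) auto
  also have "\<dots> = \<zero>" by (simp add: r_neg)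
  finally show ?thesis .
qed

end

context cring
begin

lemma finprod_permute:
  assumes "p permutes S" "finite S" "r \<in> S \<rightarrow> carrier R"
  shows "(\<Otimes>i\<in>S. r (p i)) = (\<Otimes>i\<in>S. r i)"
proof -
  have "(\<Otimes>i\<in>p ` S. r i) = (\<Otimes>i\<in>S. r (p i))"
    using assms by (intro finprod_reindex) (auto simp: permutes_image permutes_inj_on)
  then show ?thesis using assms by (simp add: permutes_image)
qed

text \<open>Expand each product over the set \<open>S\<close> of the indices at which the rank one term is chosen. A permutation contributes
only if it fixes all other indices, and then the product of the rank one terms does not depend on the
permutation. So the signs of all permutations of \<open>S\<close> are summed, which gives zero unless \<open>S\<close> has at most one element. The singletons
add up to a multiple of the trace.\<close>

lemma ring_det_rank_one_update:
  assumes t: "t \<in> carrier R" and c: "c \<in> {..<n} \<rightarrow> carrier R" and r: "r \<in> {..<n} \<rightarrow> carrier R"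
    and trace: "(\<Oplus>i\<in>{..<n}. c i \<otimes> r i) = \<zero>"
  shows "ring_det R n (\<lambda>i j. (if i = j then t else \<zero>) \<ominus> c i \<otimes> r j) = t [^] n"
proof -
  let ?I = "{..<n}"
  \<comment> \<open>The contribution of a set \<open>S\<close> on which the rank one term is chosen, up to the sign of the permutation.\<close>
  define Y where "Y S = (\<Otimes>i\<in>S. \<ominus> c i) \<otimes> (\<Otimes>i\<in>S. r i)" for S
  define D where "D S = t [^] (n - card S) \<otimes> Y S" for S
  have cc: "c i \<in> carrier R" "r i \<in> carrier R" if "i < n" for i using that c r by auto
  have fin: "finite S" if "S \<subseteq> ?I" for S by (rule finite_subset[OF that finite_lessThan])
  have Y: "Y S \<in> carrier R" if "S \<subseteq> ?I" for S
    unfolding Y_def using that cc by (intro m_closed finprod_closed Pi_I a_inv_closed) auto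
  then have D: "D S \<in> carrier R" if "S \<subseteq> ?I" for S unfolding D_def using that t by simp
  have finp: "finite {p. p permutes ?I}" by (rule finite_permutations) simp
  have expand: "perm_sign p \<otimes> (\<Otimes>i\<in>?I. (if i = p i then t else \<zero>) \<ominus> c i \<otimes> r (p i))
      = (\<Oplus>S\<in>Pow ?I. if p permutes S then perm_sign p \<otimes> D S else \<zero>)" if p: "p permutes ?I" for p
  proof -
    let ?x = "\<lambda>i. if i = p i then t else \<zero>" and ?y = "\<lambda>i. (\<ominus> c i) \<otimes> r (p i)"
    have pi: "p i < n" if "i < n" for i using that permutes_in_image[OF p, of i] by simp
    have x: "?x \<in> ?I \<rightarrow> carrier R" using t by auto
    have yc: "?y i \<in> carrier R" if "i < n" for i using that cc pi by simp
    have summand: "(\<Otimes>i\<in>?I - S. ?x i) \<otimes> (\<Otimes>i\<in>S. ?y i) = (if p permutes S then D S else \<zero>)"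
      if S: "S \<subseteq> ?I" for S
    proof (cases "p permutes S")
      case True
      have "(\<Otimes>i\<in>?I - S. ?x i) = (\<Otimes>i\<in>?I - S. t)"
        using True t by (intro finprod_cong') (auto simp: permutes_not_in)
      also have "\<dots> = t [^] (n - card S)"
        using t S fin[OF S] by (subst finprod_const) (auto simp: card_Diff_subset)
      finally have 1: "(\<Otimes>i\<in>?I - S. ?x i) = t [^] (n - card S)" .
      have Sc: "c i \<in> carrier R" "r i \<in> carrier R" "r (p i) \<in> carrier R" if "i \<in> S" for i
        using that S cc pi by auto
      have "(\<Otimes>i\<in>S. ?y i) = (\<Otimes>i\<in>S. \<ominus> c i) \<otimes> (\<Otimes>i\<in>S. r (p i))"
        using Sc by (intro finprod_multf) auto
      also have "(\<Otimes>i\<in>S. r (p i)) = (\<Otimes>i\<in>S. r i)"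
        using Sc by (intro finprod_permute True fin S) auto
      finally show ?thesis using True 1 by (simp add: D_def Y_def)
    next
      case False
      have "\<exists>i\<in>?I - S. p i \<noteq> i"
      proof (rule ccontr)
        assume *: "\<not> (\<exists>i\<in>?I - S. p i \<noteq> i)"
        have "p permutes S" by (rule permutes_superset[OF p]) (use * in blast)
        then show False using False by simp
      qed
      then obtain i where i: "i \<in> ?I - S" "p i \<noteq> i" by blast
      have "(\<Otimes>k\<in>?I - S. ?x k) = (\<Otimes>k\<in>insert i (?I - S - {i}). ?x k)"
        using i by (simp add: insert_absorb insert_Diff)
      also have "\<dots> = ?x i \<otimes> (\<Otimes>k\<in>?I - S - {i}. ?x k)"
        using t by (intro finprod_insert) auto
      also have "\<dots> = \<zero>" using i t by (auto intro!: finprod_closed)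
      finally have "(\<Otimes>k\<in>?I - S. ?x k) = \<zero>" .
      moreover have "(\<Otimes>k\<in>S. ?y k) \<in> carrier R"
        using S yc by (intro finprod_closed) auto
      ultimately show ?thesis using False by simp
    qed
    \<comment> \<open>Choose in each factor the diagonal term or the rank one term.\<close>
    have "(\<Otimes>i\<in>?I. ?x i \<ominus> c i \<otimes> r (p i)) = (\<Otimes>i\<in>?I. ?x i \<oplus> ?y i)"
    proof (rule finprod_cong'[OF refl])
      show "(\<lambda>i. ?x i \<oplus> ?y i) \<in> ?I \<rightarrow> carrier R" using t yc by auto
      show "?x i \<ominus> c i \<otimes> r (p i) = ?x i \<oplus> ?y i" if "i \<in> ?I" for i
        using that cc pi by (simp add: minus_eq l_minus)
    qed
    also have "\<dots> = (\<Oplus>S\<in>Pow ?I. (\<Otimes>i\<in>?I - S. ?x i) \<otimes> (\<Otimes>i\<in>S. ?y i))"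
      using x yc by (intro finprod_add) auto
    also have "\<dots> = (\<Oplus>S\<in>Pow ?I. if p permutes S then D S else \<zero>)"
      using summand D by (intro finsum_cong') auto
    also have "perm_sign p \<otimes> \<dots> = (\<Oplus>S\<in>Pow ?I. perm_sign p \<otimes> (if p permutes S then D S else \<zero>))"
      using D by (intro finsum_rdistr) auto
    also have "\<dots> = (\<Oplus>S\<in>Pow ?I. if p permutes S then perm_sign p \<otimes> D S else \<zero>)"
      using D by (intro finsum_cong') auto
    finally show ?thesis .
  qed
  have collect: "(\<Oplus>p\<in>{p. p permutes ?I}. if p permutes S then perm_sign p \<otimes> D S else \<zero>)
      = (if card S \<le> 1 then D S else \<zero>)" if S: "S \<subseteq> ?I" for S
  proof -
    have sub: "{p. p permutes S} \<subseteq> {p. p permutes ?I}" using permutes_subset[OF _ S] by blast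
    have "(\<Oplus>p\<in>{p. p permutes ?I}. if p permutes S then perm_sign p \<otimes> D S else \<zero>)
        = (\<Oplus>p\<in>{p. p permutes S}. perm_sign p \<otimes> D S)"
      using finp sub D[OF S] by (intro add.finprod_mono_neutral_cong_right) auto
    also have "\<dots> = (\<Oplus>p\<in>{p. p permutes S}. perm_sign p) \<otimes> D S"
      using D[OF S] finite_permutations[OF fin[OF S]] by (intro finsum_ldistr[symmetric]) auto
    also have "\<dots> = (if card S \<le> 1 then D S else \<zero>)"
    proof (cases "card S \<le> 1")
      case True
      then consider "S = {}" | a where "S = {a}"
        using fin[OF S] by (metis One_nat_def card_0_eq card_1_singletonE le_Suc_eq le_zero_eq)
      then have "{p. p permutes S} = {id}" by cases (simp_all add: permutes_sing)
      then show ?thesis using True D[OF S] by (simp add: perm_sign_def)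
    next
      case False
      then show ?thesis using finsum_perm_sign[OF fin[OF S]] D[OF S] by simp
    qed
    finally show ?thesis .
  qed
  have "ring_det R n (\<lambda>i j. (if i = j then t else \<zero>) \<ominus> c i \<otimes> r j)
      = (\<Oplus>p\<in>{p. p permutes ?I}. \<Oplus>S\<in>Pow ?I. if p permutes S then perm_sign p \<otimes> D S else \<zero>)"
    unfolding ring_det_def perm_sign_def[symmetric] using expand D
    by (intro finsum_cong') (auto intro!: finsum_closed)
  also have "\<dots> = (\<Oplus>S\<in>Pow ?I. \<Oplus>p\<in>{p. p permutes ?I}. if p permutes S then perm_sign p \<otimes> D S else \<zero>)"
    using finp D by (intro add.finprod_swap) auto
  also have "\<dots> = (\<Oplus>S\<in>Pow ?I. if card S \<le> 1 then D S else \<zero>)"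
    using collect D by (intro finsum_cong') auto
  also have "\<dots> = (\<Oplus>S\<in>insert {} ((\<lambda>i. {i}) ` ?I). D S)"
  proof (rule add.finprod_mono_neutral_cong_right)
    show "(if card S \<le> 1 then D S else \<zero>) = \<zero>" if "S \<in> Pow ?I - insert {} ((\<lambda>i. {i}) ` ?I)" for S
    proof -
      have "S \<noteq> {}" "\<And>i. S \<noteq> {i}" using that by auto
      moreover have "finite S" using that fin by blast
      ultimately have "\<not> card S \<le> 1"
        by (metis One_nat_def card_0_eq card_1_singletonE le_Suc_eq le_zero_eq)
      then show ?thesis by simp
    qed
  qed (use D in auto)
  also have "\<dots> = D {} \<oplus> (\<Oplus>S\<in>(\<lambda>i. {i}) ` ?I. D S)"
    using D by (intro finsum_insert) auto
  also have "(\<Oplus>S\<in>(\<lambda>i. {i}) ` ?I. D S) = (\<Oplus>i\<in>?I. D {i})"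
    using D by (intro finsum_reindex) (auto simp: inj_on_def)
  also have "\<dots> = (\<Oplus>i\<in>?I. (\<ominus> (t [^] (n - 1))) \<otimes> (c i \<otimes> r i))"
    using cc t by (intro finsum_cong') (auto simp: D_def Y_def l_minus r_minus)
  also have "\<dots> = (\<ominus> (t [^] (n - 1))) \<otimes> (\<Oplus>i\<in>?I. c i \<otimes> r i)"
    using cc t by (intro finsum_rdistr[symmetric]) auto
  also have "\<dots> = \<zero>" using t trace by simp
  finally show ?thesis using t by (simp add: D_def Y_def)
qed

end

lemma coords_eqI:
  assumes "module B M" "is_basis B M n e" "c \<in> {..<n} \<rightarrow> carrier B" "k < n"
    and v: "v = (\<Oplus>\<^bsub>M\<^esub>i\<in>{..<n}. c i \<odot>\<^bsub>M\<^esub> e i)"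
  shows "coords B M n e v k = c k"
proof -
  interpret module B M by fact
  have e: "e i \<in> carrier M" if "i < n" for i using assms(2) that by (auto simp: is_basis_def)
  have cc: "c i \<in> carrier B" if "i < n" for i using assms(3) that by auto
  have vc: "v \<in> carrier M" unfolding v using e cc by (intro M.finsum_closed) auto
  have "v = (\<Oplus>\<^bsub>M\<^esub>i\<in>{..<n}. restrict c {..<n} i \<odot>\<^bsub>M\<^esub> e i)"
    unfolding v using e cc by (intro M.finsum_cong') auto
  moreover have "restrict c {..<n} \<in> {..<n} \<rightarrow>\<^sub>E carrier B" using cc by auto
  moreover have "\<exists>!c. c \<in> {..<n} \<rightarrow>\<^sub>E carrier B \<and> v = (\<Oplus>\<^bsub>M\<^esub>i\<in>{..<n}. c i \<odot>\<^bsub>M\<^esub> e i)"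
    using assms(2) vc by (auto simp: is_basis_def)
  ultimately have "coords B M n e v = restrict c {..<n}"
    unfolding coords_def by (intro the1_equality) auto
  then show ?thesis using assms(4) by simp
qed

text \<open>The matrix of the multiplication by \<open>b + m\<close> in a basis \<open>e\<close> has the entries \<open>b \<delta>\<^sub>i\<^sub>k + c\<^sub>i l(e\<^sub>k)\<close>, where \<open>c\<close> are the
coordinates of \<open>m\<close>. Its rank one part has trace \<open>l(m) = 0\<close>. The computation works in any basis, in particular in the one that
the definition of the characteristic polynomial chooses.\<close>

lemma char_coeff_rank_one:
  assumes alg: "algebra B A" and basis: "\<exists>e. is_basis B A n e"
    and b: "b \<in> carrier B" and m: "m \<in> carrier A" and l: "linear_form B A l"
    and m_mult: "\<And>v. v \<in> carrier A \<Longrightarrow> m \<otimes>\<^bsub>A\<^esub> v = l v \<odot>\<^bsub>A\<^esub> m" and lm: "l m = \<zero>\<^bsub>B\<^esub>"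
    and j: "j \<le> n"
  shows "char_coeff B A n j (b \<odot>\<^bsub>A\<^esub> \<one>\<^bsub>A\<^esub> \<oplus>\<^bsub>A\<^esub> m) = esym B n j (\<lambda>_. b)"
proof -
  interpret A: algebra B A by fact
  interpret P: UP_cring B "UP B" by (simp add: UP_cring_def A.R_cring)
  define e where "e = (SOME e. is_basis B A n e)"
  define a where "a = b \<odot>\<^bsub>A\<^esub> \<one>\<^bsub>A\<^esub> \<oplus>\<^bsub>A\<^esub> m"
  have e_basis: "is_basis B A n e" unfolding e_def using basis by (rule someI_ex)
  then have ec: "e i \<in> carrier A" if "i < n" for i using that by (auto simp: is_basis_def)
  have le: "l (e i) \<in> carrier B" if "i < n" for i using ec that linear_formD(1)[OF l] by simp
  obtain c where c: "c \<in> {..<n} \<rightarrow>\<^sub>E carrier B" and m_sum: "m = (\<Oplus>\<^bsub>A\<^esub>i\<in>{..<n}. c i \<odot>\<^bsub>A\<^esub> e i)"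
    using e_basis m unfolding is_basis_def by blast
  have cc: "c i \<in> carrier B" if "i < n" for i using c that by (auto simp: PiE_iff)
  have trace: "(\<Oplus>\<^bsub>B\<^esub>i\<in>{..<n}. c i \<otimes>\<^bsub>B\<^esub> l (e i)) = \<zero>\<^bsub>B\<^esub>"
  proof -
    have "l m = (\<Oplus>\<^bsub>B\<^esub>i\<in>{..<n}. l (c i \<odot>\<^bsub>A\<^esub> e i))"
      unfolding m_sum using cc ec by (intro A.linear_form_simps(4)[OF l]) auto
    also have "\<dots> = (\<Oplus>\<^bsub>B\<^esub>i\<in>{..<n}. c i \<otimes>\<^bsub>B\<^esub> l (e i))"
      using cc ec le by (intro A.R.finsum_cong') (auto simp: linear_formD(3)[OF l])
    finally show ?thesis using lm by simp
  qed
  have matrix: "mult_matrix B A n e a i k = (if i = k then b else \<zero>\<^bsub>B\<^esub>) \<oplus>\<^bsub>B\<^esub> c i \<otimes>\<^bsub>B\<^esub> l (e k)"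
    if ik: "i < n" "k < n" for i k
    unfolding mult_matrix_def
  proof (rule coords_eqI[OF A.module e_basis])
    show "(\<lambda>i. (if i = k then b else \<zero>\<^bsub>B\<^esub>) \<oplus>\<^bsub>B\<^esub> c i \<otimes>\<^bsub>B\<^esub> l (e k)) \<in> {..<n} \<rightarrow> carrier B"
      using b cc le ik by auto
    have "(\<Oplus>\<^bsub>A\<^esub>i\<in>{..<n}. ((if i = k then b else \<zero>\<^bsub>B\<^esub>) \<oplus>\<^bsub>B\<^esub> c i \<otimes>\<^bsub>B\<^esub> l (e k)) \<odot>\<^bsub>A\<^esub> e i)
        = (\<Oplus>\<^bsub>A\<^esub>i\<in>{..<n}. (if k = i then b \<odot>\<^bsub>A\<^esub> e i else \<zero>\<^bsub>A\<^esub>) \<oplus>\<^bsub>A\<^esub> l (e k) \<odot>\<^bsub>A\<^esub> (c i \<odot>\<^bsub>A\<^esub> e i))"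
    proof (rule A.M.finsum_cong'[OF refl])
      fix i assume "i \<in> {..<n}"
      then have i: "i < n" by simp
      have "(c i \<otimes>\<^bsub>B\<^esub> l (e k)) \<odot>\<^bsub>A\<^esub> e i = l (e k) \<odot>\<^bsub>A\<^esub> (c i \<odot>\<^bsub>A\<^esub> e i)"
        using cc[OF i] ec[OF i] le[OF ik(2)] by (simp add: A.smult_assoc1[symmetric] A.R.m_comm)
      then show "((if i = k then b else \<zero>\<^bsub>B\<^esub>) \<oplus>\<^bsub>B\<^esub> c i \<otimes>\<^bsub>B\<^esub> l (e k)) \<odot>\<^bsub>A\<^esub> e i
          = (if k = i then b \<odot>\<^bsub>A\<^esub> e i else \<zero>\<^bsub>A\<^esub>) \<oplus>\<^bsub>A\<^esub> l (e k) \<odot>\<^bsub>A\<^esub> (c i \<odot>\<^bsub>A\<^esub> e i)"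
        using cc[OF i] ec[OF i] le[OF ik(2)] b by (simp add: A.smult_l_distr)
    qed (use b cc ec le ik in auto)
    also have "\<dots> = (\<Oplus>\<^bsub>A\<^esub>i\<in>{..<n}. if k = i then b \<odot>\<^bsub>A\<^esub> e i else \<zero>\<^bsub>A\<^esub>)
        \<oplus>\<^bsub>A\<^esub> (\<Oplus>\<^bsub>A\<^esub>i\<in>{..<n}. l (e k) \<odot>\<^bsub>A\<^esub> (c i \<odot>\<^bsub>A\<^esub> e i))"
      using b cc ec le ik by (intro A.M.finsum_addf) auto
    also have "(\<Oplus>\<^bsub>A\<^esub>i\<in>{..<n}. if k = i then b \<odot>\<^bsub>A\<^esub> e i else \<zero>\<^bsub>A\<^esub>) = b \<odot>\<^bsub>A\<^esub> e k"
      using b ec ik by (intro A.M.finsum_singleton) auto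
    also have "(\<Oplus>\<^bsub>A\<^esub>i\<in>{..<n}. l (e k) \<odot>\<^bsub>A\<^esub> (c i \<odot>\<^bsub>A\<^esub> e i)) = l (e k) \<odot>\<^bsub>A\<^esub> m"
      unfolding m_sum using cc ec le ik by (intro A.finsum_smult_ldistr[symmetric]) auto
    also have "b \<odot>\<^bsub>A\<^esub> e k \<oplus>\<^bsub>A\<^esub> l (e k) \<odot>\<^bsub>A\<^esub> m = a \<otimes>\<^bsub>A\<^esub> e k"
      unfolding a_def using b ec[OF ik(2)] m
      by (simp add: A.l_distr A.smult_assoc2 m_mult)
    finally show "a \<otimes>\<^bsub>A\<^esub> e k = (\<Oplus>\<^bsub>A\<^esub>i\<in>{..<n}. ((if i = k then b else \<zero>\<^bsub>B\<^esub>) \<oplus>\<^bsub>B\<^esub> c i \<otimes>\<^bsub>B\<^esub> l (e k)) \<odot>\<^bsub>A\<^esub> e i)" ..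
  qed (use ik in auto)
  let ?C = "\<lambda>x. monom (UP B) x 0" and ?X = "monom (UP B) \<one>\<^bsub>B\<^esub> 1"
  have hC: "ring_hom_cring B (UP B) ?C"
    using P.const_ring_hom by (intro ring_hom_cringI) (auto simp: A.R_cring P.UP_cring)
  have C_mult: "?C (x \<otimes>\<^bsub>B\<^esub> y) = ?C x \<otimes>\<^bsub>UP B\<^esub> ?C y" if "x \<in> carrier B" "y \<in> carrier B" for x y
    using that ring_hom_cring.homh[OF hC] by (intro ring_hom_mult)
  define t where "t = ?X \<ominus>\<^bsub>UP B\<^esub> ?C b"
  have t: "t \<in> carrier (UP B)" unfolding t_def using b by simp
  have "char_poly B n (mult_matrix B A n e a) = ring_det (UP B) n
      (\<lambda>i k. (if i = k then t else \<zero>\<^bsub>UP B\<^esub>) \<ominus>\<^bsub>UP B\<^esub> ?C (c i) \<otimes>\<^bsub>UP B\<^esub> ?C (l (e k)))"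
    unfolding char_poly_def ring_det_def
  proof (rule P.P.finsum_cong'[OF refl])
    let ?N = "\<lambda>i k. (if i = k then t else \<zero>\<^bsub>UP B\<^esub>) \<ominus>\<^bsub>UP B\<^esub> ?C (c i) \<otimes>\<^bsub>UP B\<^esub> ?C (l (e k))"
    have Nc: "?N i k \<in> carrier (UP B)" if "i < n" "k < n" for i k
      using that cc[of i] le[of k] t by simp
    have entry: "(if i = k then ?X else \<zero>\<^bsub>UP B\<^esub>) \<ominus>\<^bsub>UP B\<^esub> ?C (mult_matrix B A n e a i k) = ?N i k"
      if ik: "i < n" "k < n" for i k
    proof -
      have "?C (mult_matrix B A n e a i k)
          = (if i = k then ?C b else \<zero>\<^bsub>UP B\<^esub>) \<oplus>\<^bsub>UP B\<^esub> ?C (c i) \<otimes>\<^bsub>UP B\<^esub> ?C (l (e k))"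
        unfolding matrix[OF ik] using b cc[OF ik(1)] le[OF ik(2)]
        by (subst P.monom_add) (simp_all add: C_mult del: P.monom_mult)
      moreover have "?C (c i) \<otimes>\<^bsub>UP B\<^esub> ?C (l (e k)) \<in> carrier (UP B)"
        using cc[OF ik(1)] le[OF ik(2)] by simp
      moreover have "\<zero>\<^bsub>UP B\<^esub> \<ominus>\<^bsub>UP B\<^esub> \<zero>\<^bsub>UP B\<^esub> = \<zero>\<^bsub>UP B\<^esub>" by (simp add: P.P.minus_eq)
      ultimately show ?thesis
        unfolding t_def using b by (simp add: P.P.minus_add_distrib del: P.monom_mult)
    qed
    have pk: "p i < n" if "p permutes {..<n}" "i < n" for p i
      using that permutes_in_image[of p "{..<n}" i] by simp
    let ?s = "\<lambda>p. if evenperm p then \<one>\<^bsub>UP B\<^esub> else \<ominus>\<^bsub>UP B\<^esub> \<one>\<^bsub>UP B\<^esub>"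
    show "(\<lambda>p. ?s p \<otimes>\<^bsub>UP B\<^esub> (\<Otimes>\<^bsub>UP B\<^esub>i\<in>{..<n}. ?N i (p i))) \<in> {p. p permutes {..<n}} \<rightarrow> carrier (UP B)"
      using Nc pk by (intro Pi_I P.P.m_closed P.P.finprod_closed) simp_all
    fix p assume p: "p \<in> {p. p permutes {..<n}}"
    have "(\<Otimes>\<^bsub>UP B\<^esub>i\<in>{..<n}. (if i = p i then ?X else \<zero>\<^bsub>UP B\<^esub>) \<ominus>\<^bsub>UP B\<^esub> ?C (mult_matrix B A n e a i (p i)))
        = (\<Otimes>\<^bsub>UP B\<^esub>i\<in>{..<n}. ?N i (p i))"
      using p pk Nc entry by (intro P.P.finprod_cong' refl Pi_I) (simp_all del: split_paired_All)
    then show "?s p \<otimes>\<^bsub>UP B\<^esub> (\<Otimes>\<^bsub>UP B\<^esub>i\<in>{..<n}. (if i = p i then ?X else \<zero>\<^bsub>UP B\<^esub>) \<ominus>\<^bsub>UP B\<^esub> ?C (mult_matrix B A n e a i (p i)))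
        = ?s p \<otimes>\<^bsub>UP B\<^esub> (\<Otimes>\<^bsub>UP B\<^esub>i\<in>{..<n}. ?N i (p i))" by (simp only:)
  qed
  also have "\<dots> = t [^]\<^bsub>UP B\<^esub> n"
  proof (rule P.P.ring_det_rank_one_update[OF t])
    have "?C (\<Oplus>\<^bsub>B\<^esub>i\<in>{..<n}. c i \<otimes>\<^bsub>B\<^esub> l (e i)) = (\<Oplus>\<^bsub>UP B\<^esub>i\<in>{..<n}. (?C \<circ> (\<lambda>i. c i \<otimes>\<^bsub>B\<^esub> l (e i))) i)"
      by (rule ring_hom_cring.hom_finsum[OF hC]) (use cc le in auto)
    also have "\<dots> = (\<Oplus>\<^bsub>UP B\<^esub>i\<in>{..<n}. ?C (c i) \<otimes>\<^bsub>UP B\<^esub> ?C (l (e i)))"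
      by (rule P.P.finsum_cong'[OF refl]) (use cc le C_mult in \<open>simp_all add: Pi_iff del: P.monom_mult\<close>)
    finally show "(\<Oplus>\<^bsub>UP B\<^esub>i\<in>{..<n}. ?C (c i) \<otimes>\<^bsub>UP B\<^esub> ?C (l (e i))) = \<zero>\<^bsub>UP B\<^esub>"
      unfolding trace by simp
  qed (use cc le in \<open>simp_all add: Pi_iff\<close>)
  finally have "mult_char_poly B A n a = t [^]\<^bsub>UP B\<^esub> n"
    unfolding mult_char_poly_def e_def .
  then show ?thesis
    unfolding char_coeff_def a_def[symmetric] t_def
    using A.R.coeff_linear_power[OF b j] by simp
qed

section \<open>The ring \<open>B[x,y,z]/(x,y,z)\<^sup>2\<close>\<close>

text \<open>An algebra with basis \<open>1 = u\<^sub>0, u\<^sub>1, u\<^sub>2, u\<^sub>3\<close> in which \<open>u\<^sub>1, u\<^sub>2, u\<^sub>3\<close> have vanishing products. The closure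
depends only on this structure.\<close>

locale square_zero_algebra = A: algebra B A for B :: "('b, 'm) ring_scheme" (structure)
    and A :: "('b, 'a, 'k) module_scheme" +
  fixes u :: "nat \<Rightarrow> 'a" and coord :: "nat \<Rightarrow> 'a \<Rightarrow> 'b"
  assumes u_closed: "i < 4 \<Longrightarrow> u i \<in> carrier A"
    and u_0: "u 0 = \<one>\<^bsub>A\<^esub>"
    and u_mult: "\<lbrakk>0 < i; i < 4; 0 < j; j < 4\<rbrakk> \<Longrightarrow> u i \<otimes>\<^bsub>A\<^esub> u j = \<zero>\<^bsub>A\<^esub>"
    and coord_form: "i < 4 \<Longrightarrow> linear_form B A (coord i)"
    and coord_u: "\<lbrakk>i < 4; j < 4\<rbrakk> \<Longrightarrow> coord i (u j) = (if j = i then \<one> else \<zero>)"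
    and u_span: "v \<in> carrier A \<Longrightarrow> v = (\<Oplus>\<^bsub>A\<^esub>i\<in>{..<4}. coord i v \<odot>\<^bsub>A\<^esub> u i)"
begin

lemma u_basis: "is_basis B A 4 u"
proof (rule is_basisI[OF A.module])
  show "u \<in> {..<4} \<rightarrow> carrier A" using u_closed by auto
  show "\<exists>c\<in>{..<4} \<rightarrow> carrier B. v = (\<Oplus>\<^bsub>A\<^esub>i\<in>{..<4}. c i \<odot>\<^bsub>A\<^esub> u i)" if "v \<in> carrier A" for v
  proof (rule bexI)
    show "v = (\<Oplus>\<^bsub>A\<^esub>i\<in>{..<4}. coord i v \<odot>\<^bsub>A\<^esub> u i)" by (rule u_span[OF that])
    show "(\<lambda>i. coord i v) \<in> {..<4} \<rightarrow> carrier B"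
      using linear_formD(1)[OF coord_form that] by simp
  qed
  show "\<exists>l. linear_form B A l \<and> (\<forall>i<4. l (u i) = (if i = k then \<one> else \<zero>))" if "k < 4" for k
    using coord_form coord_u that by blast
qed

end

text \<open>The monomials \<open>1, x, y, z\<close>, numbered as the basis of \<open>square_zero_algebra\<close>.\<close>

definition monomial_xyz :: "nat \<Rightarrow> xyz multiset"
  where "monomial_xyz i = (if i = 0 then {#} else if i = 1 then {#Var_x#}
    else if i = 2 then {#Var_y#} else {#Var_z#})"

lemma less_4_cases: "i < 4 \<Longrightarrow> i = 0 \<or> i = 1 \<or> i = 2 \<or> i = (3::nat)"
  by auto

lemma monomial_xyz_eq_iff: "i < 4 \<Longrightarrow> j < 4 \<Longrightarrow> monomial_xyz i = monomial_xyz j \<longleftrightarrow> i = j"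
  by (auto simp: monomial_xyz_def dest!: less_4_cases)

lemma monomial_xyz_single: "0 < i \<Longrightarrow> i < 4 \<Longrightarrow> \<exists>a. monomial_xyz i = {#a#}"
  by (auto simp: monomial_xyz_def)

lemma single_monomial_xyz: "\<exists>i. 0 < i \<and> i < 4 \<and> {#a#} = monomial_xyz i"
proof (cases a)
  case Var_x then show ?thesis by (intro exI[of _ 1]) (simp add: monomial_xyz_def)
next
  case Var_y then show ?thesis by (intro exI[of _ 2]) (simp add: monomial_xyz_def)
next
  case Var_z then show ?thesis by (intro exI[of _ 3]) (simp add: monomial_xyz_def)
qed

locale poly_xyz_ring = B?: cring B for B :: "('b, 'm) ring_scheme" (structure)
begin

lemma monoid_alg_xyz: "monoid_alg B monomials_xyz"
  unfolding monoid_alg_def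
  by (auto intro!: comm_monoidI is_cring simp: monomials_xyz_def)

sublocale F: monoid_alg B monomials_xyz
  rewrites "monoid_algebra B monomials_xyz = poly_xyz B"
    and "carrier monomials_xyz = UNIV" and "p \<otimes>\<^bsub>monomials_xyz\<^esub> q = p + q"
    and "\<one>\<^bsub>monomials_xyz\<^esub> = {#}"
  by (rule monoid_alg_xyz) (simp_all add: poly_xyz_def monomials_xyz_def)

abbreviation "F \<equiv> poly_xyz B"
abbreviation "I \<equiv> ideal_xyz B"
abbreviation "J \<equiv> I \<cdot>\<^bsub>F\<^esub> I"

sublocale FA: algebra B F by (rule F.monoid_algebra)

lemma var_closed: "{basis_elem B {#Var_x#}, basis_elem B {#Var_y#}, basis_elem B {#Var_z#}} \<subseteq> carrier F"
  by (simp add: F.monoid_algebra_closed)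

lemma ideal_I: "ideal I F"
  unfolding ideal_xyz_def by (rule FA.genideal_ideal[OF var_closed])

lemma ideal_J: "ideal J F"
  by (rule FA.ideal_prod_is_ideal[OF ideal_I ideal_I])

lemma single_in_I: "basis_elem B {#a#} \<in> I"
  using FA.genideal_self[OF var_closed] unfolding ideal_xyz_def by (cases a) auto

text \<open>No factorization of \<open>m\<close> contributes. This is enough to control the coefficients of degree at most one: a monomial of
degree zero or one has only factorizations with a trivial factor.\<close>

lemma mult_coeff_zero:
  assumes "\<And>p q. p + q = m \<Longrightarrow> f p = \<zero> \<or> g q = \<zero>"
  shows "(f \<otimes>\<^bsub>F\<^esub> g) m = \<zero>"
proof -
  have empty: "{(p, q). f p \<noteq> \<zero> \<and> g q \<noteq> \<zero> \<and> p \<otimes>\<^bsub>monomials_xyz\<^esub> q = m} = {}"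
    using assms by (auto simp: monomials_xyz_def)
  have "(f \<otimes>\<^bsub>F\<^esub> g) m = (\<Oplus>r\<in>{(p, q). f p \<noteq> \<zero> \<and> g q \<noteq> \<zero> \<and> p \<otimes>\<^bsub>monomials_xyz\<^esub> q = m}.
      f (fst r) \<otimes> g (snd r))"
    by (simp add: poly_xyz_def monoid_algebra_def)
  then show ?thesis by (simp only: empty finsum_empty)
qed

lemma coeff_form: "linear_form B F (\<lambda>f. f m)"
  by (simp add: linear_form_def F.monoid_algebra_simps F.monoid_algebra_carrier)

lemma I_coeff:
  assumes "f \<in> I"
  shows "f {#} = \<zero>"
proof -
  let ?K = "{f \<in> carrier F. f {#} = \<zero>}"
  have "ideal ?K F"
  proof (rule idealI)
    show "ring F" by (rule FA.ring_axioms)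
    show "subgroup ?K (add_monoid F)"
    proof (rule FA.M.add.subgroupI)
      show "?K \<noteq> {}" using FA.linear_form_simps(1)[OF coeff_form] by (auto intro!: exI[of _ "\<zero>\<^bsub>F\<^esub>"])
    qed (auto simp: FA.linear_form_simps[OF coeff_form] F.monoid_algebra_simps)
    show "g \<otimes>\<^bsub>F\<^esub> f \<in> ?K" "f \<otimes>\<^bsub>F\<^esub> g \<in> ?K" if "f \<in> ?K" "g \<in> carrier F" for f g
      using that by (auto intro!: mult_coeff_zero F.monoid_algebra_mult_closed)
  qed
  then have "I \<subseteq> ?K"
    unfolding ideal_xyz_def
  proof (rule FA.genideal_minimal)
    have "basis_elem B {#a#} {#} = \<zero>" for a :: xyz by (simp add: basis_elem_def)
    then show "{basis_elem B {#Var_x#}, basis_elem B {#Var_y#}, basis_elem B {#Var_z#}} \<subseteq> ?K"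
      using var_closed by simp
  qed
  then show ?thesis using assms by auto
qed

lemma J_coeff:
  assumes "f \<in> J" "i < 4"
  shows "f (monomial_xyz i) = \<zero>"
  using assms(1)
proof (induction rule: ideal_prod.induct)
  case (prod f g)
  have "f p = \<zero> \<or> g q = \<zero>" if "p + q = monomial_xyz i" for p q
  proof -
    have "p = {#} \<or> q = {#}"
    proof (cases "i = 0")
      case True
      then show ?thesis using that by (simp add: monomial_xyz_def)
    next
      case False
      then obtain a where "monomial_xyz i = {#a#}" using monomial_xyz_single[of i] assms(2) by auto
      then have "size p + size q = 1" using that by (metis size_single size_union)
      then have "size p = 0 \<or> size q = 0" by linarith
      then show ?thesis by simp
    qed
    then show ?thesis using I_coeff[OF prod(1)] I_coeff[OF prod(2)] by auto
  qed
  then show ?case by (rule mult_coeff_zero)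
next
  case (sum f g)
  then show ?case by (simp add: F.monoid_algebra_simps)
qed

abbreviation "proj \<equiv> quot_map F J"
abbreviation "A \<equiv> trunc_xyz B"

lemma trunc_algebra: "algebra B A"
  unfolding trunc_xyz_def by (rule quot_algebra[OF FA.algebra_axioms ideal_J])

sublocale A: algebra B A by (rule trunc_algebra)

lemma proj_hom: "proj \<in> alg_hom B F A"
  unfolding trunc_xyz_def by (rule quot_map_alg_hom[OF FA.algebra_axioms ideal_J])

lemma proj_surj: "proj ` carrier F = carrier A"
  unfolding trunc_xyz_def by (rule quot_map_surj[OF FA.algebra_axioms ideal_J])

lemma proj_zero: "f \<in> J \<Longrightarrow> proj f = \<zero>\<^bsub>A\<^esub>"
  unfolding trunc_xyz_def
  by (simp only: quot_map_zero_iff[OF FA.algebra_axioms ideal_J ideal.Icarr[OF ideal_J]])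

definition u_xyz :: "nat \<Rightarrow> (xyz multiset \<Rightarrow> 'b) set"
  where "u_xyz i = proj (basis_elem B (monomial_xyz i))"

lemma u_xyz_closed: "u_xyz i \<in> carrier A"
  unfolding u_xyz_def by (intro alg_homD(2)[OF proj_hom] F.monoid_algebra_closed) simp

text \<open>Elements of the square of the ideal \<open>(x,y,z)\<close> have no terms of degree at most one, so these coefficients are
defined on the quotient.\<close>

lemma exists_coord:
  assumes "i < 4"
  shows "\<exists>l. linear_form B A l \<and> (\<forall>j<4. l (u_xyz j) = (if j = i then \<one> else \<zero>))"
proof -
  define c where "c f = f (monomial_xyz i)" for f :: "xyz multiset \<Rightarrow> 'b"
  have c: "linear_form B F c" unfolding c_def[abs_def] by (rule coeff_form)
  have "c f = \<zero>" if "f \<in> J" for f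
    unfolding c_def using that assms by (rule J_coeff)
  from linear_form_quot[OF FA.algebra_axioms ideal_J c this, folded trunc_xyz_def]
  obtain l where l: "linear_form B A l" "\<And>f. f \<in> carrier F \<Longrightarrow> l (proj f) = f (monomial_xyz i)"
    unfolding c_def by blast
  have "l (u_xyz j) = (if j = i then \<one> else \<zero>)" if "j < 4" for j
  proof -
    have "l (u_xyz j) = basis_elem B (monomial_xyz j) (monomial_xyz i)"
      unfolding u_xyz_def by (intro l(2) F.monoid_algebra_closed UNIV_I)
    also have "\<dots> = (if monomial_xyz i = monomial_xyz j then \<one> else \<zero>)"
      by (simp only: basis_elem_def)
    finally show ?thesis using monomial_xyz_eq_iff[OF assms that] by (cases "j = i") simp_all
  qed
  then show ?thesis using l(1) by (intro exI[of _ l]) simp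
qed

lemma basis_elem_in_J:
  assumes "2 \<le> size m"
  shows "basis_elem B m \<in> J"
proof -
  obtain a k where m: "m = {#a#} + k"
    using assms by (metis add_mset_add_single multiset_cases not_numeral_le_zero size_empty add.commute)
  then have "k \<noteq> {#}" using assms by auto
  then obtain b k' where k: "k = {#b#} + k'"
    by (metis add_mset_add_single multiset_cases add.commute)
  have "basis_elem B {#b#} \<otimes>\<^bsub>F\<^esub> basis_elem B k' \<in> I"
    by (intro ideal.I_r_closed[OF ideal_I single_in_I] F.monoid_algebra_closed UNIV_I)
  then have "basis_elem B k \<in> I"
    unfolding k by (simp only: F.basis_elem_mult[OF UNIV_I UNIV_I])
  then have "basis_elem B {#a#} \<otimes>\<^bsub>F\<^esub> basis_elem B k \<in> J"
    by (intro ideal_prod.prod single_in_I)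
  then show ?thesis
    unfolding m by (simp only: F.basis_elem_mult[OF UNIV_I UNIV_I])
qed

lemma trunc_span:
  assumes v: "v \<in> carrier A"
  shows "\<exists>c\<in>{..<4} \<rightarrow> carrier B. v = (\<Oplus>\<^bsub>A\<^esub>i\<in>{..<4}. c i \<odot>\<^bsub>A\<^esub> u_xyz i)"
proof -
  define N where "N = {\<Oplus>\<^bsub>A\<^esub>i\<in>{..<4}. c i \<odot>\<^bsub>A\<^esub> u_xyz i | c. c \<in> {..<4} \<rightarrow> carrier B}"
  have uf: "u_xyz \<in> {..<4} \<rightarrow> carrier A" using u_xyz_closed by blast
  have N: "submodule N B A" unfolding N_def by (rule A.span_submodule(1)[OF uf])
  have uN: "u_xyz i \<in> N" if "i < 4" for i unfolding N_def by (rule A.span_submodule(2)[OF uf that])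
  have proj_N: "proj (basis_elem B m) \<in> N" for m
  proof -
    consider "size m = 0" | "size m = 1" | "2 \<le> size m" by linarith
    then show ?thesis
    proof cases
      case 1
      then have "proj (basis_elem B m) = u_xyz 0" by (simp add: u_xyz_def monomial_xyz_def)
      then show ?thesis using uN[of 0] by simp
    next
      case 2
      then obtain a where a: "m = {#a#}" using size_1_singleton_mset by blast
      obtain i where i: "i < 4" "{#a#} = monomial_xyz i" using single_monomial_xyz[of a] by blast
      show ?thesis using uN[OF i(1)] unfolding a i(2) u_xyz_def .
    next
      case 3
      have "\<zero>\<^bsub>B\<^esub> \<odot>\<^bsub>A\<^esub> u_xyz 0 \<in> N" by (rule A.submoduleE(4)[OF N B.zero_closed uN]) simp
      then show ?thesis
        unfolding proj_zero[OF basis_elem_in_J[OF 3]] by (simp only: A.smult_l_null[OF u_xyz_closed])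
    qed
  qed
  obtain f where f: "f \<in> carrier F" "v = proj f" using v proj_surj by blast
  have "f \<in> {f \<in> carrier F. proj f \<in> N}"
    by (rule F.monoid_algebra_induct[OF f(1)
        alg_hom_preimage_submodule[OF FA.algebra_axioms trunc_algebra proj_hom N]])
      (simp add: F.monoid_algebra_closed(4) proj_N)
  then show ?thesis unfolding f(2) N_def by blast
qed

lemma trunc_square_zero:
  obtains coord where "square_zero_algebra B A u_xyz coord"
proof -
  obtain coord where coord: "linear_form B A (coord i)"
    "\<forall>j<4. coord i (u_xyz j) = (if j = i then \<one> else \<zero>)" if "i < 4" for i
    using exists_coord by metis
  have "square_zero_algebra B A u_xyz coord"
  proof
    show "u_xyz i \<in> carrier A" for i by (rule u_xyz_closed)
    show "u_xyz 0 = \<one>\<^bsub>A\<^esub>"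
      using alg_homD(5)[OF proj_hom] by (simp add: u_xyz_def monomial_xyz_def F.monoid_algebra_simps)
    show "u_xyz i \<otimes>\<^bsub>A\<^esub> u_xyz j = \<zero>\<^bsub>A\<^esub>" if ij: "0 < i" "i < 4" "0 < j" "j < 4" for i j
    proof -
      obtain a b where ab: "monomial_xyz i = {#a#}" "monomial_xyz j = {#b#}"
        using monomial_xyz_single ij by metis
      have "u_xyz i \<otimes>\<^bsub>A\<^esub> u_xyz j = proj (basis_elem B {#a#} \<otimes>\<^bsub>F\<^esub> basis_elem B {#b#})"
        unfolding u_xyz_def ab by (intro alg_homD(4)[OF proj_hom, symmetric] F.monoid_algebra_closed) auto
      also have "\<dots> = \<zero>\<^bsub>A\<^esub>" by (intro proj_zero ideal_prod.prod single_in_I)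
      finally show ?thesis .
    qed
    show "linear_form B A (coord i)" if "i < 4" for i using coord that by blast
    show "coord i (u_xyz j) = (if j = i then \<one> else \<zero>)" if "i < 4" "j < 4" for i j
      using coord that by blast
    show "v = (\<Oplus>\<^bsub>A\<^esub>i\<in>{..<4}. coord i v \<odot>\<^bsub>A\<^esub> u_xyz i)" if v: "v \<in> carrier A" for v
    proof -
      obtain c where c: "c \<in> {..<4} \<rightarrow> carrier B" and vc: "v = (\<Oplus>\<^bsub>A\<^esub>i\<in>{..<4}. c i \<odot>\<^bsub>A\<^esub> u_xyz i)"
        using trunc_span[OF v] by blast
      have cc: "c i \<in> carrier B" if "i < 4" for i using c that by auto
      have "coord k v = c k" if k: "k < 4" for k
      proof -
        have "coord k v = (\<Oplus>i\<in>{..<4}. coord k (c i \<odot>\<^bsub>A\<^esub> u_xyz i))"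
          unfolding vc using cc u_xyz_closed by (intro A.linear_form_simps(4) coord k) auto
        also have "\<dots> = (\<Oplus>i\<in>{..<4}. if k = i then c i else \<zero>)"
          using cc u_xyz_closed k coord(2)[OF k]
          by (intro finsum_cong') (auto simp: linear_formD(3)[OF coord(1)[OF k]])
        also have "\<dots> = c k" using cc k by (intro finsum_singleton) auto
        finally show ?thesis .
      qed
      then have "(\<Oplus>\<^bsub>A\<^esub>i\<in>{..<4}. coord i v \<odot>\<^bsub>A\<^esub> u_xyz i) = v"
        unfolding vc using cc u_xyz_closed by (intro A.M.finsum_cong') auto
      then show ?thesis ..
    qed
  qed
  then show thesis by (rule that)
qed

end

section \<open>Monomials in four conjugates\<close>

context cring
begin

text \<open>The sets of \<open>Suc j\<close> indices are those without \<open>n\<close> and those with \<open>n\<close>.\<close>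

lemma esym_Suc:
  assumes w: "w \<in> {..<Suc n} \<rightarrow> carrier R"
  shows "esym R (Suc n) (Suc j) w = esym R n (Suc j) w \<oplus> w n \<otimes> esym R n j w"
proof -
  let ?S = "\<lambda>n j. {S. S \<subseteq> {..<n} \<and> card S = j}"
  have fin: "finite (?S n j)" for n j :: nat by (rule finite_subset[of _ "Pow {..<n}"]) auto
  have fin_mem: "finite S" if "S \<subseteq> {..<n}" for S and n :: nat
    by (rule finite_subset[OF that]) simp
  have wn: "w n \<in> carrier R" and w': "w \<in> {..<n} \<rightarrow> carrier R" using w by auto
  have cl: "(\<Otimes>i\<in>S. w i) \<in> carrier R" if "S \<subseteq> {..<Suc n}" for S
    using that w by (intro finprod_closed) auto
  have union: "?S (Suc n) (Suc j) = ?S n (Suc j) \<union> insert n ` ?S n j"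
  proof (intro equalityI subsetI)
    fix S assume S: "S \<in> ?S (Suc n) (Suc j)"
    show "S \<in> ?S n (Suc j) \<union> insert n ` ?S n j"
    proof (cases "n \<in> S")
      case True
      have "S - {n} \<subseteq> {..<n}" "card (S - {n}) = j" "insert n (S - {n}) = S"
        using S True fin_mem[of S "Suc n"] by (auto simp: less_Suc_eq)
      then show ?thesis by blast
    next
      case False
      then have "S \<subseteq> {..<n}" using S by (auto simp: less_Suc_eq)
      then show ?thesis using S by simp
    qed
  next
    fix S assume "S \<in> ?S n (Suc j) \<union> insert n ` ?S n j"
    then consider "S \<in> ?S n (Suc j)" | T where "T \<in> ?S n j" "S = insert n T" by blast
    then show "S \<in> ?S (Suc n) (Suc j)"
    proof cases
      case 1
      then have "S \<subseteq> {..<Suc n}" by (auto simp: less_Suc_eq)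
      then show ?thesis using 1 by simp
    next
      case 2
      then have "n \<notin> T" "finite T" "T \<subseteq> {..<Suc n}" using fin_mem[of T n] by (auto simp: less_Suc_eq)
      then show ?thesis using 2 by simp
    qed
  qed
  have disj: "?S n (Suc j) \<inter> insert n ` ?S n j = {}" by auto
  have inj: "inj_on (insert n) (?S n j)"
  proof (rule inj_onI)
    fix S T assume "S \<in> ?S n j" "T \<in> ?S n j" "insert n S = insert n T"
    moreover from this have "n \<notin> S" "n \<notin> T" by auto
    ultimately show "S = T" by (metis insert_ident)
  qed
  have sub: "insert n S \<subseteq> {..<Suc n}" "S \<subseteq> {..<Suc n}" if "S \<subseteq> {..<n}" for S
    using that by (auto simp: less_Suc_eq)
  have cl1: "(\<lambda>S. \<Otimes>i\<in>S. w i) \<in> ?S n (Suc j) \<rightarrow> carrier R"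
    and cl2: "(\<lambda>S. \<Otimes>i\<in>S. w i) \<in> insert n ` ?S n j \<rightarrow> carrier R"
    using sub cl by auto
  have "esym R (Suc n) (Suc j) w = esym R n (Suc j) w \<oplus> (\<Oplus>S\<in>insert n ` ?S n j. \<Otimes>i\<in>S. w i)"
    unfolding esym_def union by (intro finsum_Un_disjoint disj fin finite_imageI cl1 cl2)
  also have "(\<Oplus>S\<in>insert n ` ?S n j. \<Otimes>i\<in>S. w i) = (\<Oplus>S\<in>?S n j. \<Otimes>i\<in>insert n S. w i)"
    using cl2 inj by (rule finsum_reindex)
  also have "\<dots> = (\<Oplus>S\<in>?S n j. w n \<otimes> (\<Otimes>i\<in>S. w i))"
  proof (rule finsum_cong'[OF refl])
    fix S assume "S \<in> ?S n j"
    then have S: "S \<subseteq> {..<n}" by simp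
    then have "n \<notin> S" "w \<in> S \<rightarrow> carrier R" using w' by auto
    then show "(\<Otimes>i\<in>insert n S. w i) = w n \<otimes> (\<Otimes>i\<in>S. w i)"
      using wn fin_mem[OF S] by (intro finprod_insert) auto
  qed (use wn cl sub in auto)
  also have "\<dots> = w n \<otimes> esym R n j w"
    unfolding esym_def using wn cl sub fin by (intro finsum_rdistr[symmetric]) auto
  finally show ?thesis .
qed

lemma esym_4:
  assumes "w 0 \<in> carrier R" "w 1 \<in> carrier R" "w 2 \<in> carrier R" "w 3 \<in> carrier R"
  shows "esym R 4 1 w = w 0 \<oplus> w 1 \<oplus> w 2 \<oplus> w 3"
    and "esym R 4 2 w = w 0 \<otimes> w 1 \<oplus> w 2 \<otimes> (w 0 \<oplus> w 1) \<oplus> w 3 \<otimes> (w 0 \<oplus> w 1 \<oplus> w 2)"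
    and "esym R 4 3 w = w 2 \<otimes> (w 0 \<otimes> w 1) \<oplus> w 3 \<otimes> (w 0 \<otimes> w 1 \<oplus> w 2 \<otimes> (w 0 \<oplus> w 1))"
    and "esym R 4 4 w = w 3 \<otimes> (w 2 \<otimes> (w 0 \<otimes> w 1))"
proof -
  have w: "w \<in> {..<Suc 0} \<rightarrow> carrier R" "w \<in> {..<Suc (Suc 0)} \<rightarrow> carrier R"
    "w \<in> {..<Suc (Suc (Suc 0))} \<rightarrow> carrier R" "w \<in> {..<Suc (Suc (Suc (Suc 0)))} \<rightarrow> carrier R"
    using assms by (auto simp: less_Suc_eq numeral_2_eq_2 numeral_3_eq_3)
  note c = assms[unfolded numeral_2_eq_2 numeral_3_eq_3 One_nat_def]
  have four: "4 = Suc (Suc (Suc (Suc 0)))" by simp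
  note e = esym_Suc[OF w(1)] esym_Suc[OF w(2)] esym_Suc[OF w(3)] esym_Suc[OF w(4)] esym_0 esym_eq_zero
  show "esym R 4 1 w = w 0 \<oplus> w 1 \<oplus> w 2 \<oplus> w 3"
    "esym R 4 2 w = w 0 \<otimes> w 1 \<oplus> w 2 \<otimes> (w 0 \<oplus> w 1) \<oplus> w 3 \<otimes> (w 0 \<oplus> w 1 \<oplus> w 2)"
    "esym R 4 3 w = w 2 \<otimes> (w 0 \<otimes> w 1) \<oplus> w 3 \<otimes> (w 0 \<otimes> w 1 \<oplus> w 2 \<otimes> (w 0 \<oplus> w 1))"
    "esym R 4 4 w = w 3 \<otimes> (w 2 \<otimes> (w 0 \<otimes> w 1))"
    unfolding numeral_2_eq_2 numeral_3_eq_3 One_nat_def four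
    using c by (simp_all add: e m_comm)
qed

end

text \<open>The index \<open>1\<close> is kept as a numeral, like the other indices.\<close>

declare One_nat_def [simp del]

text \<open>A triple \<open>a, b, c\<close> of numbers less than \<open>4\<close> stands for the monomial with \<open>u a\<close>, \<open>u b\<close>, \<open>u c\<close> in the tensor factors
\<open>0, 1, 2\<close>; the number \<open>0\<close> stands for the factor \<open>1\<close>. Excluded are the monomials of degree three other than \<open>x\<^sub>0 y\<^sub>1 z\<^sub>2\<close>, and the leading
terms \<open>u\<^sub>1 u\<^sub>2\<close> and \<open>v\<^sub>1 u\<^sub>2\<close> (with \<open>u\<close> before \<open>v\<close>) of the relations of degree two.\<close>

definition normal_monomial :: "nat \<Rightarrow> nat \<Rightarrow> nat \<Rightarrow> bool"
  where "normal_monomial a b c \<longleftrightarrow>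
    \<not> (a \<noteq> 0 \<and> b \<noteq> 0 \<and> c \<noteq> 0 \<and> (a, b, c) \<noteq> (1, 2, 3)) \<and> \<not> (a = 0 \<and> b \<noteq> 0 \<and> c \<noteq> 0 \<and> c \<le> b)"

text \<open>The value of the monomial \<open>a, b, c\<close> when the normal monomials have the values \<open>g\<close>: solve \<open>square_relation\<close> and
\<open>mixed_relation\<close> below for their leading terms, and take the sign of the permutation in degree three.\<close>

definition reduce3 :: "('r, 'm) ring_scheme \<Rightarrow> (nat \<Rightarrow> nat \<Rightarrow> nat \<Rightarrow> 'r) \<Rightarrow> nat \<Rightarrow> nat \<Rightarrow> nat \<Rightarrow> 'r"
  where "reduce3 R g a b c =
    (if normal_monomial a b c then g a b c
     else if a = 0 \<and> b = c then \<ominus>\<^bsub>R\<^esub> (g b b 0 \<oplus>\<^bsub>R\<^esub> g b 0 b)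
     else if a = 0 then \<ominus>\<^bsub>R\<^esub> (g c b 0 \<oplus>\<^bsub>R\<^esub> g c 0 b \<oplus>\<^bsub>R\<^esub> g b c 0 \<oplus>\<^bsub>R\<^esub> g 0 c b \<oplus>\<^bsub>R\<^esub> g b 0 c)
     else if (a, b, c) \<in> {(2, 3, 1), (3, 1, 2)} then g 1 2 3
     else if (a, b, c) \<in> {(2, 1, 3), (1, 3, 2), (3, 2, 1)} then \<ominus>\<^bsub>R\<^esub> g 1 2 3
     else \<zero>\<^bsub>R\<^esub>)"

text \<open>The last factor is eliminated by \<open>u\<^sub>3 = - (u\<^sub>0 + u\<^sub>1 + u\<^sub>2)\<close>; a product is zero if the new factor meets a
variable in the same place.\<close>

definition reduce4 :: "('r, 'm) ring_scheme \<Rightarrow> (nat \<Rightarrow> nat \<Rightarrow> nat \<Rightarrow> 'r) \<Rightarrow> nat \<Rightarrow> nat \<Rightarrow> nat \<Rightarrow> nat \<Rightarrow> 'r"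
  where "reduce4 R g a b c d =
    (if d = 0 then reduce3 R g a b c
     else \<ominus>\<^bsub>R\<^esub> ((if a = 0 then reduce3 R g d b c else \<zero>\<^bsub>R\<^esub>) \<oplus>\<^bsub>R\<^esub>
       (if b = 0 then reduce3 R g a d c else \<zero>\<^bsub>R\<^esub>) \<oplus>\<^bsub>R\<^esub>
       (if c = 0 then reduce3 R g a b d else \<zero>\<^bsub>R\<^esub>)))"

lemma pos_less_4_cases: "0 < i \<Longrightarrow> i < 4 \<Longrightarrow> i = 1 \<or> i = 2 \<or> i = (3::nat)"
  by auto

text \<open>A ring with elements \<open>X i k\<close>, to be thought of as \<open>u i\<close> in the tensor factor \<open>k\<close>, that satisfy the relations of the
closure in degrees one and two.\<close>

locale four_conjugates = cring C for C :: "('c, 'k) ring_scheme" (structure) +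
  fixes X :: "nat \<Rightarrow> nat \<Rightarrow> 'c"
  assumes X_closed: "i < 4 \<Longrightarrow> k < 4 \<Longrightarrow> X i k \<in> carrier C"
    and X_0: "k < 4 \<Longrightarrow> X 0 k = \<one>"
    and X_mult: "\<lbrakk>0 < i; i < 4; 0 < j; j < 4; k < 4\<rbrakk> \<Longrightarrow> X i k \<otimes> X j k = \<zero>"
    and e1: "\<lbrakk>0 < i; i < 4\<rbrakk> \<Longrightarrow> esym C 4 1 (X i) = \<zero>"
    and e2: "\<lbrakk>0 < i; i < 4\<rbrakk> \<Longrightarrow> esym C 4 2 (X i) = \<zero>"
begin

lemma X_cl: "i < 4 \<Longrightarrow> X i 0 \<in> carrier C" "i < 4 \<Longrightarrow> X i 1 \<in> carrier C"
  "i < 4 \<Longrightarrow> X i 2 \<in> carrier C" "i < 4 \<Longrightarrow> X i 3 \<in> carrier C"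
  by (simp_all add: X_closed)

definition mon :: "nat \<Rightarrow> nat \<Rightarrow> nat \<Rightarrow> 'c"
  where "mon a b c = X a 0 \<otimes> X b 1 \<otimes> X c 2"

lemma mon_closed: "\<lbrakk>a < 4; b < 4; c < 4\<rbrakk> \<Longrightarrow> mon a b c \<in> carrier C"
  by (simp add: mon_def X_cl)

lemma last_conjugate:
  assumes "0 < i" "i < 4"
  shows "X i 3 = \<ominus> (X i 0 \<oplus> X i 1 \<oplus> X i 2)"
proof -
  have "X i 0 \<oplus> X i 1 \<oplus> X i 2 \<oplus> X i 3 = \<zero>"
    using e1[OF assms] X_cl[OF assms(2)] by (simp add: esym_4(1))
  then have "X i 3 \<oplus> (X i 0 \<oplus> X i 1 \<oplus> X i 2) = \<zero>"
    using X_cl[OF assms(2)] by (simp add: a_comm)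
  then show ?thesis using X_cl[OF assms(2)] by (intro minus_equality[symmetric]) auto
qed

text \<open>This is \<open>e\<^sub>2\<close>: the terms with the last conjugate add up to \<open>X i 3 \<otimes> (- X i 3) = 0\<close>.\<close>

lemma square_relation:
  assumes "0 < i" "i < 4"
  shows "X i 0 \<otimes> X i 1 \<oplus> X i 0 \<otimes> X i 2 \<oplus> X i 1 \<otimes> X i 2 = \<zero>"
proof -
  note c = X_cl[OF assms(2)]
  have "X i 0 \<oplus> X i 1 \<oplus> X i 2 = \<ominus> X i 3" using last_conjugate[OF assms] c by simp
  then have "X i 3 \<otimes> (X i 0 \<oplus> X i 1 \<oplus> X i 2) = \<zero>"
    using c X_mult[OF assms assms, of 3] by (simp add: r_minus)
  then have "X i 0 \<otimes> X i 1 \<oplus> X i 2 \<otimes> (X i 0 \<oplus> X i 1) = \<zero>"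
    using e2[OF assms] c by (simp add: esym_4(2))
  then show ?thesis using c by (simp add: r_distr m_comm a_assoc)
qed

text \<open>This is \<open>X i 3 \<otimes> X j 3 = 0\<close>, written with the other conjugates.\<close>

lemma mixed_relation:
  assumes i: "0 < i" "i < 4" and j: "0 < j" "j < 4"
  shows "X i 0 \<otimes> X j 1 \<oplus> X i 0 \<otimes> X j 2 \<oplus> (X i 1 \<otimes> X j 0 \<oplus> X i 1 \<otimes> X j 2)
    \<oplus> (X i 2 \<otimes> X j 0 \<oplus> X i 2 \<otimes> X j 1) = \<zero>"
proof -
  note c = X_cl[OF i(2)] X_cl[OF j(2)]
  note z = X_mult[OF i j, of 0] X_mult[OF i j, of 1] X_mult[OF i j, of 2] X_mult[OF i j, of 3]
  have "(X i 0 \<oplus> X i 1 \<oplus> X i 2) \<otimes> (X j 0 \<oplus> X j 1 \<oplus> X j 2) = \<zero>"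
    using z(4) c unfolding last_conjugate[OF i] last_conjugate[OF j] by (simp add: l_minus r_minus)
  then show ?thesis using c z by (simp add: l_distr r_distr a_ac)
qed

text \<open>Multiply \<open>mixed_relation\<close> or \<open>square_relation\<close> by a conjugate of \<open>u k\<close>: all terms that already contain a variable in
that place vanish.\<close>

lemma mon_relations:
  assumes i: "0 < i" "i < 4" and j: "0 < j" "j < 4" and k: "0 < k" "k < 4"
  shows mon_swap_12: "mon i j k = \<ominus> mon j i k"
    and mon_swap_23: "mon k i j = \<ominus> mon k j i"
    and mon_repeat: "mon i i k = \<zero>" "mon k i i = \<zero>" "mon i k i = \<zero>"
proof -
  note c = X_cl[OF i(2)] X_cl[OF j(2)] X_cl[OF k(2)]
  have kill: "X a m \<otimes> X b n \<otimes> X k m = \<zero>" "X b n \<otimes> X a m \<otimes> X k m = \<zero>"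
    if "0 < a" "a < 4" "b < 4" "m < 4" "n < 4" for a b m n
  proof -
    have cl: "X a m \<in> carrier C" "X b n \<in> carrier C" "X k m \<in> carrier C" using that k X_closed by auto
    have "X a m \<otimes> X b n \<otimes> X k m = X b n \<otimes> (X a m \<otimes> X k m)" using cl by (simp add: m_ac)
    then show "X a m \<otimes> X b n \<otimes> X k m = \<zero>" using that k cl X_mult by simp
    then show "X b n \<otimes> X a m \<otimes> X k m = \<zero>" using cl by (simp add: m_comm)
  qed
  have "(X i 0 \<otimes> X j 1 \<oplus> X i 0 \<otimes> X j 2 \<oplus> (X i 1 \<otimes> X j 0 \<oplus> X i 1 \<otimes> X j 2)
    \<oplus> (X i 2 \<otimes> X j 0 \<oplus> X i 2 \<otimes> X j 1)) \<otimes> X k 2 = \<zero>"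
    using mixed_relation[OF i j] c by simp
  then have "X i 0 \<otimes> X j 1 \<otimes> X k 2 \<oplus> X i 1 \<otimes> X j 0 \<otimes> X k 2 = \<zero>"
    using c i j by (simp add: l_distr kill)
  then have "mon i j k \<oplus> mon j i k = \<zero>" using c by (simp add: mon_def m_comm[of "X i 1"])
  then show "mon i j k = \<ominus> mon j i k"
    using i j k by (intro minus_equality[symmetric]) (auto intro: mon_closed)
  have "(X i 0 \<otimes> X j 1 \<oplus> X i 0 \<otimes> X j 2 \<oplus> (X i 1 \<otimes> X j 0 \<oplus> X i 1 \<otimes> X j 2)
    \<oplus> (X i 2 \<otimes> X j 0 \<oplus> X i 2 \<otimes> X j 1)) \<otimes> X k 0 = \<zero>"
    using mixed_relation[OF i j] c by simp
  then have "X i 1 \<otimes> X j 2 \<otimes> X k 0 \<oplus> X i 2 \<otimes> X j 1 \<otimes> X k 0 = \<zero>"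
    using c i j by (simp add: l_distr kill)
  then have "mon k i j \<oplus> mon k j i = \<zero>" using c by (simp add: mon_def m_ac)
  then show "mon k i j = \<ominus> mon k j i"
    using i j k by (intro minus_equality[symmetric]) (auto intro: mon_closed)
  have sq: "(X i 0 \<otimes> X i 1 \<oplus> X i 0 \<otimes> X i 2 \<oplus> X i 1 \<otimes> X i 2) \<otimes> X k n = \<zero>" if "n < 4" for n
    using square_relation[OF i] X_closed[OF k(2) that] by simp
  show "mon i i k = \<zero>" using sq[of 2] c i by (simp add: l_distr kill mon_def)
  have "X i 1 \<otimes> X i 2 \<otimes> X k 0 = \<zero>" using sq[of 0] c i by (simp add: l_distr kill)
  then show "mon k i i = \<zero>" using c by (simp add: mon_def m_ac)
  have "X i 0 \<otimes> X i 2 \<otimes> X k 1 = \<zero>" using sq[of 1] c i by (simp add: l_distr kill)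
  then show "mon i k i = \<zero>" using c by (simp add: mon_def m_ac)
qed

lemma mon_reduce3:
  assumes abc: "a < 4" "b < 4" "c < 4"
  shows "mon a b c = reduce3 C mon a b c"
proof (cases "normal_monomial a b c")
  case True
  then show ?thesis by (simp add: reduce3_def)
next
  case False
  then consider (full) "a \<noteq> 0" "b \<noteq> 0" "c \<noteq> 0" "(a, b, c) \<noteq> (1, 2, 3)"
    | (two) "a = 0" "b \<noteq> 0" "c \<noteq> 0" "c \<le> b"
    by (auto simp: normal_monomial_def)
  then show ?thesis
  proof cases
    case full
    have 123: "mon 1 2 3 \<in> carrier C" by (rule mon_closed) auto
    have "mon 2 1 3 = \<ominus> mon 1 2 3" "mon 1 3 2 = \<ominus> mon 1 2 3" by (rule mon_relations; simp)+
    moreover have "mon 2 3 1 = \<ominus> mon 2 1 3" "mon 3 1 2 = \<ominus> mon 1 3 2" "mon 3 2 1 = \<ominus> mon 2 3 1"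
      by (rule mon_relations; simp)+
    ultimately have perms: "mon 2 1 3 = \<ominus> mon 1 2 3" "mon 1 3 2 = \<ominus> mon 1 2 3"
      "mon 2 3 1 = mon 1 2 3" "mon 3 1 2 = mon 1 2 3" "mon 3 2 1 = \<ominus> mon 1 2 3"
      using 123 by simp_all
    show ?thesis
    proof (cases "a = b \<or> b = c \<or> a = c")
      case True
      then have "mon a b c = \<zero>" using full abc mon_repeat by auto
      then show ?thesis using True False full by (auto simp: reduce3_def)
    next
      case neq: False
      have "(a, b, c) \<in> {(2, 3, 1), (3, 1, 2), (2, 1, 3), (1, 3, 2), (3, 2, 1)}"
        using full neq pos_less_4_cases[of a] pos_less_4_cases[of b] pos_less_4_cases[of c] abc by auto
      then show ?thesis using False perms by (auto simp: reduce3_def)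
    qed
  next
    case two
    note cl = X_cl[OF abc(2)] X_cl[OF abc(3)]
    have pos: "0 < b" "0 < c" using two by auto
    show ?thesis
    proof (cases "b = c")
      case True
      have "X b 1 \<otimes> X b 2 \<oplus> (X b 0 \<otimes> X b 1 \<oplus> X b 0 \<otimes> X b 2) = \<zero>"
        using square_relation[OF pos(1) abc(2)] cl by (simp add: a_ac)
      then have "X b 1 \<otimes> X b 2 = \<ominus> (X b 0 \<otimes> X b 1 \<oplus> X b 0 \<otimes> X b 2)"
        using cl by (intro minus_equality[symmetric]) auto
      then show ?thesis using True False two cl by (simp add: reduce3_def mon_def X_0)
    next
      case neq: False
      have "X b 1 \<otimes> X c 2 \<oplus> (X c 0 \<otimes> X b 1 \<oplus> X c 0 \<otimes> X b 2 \<oplus> X b 0 \<otimes> X c 1 \<oplus>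
          X c 1 \<otimes> X b 2 \<oplus> X b 0 \<otimes> X c 2) = \<zero>"
        using mixed_relation[OF pos(1) abc(2) pos(2) abc(3)] cl by (simp add: a_ac m_ac)
      then have "X b 1 \<otimes> X c 2 = \<ominus> (X c 0 \<otimes> X b 1 \<oplus> X c 0 \<otimes> X b 2 \<oplus> X b 0 \<otimes> X c 1 \<oplus>
          X c 1 \<otimes> X b 2 \<oplus> X b 0 \<otimes> X c 2)"
        using cl by (intro minus_equality[symmetric]) auto
      then show ?thesis using neq False two cl by (simp add: reduce3_def mon_def X_0)
    qed
  qed
qed

lemma mon_reduce4:
  assumes abcd: "a < 4" "b < 4" "c < 4" "d < 4"
  shows "mon a b c \<otimes> X d 3 = reduce4 C mon a b c d"
proof (cases "d = 0")
  case True
  then show ?thesis using mon_reduce3[OF abcd(1-3)] mon_closed[OF abcd(1-3)]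
    by (simp add: reduce4_def X_0)
next
  case False
  then have d: "0 < d" by simp
  note cl = X_cl[OF abcd(1)] X_cl[OF abcd(2)] X_cl[OF abcd(3)] X_cl[OF abcd(4)]
  have absorb: "X i k \<otimes> X d k = (if i = 0 then X d k else \<zero>)" if "i < 4" "k < 4" for i k
    using that d abcd X_mult[of i d k] X_0 X_closed by (cases "i = 0") auto
  have "mon a b c \<otimes> X d 3 = \<ominus> (mon a b c \<otimes> X d 0 \<oplus> mon a b c \<otimes> X d 1 \<oplus> mon a b c \<otimes> X d 2)"
    unfolding last_conjugate[OF d abcd(4)]
    using cl mon_closed[OF abcd(1-3)] by (simp add: r_minus r_distr)
  also have "mon a b c \<otimes> X d 0 = (X a 0 \<otimes> X d 0) \<otimes> X b 1 \<otimes> X c 2"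
    using cl by (simp add: mon_def m_ac)
  also have "\<dots> = (if a = 0 then mon d b c else \<zero>)"
    using cl abcd by (simp add: absorb mon_def)
  also have "mon a b c \<otimes> X d 1 = X a 0 \<otimes> (X b 1 \<otimes> X d 1) \<otimes> X c 2"
    using cl by (simp add: mon_def m_ac)
  also have "\<dots> = (if b = 0 then mon a d c else \<zero>)"
    using cl abcd by (simp add: absorb mon_def)
  also have "mon a b c \<otimes> X d 2 = X a 0 \<otimes> X b 1 \<otimes> (X c 2 \<otimes> X d 2)"
    using cl by (simp add: mon_def m_ac)
  also have "\<dots> = (if c = 0 then mon a b d else \<zero>)"
    using cl abcd by (simp add: absorb mon_def)
  finally show ?thesis
    using False mon_reduce3 abcd by (simp add: reduce4_def)
qed

text \<open>The product of the first three conjugates vanishes by \<open>mon_repeat\<close>, and the rest of \<open>e\<^sub>3\<close> is \<open>X i 3\<close> times the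
left-hand side of \<open>square_relation\<close>.\<close>

lemma esym_X_eq_zero:
  assumes i: "0 < i" "i < 4"
  shows "\<forall>j>0. esym C 4 j (X i) = \<zero>"
proof -
  note c = X_cl[OF i(2)]
  have 012: "X i 0 \<otimes> X i 1 \<otimes> X i 2 = \<zero>"
    using mon_repeat(1)[OF i i i] by (simp add: mon_def)
  have rest: "X i 0 \<otimes> X i 1 \<oplus> X i 2 \<otimes> (X i 0 \<oplus> X i 1) = \<zero>"
    using square_relation[OF i] c by (simp add: r_distr m_comm a_assoc)
  have "esym C 4 3 (X i) = \<zero>" "esym C 4 4 (X i) = \<zero>"
    using c 012 rest by (simp_all add: esym_4 m_comm[of "X i 2"])
  moreover have "j = 1 \<or> j = 2 \<or> j = 3 \<or> j = 4 \<or> 4 < j" if "0 < j" for j :: nat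
    using that by auto
  ultimately show ?thesis using e1[OF i] e2[OF i] esym_eq_zero by metis
qed

end

section \<open>Reduction and the relations \<open>e\<^sub>1\<close> and \<open>e\<^sub>2\<close>\<close>

context cring
begin

context
  fixes g :: "nat \<Rightarrow> nat \<Rightarrow> nat \<Rightarrow> 'a"
  assumes g: "\<And>a b c. g a b c \<in> carrier R"
begin

abbreviation "r3 \<equiv> reduce3 R g"
abbreviation "r4 \<equiv> reduce4 R g"

lemma reduce3_closed [simp]: "r3 a b c \<in> carrier R"
  by (simp add: reduce3_def g)

lemma reduce4_closed [simp]: "r4 a b c d \<in> carrier R"
  by (simp add: reduce4_def)

lemma reduce3_swap:
  assumes "0 < a" "a < 4" "0 < b" "b < 4" "0 < c" "c < 4"
  shows "r3 b a c = \<ominus> r3 a b c" "r3 a c b = \<ominus> r3 a b c"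
  using pos_less_4_cases[OF assms(1,2)] pos_less_4_cases[OF assms(3,4)] pos_less_4_cases[OF assms(5,6)]
  by (elim disjE; simp add: reduce3_def normal_monomial_def g)+

lemma reduce3_repeat:
  assumes "0 < a" "0 < b" "0 < c" "a = b \<or> b = c \<or> a = c"
  shows "r3 a b c = \<zero>"
  using assms by (auto simp: reduce3_def normal_monomial_def)

lemma reduce3_square:
  assumes "0 < i" "i < 4"
  shows "r3 0 i i = \<ominus> (r3 i i 0 \<oplus> r3 i 0 i)"
  using assms by (simp add: reduce3_def normal_monomial_def)

text \<open>For \<open>i \<noteq> j\<close> this is the defining equation of one of the six terms. For \<open>i = j\<close> it is twice \<open>reduce3_square\<close>.\<close>

lemma reduce3_mixed:
  assumes "0 < i" "i < 4" "0 < j" "j < 4"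
  shows "r3 i j 0 \<oplus> r3 i 0 j \<oplus> r3 j i 0 \<oplus> r3 0 i j \<oplus> r3 j 0 i \<oplus> r3 0 j i = \<zero>"
proof -
  have ge: "r3 i j 0 \<oplus> r3 i 0 j \<oplus> r3 j i 0 \<oplus> r3 0 i j \<oplus> r3 j 0 i \<oplus> r3 0 j i = \<zero>"
    if ij: "i < j" "0 < i" for i j
  proof -
    let ?s = "g i j 0 \<oplus> g i 0 j \<oplus> g j i 0 \<oplus> g 0 i j \<oplus> g j 0 i"
    have "r3 0 j i = \<ominus> ?s" using ij by (simp add: reduce3_def normal_monomial_def)
    moreover have "r3 i j 0 \<oplus> r3 i 0 j \<oplus> r3 j i 0 \<oplus> r3 0 i j \<oplus> r3 j 0 i = ?s"
      using ij by (simp add: reduce3_def normal_monomial_def)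
    moreover have "?s \<in> carrier R" by (simp add: g)
    ultimately show ?thesis by (simp add: r_neg)
  qed
  consider "i < j" | "i = j" | "j < i" by linarith
  then show ?thesis
  proof cases
    case 1
    then show ?thesis using ge[of i j] assms by simp
  next
    case 2
    let ?s = "r3 i i 0 \<oplus> r3 i 0 i"
    have "r3 i i 0 \<oplus> r3 i 0 i \<oplus> r3 i i 0 \<oplus> r3 0 i i \<oplus> r3 i 0 i \<oplus> r3 0 i i = (?s \<oplus> r3 0 i i) \<oplus> (?s \<oplus> r3 0 i i)"
      by (simp add: a_ac)
    also have "?s \<oplus> r3 0 i i = \<zero>" by (simp only: reduce3_square[OF assms(1,2)] r_neg a_closed reduce3_closed)
    finally show ?thesis using 2 by simp
  next
    case 3
    have "r3 j i 0 \<oplus> r3 j 0 i \<oplus> r3 i j 0 \<oplus> r3 0 j i \<oplus> r3 i 0 j \<oplus> r3 0 i j = \<zero>"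
      using ge[of j i] 3 assms by simp
    then show ?thesis by (simp add: a_ac)
  qed
qed

text \<open>The formal counterpart of multiplying the monomial \<open>a, b, c, d\<close> by \<open>e\<^sub>1\<close> of \<open>u i\<close>. If \<open>d = 0\<close> this is the
definition of \<open>reduce4\<close>. Otherwise the factors \<open>u i\<close> and \<open>u d\<close> are distributed over the free places in both orders,
which gives zero by \<open>reduce3_mixed\<close> or by the change of sign in degree three.\<close>

lemma reduce4_e1:
  assumes "a < 4" "b < 4" "c < 4" "d < 4" "0 < i" "i < 4"
  shows "(if a = 0 then r4 i b c d else \<zero>) \<oplus> (if b = 0 then r4 a i c d else \<zero>) \<oplus>
    (if c = 0 then r4 a b i d else \<zero>) \<oplus> (if d = 0 then r4 a b c i else \<zero>) = \<zero>"
proof (cases "d = 0")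
  case True
  then show ?thesis using assms by (simp add: reduce4_def r_neg)
next
  case False
  then have d: "0 < d" by simp
  have [simp]: "i \<noteq> 0" "d \<noteq> 0" using assms d by auto
  have neg: "\<ominus> x \<oplus> \<ominus> y = \<zero>" if "x \<oplus> y = \<zero>" "x \<in> carrier R" "y \<in> carrier R" for x y
    using that by (simp add: minus_add[symmetric])
  have swap: "r3 a i d \<oplus> r3 a d i = \<zero>" "r3 i a d \<oplus> r3 d a i = \<zero>" "r3 i d a \<oplus> r3 d i a = \<zero>"
    if "0 < a" "a < 4" for a
  proof -
    note s = reduce3_swap[OF that assms(5,6) d assms(4)] reduce3_swap[OF that d assms(4) assms(5,6)]
      reduce3_swap[OF assms(5,6) that d assms(4)] reduce3_swap[OF assms(5,6) d assms(4) that]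
      reduce3_swap[OF d assms(4) that assms(5,6)]
    show "r3 a i d \<oplus> r3 a d i = \<zero>" by (simp add: s(2) r_neg)
    show "r3 i d a \<oplus> r3 d i a = \<zero>" by (simp add: s(7) r_neg)
    have "r3 d a i = \<ominus> r3 a d i" "r3 i a d = \<ominus> r3 a i d" "r3 a d i = \<ominus> r3 a i d"
      using s(1,2,3) by blast+
    then show "r3 i a d \<oplus> r3 d a i = \<zero>" by (simp add: l_neg)
  qed
  show ?thesis
  proof (cases "a = 0"; cases "b = 0"; cases "c = 0")
    assume "a = 0" "b = 0" "c = 0"
    moreover have "\<ominus> (r3 i d 0 \<oplus> r3 i 0 d) \<oplus> \<ominus> (r3 d i 0 \<oplus> r3 0 i d) \<oplus> \<ominus> (r3 d 0 i \<oplus> r3 0 d i) = \<zero>"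
      using reduce3_mixed[OF assms(5,6) d assms(4)]
      by (simp add: minus_add[symmetric] a_assoc)
    ultimately show ?thesis by (simp add: reduce4_def)
  next
    assume "a = 0" "b = 0" "c \<noteq> 0"
    then show ?thesis using neg[OF swap(3)[of c]] assms by (simp add: reduce4_def)
  next
    assume "a = 0" "b \<noteq> 0" "c = 0"
    then show ?thesis using neg[OF swap(2)[of b]] assms by (simp add: reduce4_def)
  next
    assume "a \<noteq> 0" "b = 0" "c = 0"
    then show ?thesis using neg[OF swap(1)[of a]] assms by (simp add: reduce4_def)
  qed (simp_all add: reduce4_def)
qed

text \<open>The same for \<open>e\<^sub>2\<close>, with the six products of two conjugates grouped as in \<open>esym_4\<close>. All terms of degree three vanish, since
\<open>u i\<close> repeats.\<close>

lemma reduce4_e2: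
  assumes "a < 4" "b < 4" "c < 4" "d < 4" "0 < i" "i < 4"
  shows "(if a = 0 \<and> b = 0 then r4 i i c d else \<zero>) \<oplus>
    ((if a = 0 \<and> c = 0 then r4 i b i d else \<zero>) \<oplus> (if b = 0 \<and> c = 0 then r4 a i i d else \<zero>)) \<oplus>
    ((if a = 0 \<and> d = 0 then r4 i b c i else \<zero>) \<oplus> (if b = 0 \<and> d = 0 then r4 a i c i else \<zero>) \<oplus>
     (if c = 0 \<and> d = 0 then r4 a b i i else \<zero>)) = \<zero>"
proof -
  have [simp]: "i \<noteq> 0" using assms by simp
  note rep = reduce3_repeat
  consider (full) "a = 0" "b = 0" "c = 0" "d = 0" | (zero) "d = 0" "\<not> (a = 0 \<and> b = 0 \<and> c = 0)" | (pos) "d \<noteq> 0"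
    by blast
  then show ?thesis
  proof cases
    case full
    let ?x = "r3 i i 0" and ?y = "r3 i 0 i" and ?z = "r3 0 i i"
    have s: "?x \<oplus> ?y \<oplus> ?z = \<zero>"
      by (simp only: reduce3_square[OF assms(5,6)] r_neg a_closed reduce3_closed)
    have "?x \<oplus> (?y \<oplus> ?z) \<oplus> (\<ominus> (?x \<oplus> ?y) \<oplus> \<ominus> (?x \<oplus> ?z) \<oplus> \<ominus> (?y \<oplus> ?z))
        = (?x \<oplus> ?y \<oplus> ?z) \<oplus> \<ominus> ((?x \<oplus> ?y \<oplus> ?z) \<oplus> (?x \<oplus> ?y \<oplus> ?z))"
      by (simp add: minus_add[symmetric] a_ac del: minus_add)
    also have "\<dots> = \<zero>" by (simp only: s r_zero zero_closed minus_zero)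
    finally show ?thesis using full by (simp add: reduce4_def)
  next
    case zero
    then show ?thesis using assms(5)
      by (cases "a = 0"; cases "b = 0"; cases "c = 0") (simp_all add: reduce4_def rep)
  next
    case pos
    then show ?thesis using assms(5)
      by (cases "a = 0"; cases "b = 0"; cases "c = 0") (simp_all add: reduce4_def rep)
  qed
qed

end

end

section \<open>The relations of the closure\<close>

lemma (in algebra) scalar_hom: "ring_hom_cring R M (\<lambda>b. b \<odot>\<^bsub>M\<^esub> \<one>\<^bsub>M\<^esub>)"
proof (rule ring_hom_cringI[OF R_cring M_cring])
  show "(\<lambda>b. b \<odot>\<^bsub>M\<^esub> \<one>\<^bsub>M\<^esub>) \<in> ring_hom R M"
    by (rule ring_hom_memI) (simp_all add: smult_l_distr smult_assoc1 smult_assoc2)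
qed

context square_zero_algebra
begin

lemma coord_closed: "i < 4 \<Longrightarrow> v \<in> carrier A \<Longrightarrow> coord i v \<in> carrier B"
  by (rule linear_formD(1)[OF coord_form])

definition nil_part :: "'a \<Rightarrow> 'a"
  where "nil_part v = coord 1 v \<odot>\<^bsub>A\<^esub> u 1 \<oplus>\<^bsub>A\<^esub> (coord 2 v \<odot>\<^bsub>A\<^esub> u 2 \<oplus>\<^bsub>A\<^esub> coord 3 v \<odot>\<^bsub>A\<^esub> u 3)"

lemma nil_part_closed: "v \<in> carrier A \<Longrightarrow> nil_part v \<in> carrier A"
  by (simp add: nil_part_def coord_closed u_closed)

lemma decompose:
  assumes v: "v \<in> carrier A"
  shows "v = coord 0 v \<odot>\<^bsub>A\<^esub> \<one>\<^bsub>A\<^esub> \<oplus>\<^bsub>A\<^esub> nil_part v"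
proof -
  have four: "{..<4} = {0, 1, 2, 3::nat}" by auto
  have c: "coord i v \<in> carrier B" "u i \<in> carrier A" if "i < 4" for i
    using coord_closed that v u_closed by auto
  have "(\<Oplus>\<^bsub>A\<^esub>i\<in>{..<4}. coord i v \<odot>\<^bsub>A\<^esub> u i) = coord 0 v \<odot>\<^bsub>A\<^esub> \<one>\<^bsub>A\<^esub> \<oplus>\<^bsub>A\<^esub> nil_part v"
    unfolding four nil_part_def using c by (simp add: u_0)
  then show ?thesis using u_span[OF v] by simp
qed

text \<open>Only the constant term of \<open>v\<close> survives.\<close>

lemma u_mult_right:
  assumes v: "v \<in> carrier A" and j: "0 < j" "j < 4"
  shows "v \<otimes>\<^bsub>A\<^esub> u j = coord 0 v \<odot>\<^bsub>A\<^esub> u j"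
proof -
  have "v \<otimes>\<^bsub>A\<^esub> u j = (coord 0 v \<odot>\<^bsub>A\<^esub> \<one>\<^bsub>A\<^esub> \<oplus>\<^bsub>A\<^esub> nil_part v) \<otimes>\<^bsub>A\<^esub> u j"
    using decompose[OF v] by simp
  also have "\<dots> = coord 0 v \<odot>\<^bsub>A\<^esub> u j"
    using v j u_mult[of 1 j] u_mult[of 2 j] u_mult[of 3 j]
    by (simp add: nil_part_def A.l_distr A.smult_assoc2 coord_closed u_closed)
  finally show ?thesis .
qed

lemma nil_part_mult:
  assumes v: "v \<in> carrier A" and w: "w \<in> carrier A"
  shows "nil_part v \<otimes>\<^bsub>A\<^esub> w = coord 0 w \<odot>\<^bsub>A\<^esub> nil_part v"
proof -
  have "u j \<otimes>\<^bsub>A\<^esub> w = coord 0 w \<odot>\<^bsub>A\<^esub> u j" if "0 < j" "j < 4" for j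
    using u_mult_right[OF w that] w u_closed[OF that(2)] by (simp add: A.m_comm)
  moreover have "b \<odot>\<^bsub>A\<^esub> (c \<odot>\<^bsub>A\<^esub> x) = c \<odot>\<^bsub>A\<^esub> (b \<odot>\<^bsub>A\<^esub> x)"
    if "b \<in> carrier B" "c \<in> carrier B" "x \<in> carrier A" for b c x
    using that by (simp add: A.smult_assoc1[symmetric] A.R.m_comm)
  ultimately show ?thesis
    using v w by (simp add: nil_part_def A.l_distr A.smult_assoc2 A.smult_r_distr coord_closed u_closed)
qed

lemma coord_0_nil_part: "v \<in> carrier A \<Longrightarrow> coord 0 (nil_part v) = \<zero>"
  by (simp add: nil_part_def linear_formD[OF coord_form] coord_closed u_closed coord_u)

lemma char_coeff_trunc:
  assumes v: "v \<in> carrier A" and j: "j \<le> 4"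
  shows "char_coeff B A 4 j v = esym B 4 j (\<lambda>_. coord 0 v)"
proof -
  have "char_coeff B A 4 j (coord 0 v \<odot>\<^bsub>A\<^esub> \<one>\<^bsub>A\<^esub> \<oplus>\<^bsub>A\<^esub> nil_part v) = esym B 4 j (\<lambda>_. coord 0 v)"
    using v u_basis coord_form[of 0]
    by (intro char_coeff_rank_one[where l = "coord 0"] A.algebra_axioms exI j)
      (simp_all add: coord_closed nil_part_closed nil_part_mult coord_0_nil_part)
  then show ?thesis using decompose[OF v] by simp
qed

end

text \<open>Four homomorphisms from \<open>A\<close> into an algebra: the universal case is the tensor power with its four factors, and the
case of interest its quotients.\<close>

locale conjugate_family = square_zero_algebra B A u coord + C: algebra B C
  for B :: "('b, 'm) ring_scheme" (structure) and A :: "('b, 'a, 'k) module_scheme"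
    and u and coord and C :: "('b, 'c, 'l) module_scheme" +
  fixes \<iota> :: "nat \<Rightarrow> 'a \<Rightarrow> 'c"
  assumes \<iota>_hom: "k < 4 \<Longrightarrow> \<iota> k \<in> alg_hom B A C"
begin

definition X :: "nat \<Rightarrow> nat \<Rightarrow> 'c"
  where "X i k = \<iota> k (u i)"

lemma X_closed: "i < 4 \<Longrightarrow> k < 4 \<Longrightarrow> X i k \<in> carrier C"
  unfolding X_def by (intro alg_homD(2)[OF \<iota>_hom] u_closed)

lemma X_0: "k < 4 \<Longrightarrow> X 0 k = \<one>\<^bsub>C\<^esub>"
  unfolding X_def u_0 by (rule alg_homD(5)[OF \<iota>_hom])

lemma X_mult: "\<lbrakk>0 < i; i < 4; 0 < j; j < 4; k < 4\<rbrakk> \<Longrightarrow> X i k \<otimes>\<^bsub>C\<^esub> X j k = \<zero>\<^bsub>C\<^esub>"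
proof -
  assume a: "0 < i" "i < 4" "0 < j" "j < 4" "k < 4"
  interpret h: ring_hom_cring A C "\<iota> k"
    by (rule alg_hom_ring_hom_cring[OF A.algebra_axioms C.algebra_axioms \<iota>_hom[OF a(5)]])
  show ?thesis unfolding X_def using a
    by (simp add: h.hom_mult[symmetric] u_closed u_mult del: h.hom_mult)
qed

text \<open>The relations of the closure for all elements of \<open>A\<close>. They are equivalent to the finitely many relations of
\<open>four_conjugates\<close>.\<close>

definition generic_relations :: bool
  where "generic_relations \<longleftrightarrow> (\<forall>a\<in>carrier A. \<forall>j. 1 \<le> j \<and> j \<le> 4 \<longrightarrow>
    char_coeff B A 4 j a \<odot>\<^bsub>C\<^esub> \<one>\<^bsub>C\<^esub> = esym C 4 j (\<lambda>k. \<iota> k a))"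

lemma four_conjugates_if_generic:
  assumes "generic_relations"
  shows "four_conjugates C X"
proof -
  have rel: "esym C 4 j (X i) = \<zero>\<^bsub>C\<^esub>" if ij: "0 < i" "i < 4" "1 \<le> j" "j \<le> 4" for i j
  proof -
    have "coord 0 (u i) = \<zero>" using ij by (simp add: coord_u)
    then have "char_coeff B A 4 j (u i) = esym B 4 j (\<lambda>_. \<zero> \<otimes> \<one>)"
      using ij by (simp add: char_coeff_trunc u_closed)
    also have "\<dots> = \<zero>"
      using ij by (subst A.R.esym_scale) (auto simp: A.R.esym_closed A.R.nat_pow_zero)
    finally have "char_coeff B A 4 j (u i) \<odot>\<^bsub>C\<^esub> \<one>\<^bsub>C\<^esub> = \<zero>\<^bsub>C\<^esub>" by simp
    then show ?thesis using assms ij u_closed[OF ij(2)] by (simp add: generic_relations_def X_def[abs_def])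
  qed
  show ?thesis
    by unfold_locales (simp_all add: X_closed X_0 X_mult rel)
qed

text \<open>An element of \<open>A\<close> is a constant plus a combination of \<open>u 1\<close>, \<open>u 2\<close>, \<open>u 3\<close>. The positive \<open>e\<^sub>j\<close> vanish for each \<open>u i\<close>, hence
for its multiples, hence for the sum; and the constant turns them into \<open>e\<^sub>j(b, b, b, b)\<close>, which is the
characteristic coefficient.\<close>

lemma generic_if_four_conjugates:
  assumes "four_conjugates C X"
  shows "generic_relations"
  unfolding generic_relations_def
proof (intro ballI allI impI)
  fix a and j :: nat
  assume a: "a \<in> carrier A" and j: "1 \<le> j \<and> j \<le> 4"
  interpret F: four_conjugates C X by fact
  interpret h: ring_hom_cring B C "\<lambda>b. b \<odot>\<^bsub>C\<^esub> \<one>\<^bsub>C\<^esub>" by (rule C.scalar_hom)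
  let ?h = "\<lambda>b. b \<odot>\<^bsub>C\<^esub> \<one>\<^bsub>C\<^esub>"
  \<comment> \<open>The component of \<open>a\<close> along \<open>u i\<close> in the factor \<open>k\<close>.\<close>
  define w where "w i k = ?h (coord i a) \<otimes>\<^bsub>C\<^esub> X i k" for i k
  have wc: "w i k \<in> carrier C" if "i < 4" "k < 4" for i k
    unfolding w_def using that a by (simp add: coord_closed X_closed)
  have wf: "w i \<in> {..<4} \<rightarrow> carrier C" if "i < 4" for i using wc that by auto
  have w_zero: "\<forall>j>0. esym C 4 j (w i) = \<zero>\<^bsub>C\<^esub>" if i: "0 < i" "i < 4" for i
  proof (intro allI impI)
    fix j :: nat assume "0 < j"
    have "X i \<in> {..<4} \<rightarrow> carrier C" using X_closed i by auto
    then have "esym C 4 j (w i) = ?h (coord i a) [^]\<^bsub>C\<^esub> j \<otimes>\<^bsub>C\<^esub> esym C 4 j (X i)"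
      unfolding w_def[abs_def] using a i coord_closed by (intro C.esym_scale) auto
    then show "esym C 4 j (w i) = \<zero>\<^bsub>C\<^esub>"
      using F.esym_X_eq_zero[OF i] \<open>0 < j\<close> a i coord_closed by simp
  qed
  have orth: "w i k \<otimes>\<^bsub>C\<^esub> w l k = \<zero>\<^bsub>C\<^esub>" if "0 < i" "i < 4" "0 < l" "l < 4" "k < 4" for i l k
  proof -
    have cl: "?h (coord i a) \<in> carrier C" "?h (coord l a) \<in> carrier C" using that a coord_closed by auto
    have "w i k \<otimes>\<^bsub>C\<^esub> w l k = (?h (coord i a) \<otimes>\<^bsub>C\<^esub> ?h (coord l a)) \<otimes>\<^bsub>C\<^esub> (X i k \<otimes>\<^bsub>C\<^esub> X l k)"
      unfolding w_def using cl X_closed[of i k] X_closed[of l k] that by (simp only: C.m_ac C.m_closed)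
    then show ?thesis using that cl by (simp only: X_mult C.r_null C.m_closed)
  qed
  define v where "v k = w 1 k \<oplus>\<^bsub>C\<^esub> (w 2 k \<oplus>\<^bsub>C\<^esub> w 3 k)" for k
  have v23: "\<forall>j>0. esym C 4 j (\<lambda>k. w 2 k \<oplus>\<^bsub>C\<^esub> w 3 k) = \<zero>\<^bsub>C\<^esub>"
    by (rule C.esym_add_zero) (simp_all add: wf orth w_zero)
  have v_zero: "\<forall>j>0. esym C 4 j v = \<zero>\<^bsub>C\<^esub>"
    unfolding v_def[abs_def]
  proof (rule C.esym_add_zero)
    show "(\<lambda>k. w 2 k \<oplus>\<^bsub>C\<^esub> w 3 k) \<in> {..<4} \<rightarrow> carrier C" using wc by auto
    show "w 1 k \<otimes>\<^bsub>C\<^esub> (w 2 k \<oplus>\<^bsub>C\<^esub> w 3 k) = \<zero>\<^bsub>C\<^esub>" if "k < 4" for k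
      using that by (simp add: C.r_distr wc orth)
  qed (simp_all add: wf w_zero v23)
  have vf: "v \<in> {..<4} \<rightarrow> carrier C" unfolding v_def using wc by auto
  have \<iota>_a: "\<iota> k a = ?h (coord 0 a) \<oplus>\<^bsub>C\<^esub> v k" if k: "k < 4" for k
  proof -
    note hom = alg_homD[OF \<iota>_hom[OF k]]
    have "\<iota> k a = \<iota> k (coord 0 a \<odot>\<^bsub>A\<^esub> \<one>\<^bsub>A\<^esub> \<oplus>\<^bsub>A\<^esub> nil_part a)" using decompose[OF a] by simp
    also have "\<dots> = coord 0 a \<odot>\<^bsub>C\<^esub> \<one>\<^bsub>C\<^esub> \<oplus>\<^bsub>C\<^esub>
        (coord 1 a \<odot>\<^bsub>C\<^esub> X 1 k \<oplus>\<^bsub>C\<^esub> (coord 2 a \<odot>\<^bsub>C\<^esub> X 2 k \<oplus>\<^bsub>C\<^esub> coord 3 a \<odot>\<^bsub>C\<^esub> X 3 k))"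
      using a by (simp add: nil_part_def hom X_def coord_closed u_closed)
    also have "\<dots> = ?h (coord 0 a) \<oplus>\<^bsub>C\<^esub> v k"
      unfolding v_def w_def using a k
      by (simp add: C.smult_assoc2 coord_closed X_closed)
    finally show ?thesis .
  qed
  have "esym C 4 j (\<lambda>k. \<iota> k a) = esym C 4 j (\<lambda>k. ?h (coord 0 a) \<oplus>\<^bsub>C\<^esub> v k)"
    using a \<iota>_a alg_homD(2)[OF \<iota>_hom] by (intro C.esym_cong) auto
  also have "\<dots> = esym C 4 j (\<lambda>k. ?h (coord 0 a))"
    using a vf v_zero coord_closed by (intro C.esym_translate) auto
  also have "\<dots> = ?h (esym B 4 j (\<lambda>_. coord 0 a))"
    using a coord_closed by (subst h.hom_esym) (auto simp: comp_def)
  also have "\<dots> = char_coeff B A 4 j a \<odot>\<^bsub>C\<^esub> \<one>\<^bsub>C\<^esub>"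
    using a j by (simp add: char_coeff_trunc)
  finally show "char_coeff B A 4 j a \<odot>\<^bsub>C\<^esub> \<one>\<^bsub>C\<^esub> = esym C 4 j (\<lambda>k. \<iota> k a)" ..
qed

end

section \<open>A basis of the closure\<close>

text \<open>The enumeration of the normal monomials that indexes the basis.\<close>

definition normal_list :: "(nat \<times> nat \<times> nat) list"
  where "normal_list = filter (\<lambda>(a, b, c). normal_monomial a b c)
    (List.product [0..<4] (List.product [0..<4] [0..<4]))"

lemma length_normal_list: "length normal_list = 32"
  by code_simp

lemma distinct_normal_list: "distinct normal_list"
  unfolding normal_list_def by (intro distinct_filter distinct_product distinct_upt)

lemma set_normal_list:
  "(a, b, c) \<in> set normal_list \<longleftrightarrow> a < 4 \<and> b < 4 \<and> c < 4 \<and> normal_monomial a b c"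
  by (auto simp: normal_list_def)

context square_zero_algebra
begin

interpretation TP: algebra_power B A 4 ..

interpretation CT: conjugate_family B A u coord "tensor_power B A 4" "tensor_factor B A 4"
  by (unfold_locales) (rule TP.tensor_factor_alg_hom)

abbreviation "T \<equiv> tensor_power B A 4"
abbreviation "tf \<equiv> tensor_factor B A 4"
abbreviation "pt \<equiv> pure_tensor B A 4"

lemma pure_tensor_factors:
  assumes t: "t \<in> {..<4} \<rightarrow>\<^sub>E carrier A"
  shows "pt t = tf 0 (t 0) \<otimes>\<^bsub>T\<^esub> tf 1 (t 1) \<otimes>\<^bsub>T\<^esub> tf 2 (t 2) \<otimes>\<^bsub>T\<^esub> tf 3 (t 3)"
proof -
  have tc: "t i \<in> carrier A" if "i < 4" for i using t that by auto
  let ?s = "\<lambda>i. \<lambda>k\<in>{..<4}. if k = i then t i else \<one>\<^bsub>A\<^esub>"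
  let ?m = "\<lambda>s s'. \<lambda>k\<in>{..<4}. s k \<otimes>\<^bsub>A\<^esub> s' k"
  have s: "?s i \<in> {..<4} \<rightarrow>\<^sub>E carrier A" if "i < 4" for i using tc that by auto
  have m: "?m p q \<in> {..<4} \<rightarrow>\<^sub>E carrier A" if "p \<in> {..<4} \<rightarrow>\<^sub>E carrier A" "q \<in> {..<4} \<rightarrow>\<^sub>E carrier A" for p q
    using that by (auto simp: PiE_iff)
  have s0: "?s 0 \<in> {..<4} \<rightarrow>\<^sub>E carrier A" "?s 1 \<in> {..<4} \<rightarrow>\<^sub>E carrier A"
    "?s 2 \<in> {..<4} \<rightarrow>\<^sub>E carrier A" "?s 3 \<in> {..<4} \<rightarrow>\<^sub>E carrier A"
    by (rule s, simp)+
  have "tf 0 (t 0) \<otimes>\<^bsub>T\<^esub> tf 1 (t 1) \<otimes>\<^bsub>T\<^esub> tf 2 (t 2) \<otimes>\<^bsub>T\<^esub> tf 3 (t 3)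
      = pt (?m (?m (?m (?s 0) (?s 1)) (?s 2)) (?s 3))"
    unfolding tensor_factor_def
    by (simp only: TP.pure_tensor_mult s0 m)
  also have "?m (?m (?m (?s 0) (?s 1)) (?s 2)) (?s 3) = t"
  proof
    fix i
    show "?m (?m (?m (?s 0) (?s 1)) (?s 2)) (?s 3) i = t i"
    proof (cases "i < 4")
      case True
      then show ?thesis using less_4_cases[OF True] tc by auto
    next
      case False
      then show ?thesis using t by (auto simp: PiE_iff extensional_def)
    qed
  qed
  finally show ?thesis ..
qed

definition mon4 :: "nat \<Rightarrow> nat \<Rightarrow> nat \<Rightarrow> nat \<Rightarrow> ((nat \<Rightarrow> 'a) \<Rightarrow> 'b) set"
  where "mon4 a b c d = tf 0 (u a) \<otimes>\<^bsub>T\<^esub> tf 1 (u b) \<otimes>\<^bsub>T\<^esub> tf 2 (u c) \<otimes>\<^bsub>T\<^esub> tf 3 (u d)"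

lemma tf_closed: "k < 4 \<Longrightarrow> a \<in> carrier A \<Longrightarrow> tf k a \<in> carrier T"
  by (rule alg_homD(2)[OF TP.tensor_factor_alg_hom])

lemma mon4_closed: "\<lbrakk>a < 4; b < 4; c < 4; d < 4\<rbrakk> \<Longrightarrow> mon4 a b c d \<in> carrier T"
  unfolding mon4_def by (intro TP.T.m_closed tf_closed u_closed) simp_all

text \<open>For varying entry \<open>k\<close>, membership of a pure tensor in a submodule is a linear condition, so it need only be checked for the
basis of \<open>A\<close>.\<close>

lemma slot_submodule:
  assumes N: "submodule N B T" and t: "t \<in> {..<4} \<rightarrow>\<^sub>E carrier A" and k: "k < 4"
  shows "submodule {a \<in> carrier A. pt (t(k := a)) \<in> N} B A"
proof (rule A.submoduleI)
  note Ncl = TP.T.submoduleE[OF N]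
  note add = TP.pure_tensor_add[OF t k] and smult = TP.pure_tensor_smult[OF t k]
  have smult_mem: "b \<odot>\<^bsub>A\<^esub> a \<in> {a \<in> carrier A. pt (t(k := a)) \<in> N}"
    if "b \<in> carrier B" "a \<in> {a \<in> carrier A. pt (t(k := a)) \<in> N}" for b a
    using that Ncl by (simp add: smult)
  then show "\<And>b a. b \<in> carrier B \<Longrightarrow> a \<in> {a \<in> carrier A. pt (t(k := a)) \<in> N} \<Longrightarrow>
      b \<odot>\<^bsub>A\<^esub> a \<in> {a \<in> carrier A. pt (t(k := a)) \<in> N}" .
  show "\<zero>\<^bsub>A\<^esub> \<in> {a \<in> carrier A. pt (t(k := a)) \<in> N}"
  proof -
    have tk: "t(k := \<one>\<^bsub>A\<^esub>) \<in> {..<4} \<rightarrow>\<^sub>E carrier A" by (rule TP.tuple_upd[OF t k]) simp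
    obtain x where "x \<in> N" using Ncl(2) by blast
    then have "\<zero> \<odot>\<^bsub>T\<^esub> x \<in> N" "x \<in> carrier T" using Ncl(1,4) by auto
    then have "\<zero>\<^bsub>T\<^esub> \<in> N" by simp
    moreover have "pt (t(k := \<zero> \<odot>\<^bsub>A\<^esub> \<one>\<^bsub>A\<^esub>)) = \<zero>\<^bsub>T\<^esub>"
      using TP.pure_tensor_closed[OF tk] by (subst smult) simp_all
    ultimately show ?thesis by simp
  qed
  show "\<ominus>\<^bsub>A\<^esub> a \<in> {a \<in> carrier A. pt (t(k := a)) \<in> N}" if "a \<in> {a \<in> carrier A. pt (t(k := a)) \<in> N}" for a
    using smult_mem[of "\<ominus> \<one>" a] that by (simp add: A.smult_l_minus)
  show "a \<oplus>\<^bsub>A\<^esub> a' \<in> {a \<in> carrier A. pt (t(k := a)) \<in> N}"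
    if "a \<in> {a \<in> carrier A. pt (t(k := a)) \<in> N}" "a' \<in> {a \<in> carrier A. pt (t(k := a)) \<in> N}" for a a'
    using that Ncl by (simp add: add)
qed auto

lemma submodule_A_full:
  assumes S: "submodule S B A" and uS: "\<And>i. i < 4 \<Longrightarrow> u i \<in> S" and v: "v \<in> carrier A"
  shows "v \<in> S"
proof -
  note Scl = A.submoduleE[OF S]
  have "coord 0 v \<odot>\<^bsub>A\<^esub> u 0 \<oplus>\<^bsub>A\<^esub> nil_part v \<in> S"
    unfolding nil_part_def using v by (intro Scl(4,5) uS coord_closed) simp_all
  then show ?thesis using decompose[OF v] by (simp add: u_0)
qed

lemma tensor_power_mon4_induct:
  assumes N: "submodule N B T"
    and mon: "\<And>a b c d. \<lbrakk>a < 4; b < 4; c < 4; d < 4\<rbrakk> \<Longrightarrow> mon4 a b c d \<in> N"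
    and v: "v \<in> carrier T"
  shows "v \<in> N"
proof -
  \<comment> \<open>From tensors of basis elements to all pure tensors, one entry at a time: the entries below \<open>k\<close> are arbitrary.\<close>
  have slots: "pt t \<in> N"
    if "k \<le> 4" "t \<in> {..<4} \<rightarrow>\<^sub>E carrier A" "\<And>i. k \<le> i \<Longrightarrow> i < 4 \<Longrightarrow> \<exists>a<4. t i = u a" for k t
    using that
  proof (induction k arbitrary: t)
    case 0
    obtain a b c d where "a < 4" "t 0 = u a" "b < 4" "t 1 = u b" "c < 4" "t 2 = u c" "d < 4" "t 3 = u d"
      using 0(3)[of 0] 0(3)[of 1] 0(3)[of 2] 0(3)[of 3] by auto
    then show ?case using mon[of a b c d] pure_tensor_factors[OF 0(2)] by (simp add: mon4_def)
  next
    case (Suc k)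
    have k: "k < 4" using Suc by simp
    have "t k \<in> {a \<in> carrier A. pt (t(k := a)) \<in> N}"
    proof (rule submodule_A_full[OF slot_submodule[OF N Suc.prems(2) k]])
      show "t k \<in> carrier A" using Suc.prems(2) k by auto
      fix i :: nat assume i: "i < 4"
      have "pt (t(k := u i)) \<in> N"
      proof (rule Suc.IH)
        show "t(k := u i) \<in> {..<4} \<rightarrow>\<^sub>E carrier A" by (rule TP.tuple_upd[OF Suc.prems(2) k u_closed[OF i]])
        show "\<exists>a<4. (t(k := u i)) l = u a" if "k \<le> l" "l < 4" for l
          using that i Suc.prems(3)[of l] by (cases "l = k") auto
      qed (use k in simp)
      then show "u i \<in> {a \<in> carrier A. pt (t(k := a)) \<in> N}" using u_closed[OF i] by simp
    qed
    then show ?case by simp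
  qed
  show ?thesis
    by (rule TP.tensor_power_induct[OF v N], rule slots[of 4]) auto
qed

text \<open>The 256 monomials are independent in the tensor power: products of coordinate forms give the dual forms, and these can be combined
with arbitrary coefficients.\<close>

lemma form_on_mon4:
  assumes f: "\<And>a b c d. f a b c d \<in> carrier B"
  obtains l where "linear_form B T l"
    "\<And>a b c d. \<lbrakk>a < 4; b < 4; c < 4; d < 4\<rbrakk> \<Longrightarrow> l (mon4 a b c d) = f a b c d"
proof -
  define P where "P = {..<4::nat} \<times> {..<4::nat} \<times> {..<4::nat} \<times> {..<4::nat}"
  have P: "finite P" by (simp add: P_def)
  have "\<exists>l. linear_form B T l \<and> (\<forall>a b c d. a < 4 \<and> b < 4 \<and> c < 4 \<and> d < 4 \<longrightarrow>
      l (mon4 a b c d) = (if (a, b, c, d) = p then \<one> else \<zero>))" if pP: "p \<in> P" for p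
  proof -
    obtain a' b' c' d' where p: "p = (a', b', c', d')" "a' < 4" "b' < 4" "c' < 4" "d' < 4"
      using pP by (cases p) (auto simp: P_def)
    define \<phi> where "\<phi> i = coord (if i = 0 then a' else if i = 1 then b' else if i = 2 then c' else d')" for i :: nat
    have "linear_form B A (\<phi> i)" for i
      unfolding \<phi>_def using p by (intro coord_form) auto
    then obtain l where l: "linear_form B T l"
      "\<And>t. t \<in> {..<4} \<rightarrow>\<^sub>E carrier A \<Longrightarrow> l (pt t) = (\<Otimes>i\<in>{..<4}. \<phi> i (t i))"
      using TP.tensor_power_product_form[of \<phi>] by blast
    have "l (mon4 a b c d) = (if (a, b, c, d) = p then \<one> else \<zero>)"
      if abcd: "a < 4" "b < 4" "c < 4" "d < 4" for a b c d
    proof -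
      define t where "t = (\<lambda>i\<in>{..<4::nat}. u (if i = 0 then a else if i = 1 then b else if i = 2 then c else d))"
      have t: "t \<in> {..<4} \<rightarrow>\<^sub>E carrier A" unfolding t_def using abcd u_closed by auto
      have t_vals: "t 0 = u a" "t 1 = u b" "t 2 = u c" "t 3 = u d" by (simp_all add: t_def)
      have four: "{..<4} = {0, 1, 2, 3::nat}" by auto
      have "mon4 a b c d = pt t" unfolding pure_tensor_factors[OF t] t_vals mon4_def ..
      then have "l (mon4 a b c d) = (\<Otimes>i\<in>{0, 1, 2, 3}. \<phi> i (t i))" using l(2)[OF t] by (simp add: four)
      also have "\<dots> = \<phi> 0 (t 0) \<otimes> (\<phi> 1 (t 1) \<otimes> (\<phi> 2 (t 2) \<otimes> \<phi> 3 (t 3)))"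
      proof -
        have "\<phi> 0 (t 0) \<in> carrier B" "\<phi> 1 (t 1) \<in> carrier B" "\<phi> 2 (t 2) \<in> carrier B" "\<phi> 3 (t 3) \<in> carrier B"
          using abcd p by (simp_all add: \<phi>_def t_vals coord_u)
        then show ?thesis by simp
      qed
      also have "\<dots> = coord a' (u a) \<otimes> (coord b' (u b) \<otimes> (coord c' (u c) \<otimes> coord d' (u d)))"
        by (simp add: \<phi>_def t_vals)
      also have "\<dots> = (if (a, b, c, d) = p then \<one> else \<zero>)"
        using abcd p by (simp add: coord_u)
      finally show ?thesis .
    qed
    with l(1) show ?thesis by blast
  qed
  then obtain l where l: "\<And>p. p \<in> P \<Longrightarrow> linear_form B T (l p)"
    "\<And>p a b c d. \<lbrakk>p \<in> P; a < 4; b < 4; c < 4; d < 4\<rbrakk> \<Longrightarrow>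
      l p (mon4 a b c d) = (if (a, b, c, d) = p then \<one> else \<zero>)"
    by metis
  define F where "F p = (case p of (a, b, c, d) \<Rightarrow> f a b c d)" for p
  have Fc: "F p \<in> carrier B" for p by (simp add: F_def f split: prod.split)
  show thesis
  proof (rule that)
    show "linear_form B T (\<lambda>x. \<Oplus>p\<in>P. F p \<otimes> l p x)"
      using P Fc l(1) by (intro TP.T.linear_form_combination)
    fix a b c d :: nat assume abcd: "a < 4" "b < 4" "c < 4" "d < 4"
    have "(\<Oplus>p\<in>P. F p \<otimes> l p (mon4 a b c d)) = (\<Oplus>p\<in>P. if (a, b, c, d) = p then F p else \<zero>)"
      using abcd Fc l(2) by (intro A.R.finsum_cong') auto
    also have "\<dots> = F (a, b, c, d)"
      using abcd P Fc by (intro A.R.finsum_singleton) (auto simp: P_def)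
    finally show "(\<Oplus>p\<in>P. F p \<otimes> l p (mon4 a b c d)) = f a b c d" by (simp add: F_def)
  qed
qed

lemma absorb:
  assumes "a < 4" "0 < i" "i < 4" "k < 4"
  shows "tf k (u a) \<otimes>\<^bsub>T\<^esub> tf k (u i) = (if a = 0 then tf k (u i) else \<zero>\<^bsub>T\<^esub>)"
  using assms CT.X_mult[of a i k] CT.X_0[of k] CT.X_closed[of i k] by (cases "a = 0") (simp_all add: CT.X_def)

lemma mon4_mult:
  assumes abcd: "a < 4" "b < 4" "c < 4" "d < 4" and i: "0 < i" "i < 4"
  shows "mon4 a b c d \<otimes>\<^bsub>T\<^esub> tf 0 (u i) = (if a = 0 then mon4 i b c d else \<zero>\<^bsub>T\<^esub>)"
    and "mon4 a b c d \<otimes>\<^bsub>T\<^esub> tf 1 (u i) = (if b = 0 then mon4 a i c d else \<zero>\<^bsub>T\<^esub>)"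
    and "mon4 a b c d \<otimes>\<^bsub>T\<^esub> tf 2 (u i) = (if c = 0 then mon4 a b i d else \<zero>\<^bsub>T\<^esub>)"
    and "mon4 a b c d \<otimes>\<^bsub>T\<^esub> tf 3 (u i) = (if d = 0 then mon4 a b c i else \<zero>\<^bsub>T\<^esub>)"
proof -
  define w x y z where "w = tf 0 (u a)" "x = tf 1 (u b)" "y = tf 2 (u c)" "z = tf 3 (u d)"
  note defs = this
  define p where "p k = tf k (u i)" for k
  have cl: "w \<in> carrier T" "x \<in> carrier T" "y \<in> carrier T" "z \<in> carrier T"
    "p 0 \<in> carrier T" "p 1 \<in> carrier T" "p 2 \<in> carrier T" "p 3 \<in> carrier T"
    using abcd i by (simp_all add: defs p_def tf_closed u_closed)
  have ab: "w \<otimes>\<^bsub>T\<^esub> p 0 = (if a = 0 then p 0 else \<zero>\<^bsub>T\<^esub>)" "x \<otimes>\<^bsub>T\<^esub> p 1 = (if b = 0 then p 1 else \<zero>\<^bsub>T\<^esub>)"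
    "y \<otimes>\<^bsub>T\<^esub> p 2 = (if c = 0 then p 2 else \<zero>\<^bsub>T\<^esub>)" "z \<otimes>\<^bsub>T\<^esub> p 3 = (if d = 0 then p 3 else \<zero>\<^bsub>T\<^esub>)"
    unfolding defs p_def using abcd i by (simp_all add: absorb)
  have "w \<otimes>\<^bsub>T\<^esub> x \<otimes>\<^bsub>T\<^esub> y \<otimes>\<^bsub>T\<^esub> z \<otimes>\<^bsub>T\<^esub> p 0 = (w \<otimes>\<^bsub>T\<^esub> p 0) \<otimes>\<^bsub>T\<^esub> x \<otimes>\<^bsub>T\<^esub> y \<otimes>\<^bsub>T\<^esub> z"
    "w \<otimes>\<^bsub>T\<^esub> x \<otimes>\<^bsub>T\<^esub> y \<otimes>\<^bsub>T\<^esub> z \<otimes>\<^bsub>T\<^esub> p 1 = w \<otimes>\<^bsub>T\<^esub> (x \<otimes>\<^bsub>T\<^esub> p 1) \<otimes>\<^bsub>T\<^esub> y \<otimes>\<^bsub>T\<^esub> z"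
    "w \<otimes>\<^bsub>T\<^esub> x \<otimes>\<^bsub>T\<^esub> y \<otimes>\<^bsub>T\<^esub> z \<otimes>\<^bsub>T\<^esub> p 2 = w \<otimes>\<^bsub>T\<^esub> x \<otimes>\<^bsub>T\<^esub> (y \<otimes>\<^bsub>T\<^esub> p 2) \<otimes>\<^bsub>T\<^esub> z"
    "w \<otimes>\<^bsub>T\<^esub> x \<otimes>\<^bsub>T\<^esub> y \<otimes>\<^bsub>T\<^esub> z \<otimes>\<^bsub>T\<^esub> p 3 = w \<otimes>\<^bsub>T\<^esub> x \<otimes>\<^bsub>T\<^esub> y \<otimes>\<^bsub>T\<^esub> (z \<otimes>\<^bsub>T\<^esub> p 3)"
    using cl by (simp_all add: TP.T.m_ac)
  then show "mon4 a b c d \<otimes>\<^bsub>T\<^esub> tf 0 (u i) = (if a = 0 then mon4 i b c d else \<zero>\<^bsub>T\<^esub>)"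
    "mon4 a b c d \<otimes>\<^bsub>T\<^esub> tf 1 (u i) = (if b = 0 then mon4 a i c d else \<zero>\<^bsub>T\<^esub>)"
    "mon4 a b c d \<otimes>\<^bsub>T\<^esub> tf 2 (u i) = (if c = 0 then mon4 a b i d else \<zero>\<^bsub>T\<^esub>)"
    "mon4 a b c d \<otimes>\<^bsub>T\<^esub> tf 3 (u i) = (if d = 0 then mon4 a b c i else \<zero>\<^bsub>T\<^esub>)"
    unfolding ab using cl unfolding mon4_def defs[symmetric] p_def[symmetric] by simp_all
qed

lemma quot_conjugate_family:
  assumes "ideal K T"
  shows "conjugate_family B A u coord (quot_algebra T K) (\<lambda>k. quot_map T K \<circ> tf k)"
proof -
  interpret C: algebra B "quot_algebra T K" by (rule quot_algebra[OF TP.T.algebra_axioms assms])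
  show ?thesis
    by unfold_locales
      (rule alg_hom_comp[OF TP.tensor_factor_alg_hom quot_map_alg_hom[OF TP.T.algebra_axioms assms]])
qed

lemma quot_esym:
  assumes K: "ideal K T" and w: "w \<in> {..<4} \<rightarrow> carrier T"
  shows "quot_map T K (esym T 4 j w) = esym (quot_algebra T K) 4 j (quot_map T K \<circ> w)"
  by (rule ring_hom_cring.hom_esym[OF alg_hom_ring_hom_cring[OF TP.T.algebra_axioms
        quot_algebra[OF TP.T.algebra_axioms K] quot_map_alg_hom[OF TP.T.algebra_axioms K]] w])

definition relator :: "nat \<Rightarrow> 'a \<Rightarrow> ((nat \<Rightarrow> 'a) \<Rightarrow> 'b) set"
  where "relator j a = char_coeff B A 4 j a \<odot>\<^bsub>T\<^esub> \<one>\<^bsub>T\<^esub> \<ominus>\<^bsub>T\<^esub> esym T 4 j (\<lambda>k. tf k a)"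

lemma Sn_generators_relators:
  "Sn_generators B A 4 = {relator j a | j a. 1 \<le> j \<and> j \<le> 4 \<and> a \<in> carrier A}"
  unfolding Sn_generators_def relator_def esym_def Let_def by (rule refl)

lemma relator_parts_closed:
  assumes "a \<in> carrier A" "j \<le> 4"
  shows "char_coeff B A 4 j a \<in> carrier B" "esym T 4 j (\<lambda>k. tf k a) \<in> carrier T"
proof -
  show "char_coeff B A 4 j a \<in> carrier B"
    using assms by (simp add: char_coeff_trunc A.R.esym_closed coord_closed)
  have "(\<lambda>k. tf k a) \<in> {..<4} \<rightarrow> carrier T" using tf_closed[OF _ assms(1)] by simp
  then show "esym T 4 j (\<lambda>k. tf k a) \<in> carrier T" by (rule TP.T.esym_closed)
qed

lemma relator_closed: "a \<in> carrier A \<Longrightarrow> j \<le> 4 \<Longrightarrow> relator j a \<in> carrier T"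
  unfolding relator_def using relator_parts_closed[of a j] by simp

lemma Sn_generators_closed: "Sn_generators B A 4 \<subseteq> carrier T"
  unfolding Sn_generators_relators using relator_closed by blast

lemma relator_in_ideal_iff:
  assumes K: "ideal K T" and a: "a \<in> carrier A" and j: "j \<le> 4"
  shows "relator j a \<in> K \<longleftrightarrow> char_coeff B A 4 j a \<odot>\<^bsub>quot_algebra T K\<^esub> \<one>\<^bsub>quot_algebra T K\<^esub>
    = esym (quot_algebra T K) 4 j (\<lambda>k. (quot_map T K \<circ> tf k) a)"
proof -
  note hom = alg_homD[OF quot_map_alg_hom[OF TP.T.algebra_axioms K]]
  note cl = relator_parts_closed[OF a j]
  have "relator j a \<in> K \<longleftrightarrow> quot_map T K (char_coeff B A 4 j a \<odot>\<^bsub>T\<^esub> \<one>\<^bsub>T\<^esub>) = quot_map T K (esym T 4 j (\<lambda>k. tf k a))"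
    unfolding relator_def using cl by (subst quot_map_eq_iff[OF TP.T.algebra_axioms K]) simp_all
  also have "quot_map T K (char_coeff B A 4 j a \<odot>\<^bsub>T\<^esub> \<one>\<^bsub>T\<^esub>)
      = char_coeff B A 4 j a \<odot>\<^bsub>quot_algebra T K\<^esub> \<one>\<^bsub>quot_algebra T K\<^esub>"
    using cl by (simp add: hom)
  also have "quot_map T K (esym T 4 j (\<lambda>k. tf k a)) = esym (quot_algebra T K) 4 j (\<lambda>k. (quot_map T K \<circ> tf k) a)"
  proof -
    have "(\<lambda>k. tf k a) \<in> {..<4} \<rightarrow> carrier T" using tf_closed[OF _ a] by simp
    from quot_esym[OF K this] show ?thesis by (simp only: comp_def)
  qed
  finally show ?thesis .
qed

lemma Sn_generators_subset_iff:
  assumes K: "ideal K T"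
  shows "Sn_generators B A 4 \<subseteq> K \<longleftrightarrow>
    conjugate_family.generic_relations B A (quot_algebra T K) (\<lambda>k. quot_map T K \<circ> tf k)"
  unfolding Sn_generators_relators conjugate_family.generic_relations_def[OF quot_conjugate_family[OF K]]
  using relator_in_ideal_iff[OF K] by blast

text \<open>In the quotient by \<open>K\<close> the conjugates satisfy the relations in degrees one and two, hence all of them.\<close>

lemma Sn_generators_subset_if:
  assumes K: "ideal K T"
    and e1: "\<And>i. 0 < i \<Longrightarrow> i < 4 \<Longrightarrow> esym T 4 1 (CT.X i) \<in> K"
    and e2: "\<And>i. 0 < i \<Longrightarrow> i < 4 \<Longrightarrow> esym T 4 2 (CT.X i) \<in> K"
  shows "Sn_generators B A 4 \<subseteq> K"
proof -
  interpret Q: conjugate_family B A u coord "quot_algebra T K" "\<lambda>k. quot_map T K \<circ> tf k"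
    by (rule quot_conjugate_family[OF K])
  have X: "Q.X i = quot_map T K \<circ> CT.X i" for i
    by (simp add: fun_eq_iff Q.X_def CT.X_def)
  have Xf: "CT.X i \<in> {..<4} \<rightarrow> carrier T" if "i < 4" for i using CT.X_closed that by auto
  have "esym (quot_algebra T K) 4 j (Q.X i) = \<zero>\<^bsub>quot_algebra T K\<^esub>"
    if "0 < i" "i < 4" "esym T 4 j (CT.X i) \<in> K" for i j
    using that Xf[OF that(2)] quot_map_zero_iff[OF TP.T.algebra_axioms K]
    by (simp add: X quot_esym[OF K, symmetric] TP.T.esym_closed)
  then have "four_conjugates (quot_algebra T K) Q.X"
    by unfold_locales (simp_all add: Q.X_closed Q.X_0 Q.X_mult e1 e2)
  then show ?thesis
    using Q.generic_if_four_conjugates Sn_generators_subset_iff[OF K] by simp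
qed

text \<open>By the preceding lemma only \<open>e\<^sub>1\<close> and \<open>e\<^sub>2\<close> of the variables have to be tested, and they are multiplied only by monomials.
Multiplication by a conjugate fills a free place of the monomial or gives zero, so the claim becomes
\<open>reduce4_e1\<close> and \<open>reduce4_e2\<close>.\<close>

lemma form_kills_Sn_ideal:
  assumes g: "\<And>a b c. g a b c \<in> carrier B" and l: "linear_form B T l"
    and l_mon: "\<And>a b c d. \<lbrakk>a < 4; b < 4; c < 4; d < 4\<rbrakk> \<Longrightarrow> l (mon4 a b c d) = reduce4 B g a b c d"
    and x: "x \<in> Idl\<^bsub>T\<^esub> (Sn_generators B A 4)"
  shows "l x = \<zero>"
proof -
  let ?K = "{x \<in> carrier T. \<forall>h\<in>carrier T. l (h \<otimes>\<^bsub>T\<^esub> x) = \<zero>}"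
  have K: "ideal ?K T" by (rule TP.T.form_annihilator_ideal[OF l])
  note lD = linear_formD[OF l] TP.T.linear_form_simps(1)[OF l]
  have K_I: "y \<in> ?K" if y: "y \<in> carrier T"
    and mon: "\<And>a b c d. \<lbrakk>a < 4; b < 4; c < 4; d < 4\<rbrakk> \<Longrightarrow> l (mon4 a b c d \<otimes>\<^bsub>T\<^esub> y) = \<zero>" for y
  proof -
    have "h \<in> {h \<in> carrier T. l (h \<otimes>\<^bsub>T\<^esub> y) = \<zero>}" if "h \<in> carrier T" for h
      by (rule tensor_power_mon4_induct[OF TP.T.form_annihilator_submodule[OF l y] _ that])
        (simp add: mon mon4_closed)
    then show ?thesis using y by blast
  qed
  have "Sn_generators B A 4 \<subseteq> ?K"
  proof (rule Sn_generators_subset_if[OF K])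
    fix i :: nat assume i: "0 < i" "i < 4"
    define p where "p k = tf k (u i)" for k
    have X: "CT.X i = p" by (simp add: fun_eq_iff CT.X_def p_def)
    have p: "p 0 \<in> carrier T" "p 1 \<in> carrier T" "p 2 \<in> carrier T" "p 3 \<in> carrier T"
      unfolding p_def using i by (simp_all add: tf_closed u_closed)
    note mm = mon4_mult[OF _ _ _ _ i, folded p_def]
    have l_if: "l (if P then y else \<zero>\<^bsub>T\<^esub>) = (if P then l y else \<zero>)" for P y
      by (simp add: lD)
    show "esym T 4 1 (CT.X i) \<in> ?K" unfolding X
    proof (rule K_I)
      show "esym T 4 1 p \<in> carrier T" using p by (simp add: TP.T.esym_4)
      fix a b c d :: nat assume abcd: "a < 4" "b < 4" "c < 4" "d < 4"
      have m: "mon4 a b c d \<in> carrier T" using abcd by (rule mon4_closed)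
      have "l (mon4 a b c d \<otimes>\<^bsub>T\<^esub> esym T 4 1 p) = l (mon4 a b c d \<otimes>\<^bsub>T\<^esub> p 0) \<oplus> l (mon4 a b c d \<otimes>\<^bsub>T\<^esub> p 1)
          \<oplus> l (mon4 a b c d \<otimes>\<^bsub>T\<^esub> p 2) \<oplus> l (mon4 a b c d \<otimes>\<^bsub>T\<^esub> p 3)"
        using p m by (simp add: TP.T.esym_4 TP.T.r_distr lD)
      also have "\<dots> = (if a = 0 then reduce4 B g i b c d else \<zero>) \<oplus> (if b = 0 then reduce4 B g a i c d else \<zero>) \<oplus>
          (if c = 0 then reduce4 B g a b i d else \<zero>) \<oplus> (if d = 0 then reduce4 B g a b c i else \<zero>)"
        using abcd i by (simp only: mm[OF abcd] l_if l_mon)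
      also have "\<dots> = \<zero>" by (rule A.R.reduce4_e1[OF g abcd i])
      finally show "l (mon4 a b c d \<otimes>\<^bsub>T\<^esub> esym T 4 1 p) = \<zero>" .
    qed
    show "esym T 4 2 (CT.X i) \<in> ?K" unfolding X
    proof (rule K_I)
      show "esym T 4 2 p \<in> carrier T" using p by (simp add: TP.T.esym_4)
      fix a b c d :: nat assume abcd: "a < 4" "b < 4" "c < 4" "d < 4"
      let ?m = "mon4 a b c d"
      have m: "?m \<in> carrier T" using abcd by (rule mon4_closed)
      have z: "\<zero>\<^bsub>T\<^esub> \<otimes>\<^bsub>T\<^esub> p k = \<zero>\<^bsub>T\<^esub>" if "k < 4" for k
        using that i by (simp add: p_def tf_closed u_closed)
      have expand: "?m \<otimes>\<^bsub>T\<^esub> esym T 4 2 p = (?m \<otimes>\<^bsub>T\<^esub> p 0 \<otimes>\<^bsub>T\<^esub> p 1) \<oplus>\<^bsub>T\<^esub> ((?m \<otimes>\<^bsub>T\<^esub> p 2 \<otimes>\<^bsub>T\<^esub> p 0) \<oplus>\<^bsub>T\<^esub> (?m \<otimes>\<^bsub>T\<^esub> p 2 \<otimes>\<^bsub>T\<^esub> p 1))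
          \<oplus>\<^bsub>T\<^esub> ((?m \<otimes>\<^bsub>T\<^esub> p 3 \<otimes>\<^bsub>T\<^esub> p 0) \<oplus>\<^bsub>T\<^esub> (?m \<otimes>\<^bsub>T\<^esub> p 3 \<otimes>\<^bsub>T\<^esub> p 1) \<oplus>\<^bsub>T\<^esub> (?m \<otimes>\<^bsub>T\<^esub> p 3 \<otimes>\<^bsub>T\<^esub> p 2))"
        using p m by (simp add: TP.T.esym_4 TP.T.r_distr TP.T.m_assoc)
      have split: "l (?m \<otimes>\<^bsub>T\<^esub> esym T 4 2 p) = l (?m \<otimes>\<^bsub>T\<^esub> p 0 \<otimes>\<^bsub>T\<^esub> p 1) \<oplus> (l (?m \<otimes>\<^bsub>T\<^esub> p 2 \<otimes>\<^bsub>T\<^esub> p 0) \<oplus> l (?m \<otimes>\<^bsub>T\<^esub> p 2 \<otimes>\<^bsub>T\<^esub> p 1))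
          \<oplus> (l (?m \<otimes>\<^bsub>T\<^esub> p 3 \<otimes>\<^bsub>T\<^esub> p 0) \<oplus> l (?m \<otimes>\<^bsub>T\<^esub> p 3 \<otimes>\<^bsub>T\<^esub> p 1) \<oplus> l (?m \<otimes>\<^bsub>T\<^esub> p 3 \<otimes>\<^bsub>T\<^esub> p 2))"
        unfolding expand by (simp only: lD(2) p m TP.T.m_closed TP.T.a_closed)
      have v1: "l (?m \<otimes>\<^bsub>T\<^esub> p 0 \<otimes>\<^bsub>T\<^esub> p 1) = (if a = 0 \<and> b = 0 then reduce4 B g i i c d else \<zero>)"
        using abcd i by (cases "a = 0"; cases "b = 0") (simp_all add: mm z lD l_mon)
      have v2: "l (?m \<otimes>\<^bsub>T\<^esub> p 2 \<otimes>\<^bsub>T\<^esub> p 0) = (if a = 0 \<and> c = 0 then reduce4 B g i b i d else \<zero>)"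
        using abcd i by (cases "a = 0"; cases "c = 0") (simp_all add: mm z lD l_mon)
      have v3: "l (?m \<otimes>\<^bsub>T\<^esub> p 2 \<otimes>\<^bsub>T\<^esub> p 1) = (if b = 0 \<and> c = 0 then reduce4 B g a i i d else \<zero>)"
        using abcd i by (cases "b = 0"; cases "c = 0") (simp_all add: mm z lD l_mon)
      have v4: "l (?m \<otimes>\<^bsub>T\<^esub> p 3 \<otimes>\<^bsub>T\<^esub> p 0) = (if a = 0 \<and> d = 0 then reduce4 B g i b c i else \<zero>)"
        using abcd i by (cases "a = 0"; cases "d = 0") (simp_all add: mm z lD l_mon)
      have v5: "l (?m \<otimes>\<^bsub>T\<^esub> p 3 \<otimes>\<^bsub>T\<^esub> p 1) = (if b = 0 \<and> d = 0 then reduce4 B g a i c i else \<zero>)"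
        using abcd i by (cases "b = 0"; cases "d = 0") (simp_all add: mm z lD l_mon)
      have v6: "l (?m \<otimes>\<^bsub>T\<^esub> p 3 \<otimes>\<^bsub>T\<^esub> p 2) = (if c = 0 \<and> d = 0 then reduce4 B g a b i i else \<zero>)"
        using abcd i by (cases "c = 0"; cases "d = 0") (simp_all add: mm z lD l_mon)
      show "l (?m \<otimes>\<^bsub>T\<^esub> esym T 4 2 p) = \<zero>"
        unfolding split v1 v2 v3 v4 v5 v6 by (rule A.R.reduce4_e2[OF g abcd i])
    qed
  qed
  then have "Idl\<^bsub>T\<^esub> (Sn_generators B A 4) \<subseteq> ?K" by (rule TP.T.genideal_minimal[OF K])
  then have "x \<in> carrier T" "l (\<one>\<^bsub>T\<^esub> \<otimes>\<^bsub>T\<^esub> x) = \<zero>" using x TP.T.one_closed by blast+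
  then show ?thesis by simp
qed

text \<open>The normal monomials span by \<open>mon_reduce4\<close>. Their dual forms are the reductions of the indicators of normal monomials.\<close>

theorem Sn_closure_free: "free_of_rank B (Sn_closure B A 4) 32"
proof -
  define I where "I = Idl\<^bsub>T\<^esub> (Sn_generators B A 4)"
  define G where "G = quot_algebra T I"
  have closure: "Sn_closure B A 4 = G" by (simp add: Sn_closure_def G_def I_def)
  have I: "ideal I T" unfolding I_def by (rule TP.T.genideal_ideal[OF Sn_generators_closed])
  let ?\<pi> = "quot_map T I"
  have hom: "?\<pi> \<in> alg_hom B T G" unfolding G_def by (rule quot_map_alg_hom[OF TP.T.algebra_axioms I])
  note homD = alg_homD[OF hom]
  interpret Q: conjugate_family B A u coord G "\<lambda>k. ?\<pi> \<circ> tf k"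
    unfolding G_def by (rule quot_conjugate_family[OF I])
  have "Sn_generators B A 4 \<subseteq> I" unfolding I_def by (rule TP.T.genideal_self[OF Sn_generators_closed])
  then have "Q.generic_relations" using Sn_generators_subset_iff[OF I] unfolding G_def by simp
  then interpret F: four_conjugates G Q.X by (rule Q.four_conjugates_if_generic)
  have \<pi>_mon4: "?\<pi> (mon4 a b c d) = F.mon a b c \<otimes>\<^bsub>G\<^esub> Q.X d 3"
    if "a < 4" "b < 4" "c < 4" "d < 4" for a b c d
    using that by (simp add: mon4_def F.mon_def Q.X_def homD tf_closed u_closed)
  have mon_\<pi>: "F.mon a b c = ?\<pi> (mon4 a b c 0)" if "a < 4" "b < 4" "c < 4" for a b c
    using that F.mon_closed[OF that] by (simp add: \<pi>_mon4 Q.X_0)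
  define e where "e i = (case normal_list ! i of (a, b, c) \<Rightarrow> F.mon a b c)" for i
  have nth: "\<exists>a b c. normal_list ! i = (a, b, c) \<and> a < 4 \<and> b < 4 \<and> c < 4 \<and> normal_monomial a b c"
    if "i < 32" for i
  proof -
    obtain a b c where abc: "normal_list ! i = (a, b, c)" by (cases "normal_list ! i") auto
    then have "(a, b, c) \<in> set normal_list" using that by (metis length_normal_list nth_mem)
    then show ?thesis using abc by (simp add: set_normal_list)
  qed
  have ec: "e \<in> {..<32} \<rightarrow> carrier G"
  proof
    fix i :: nat assume "i \<in> {..<32}"
    then obtain a b c where "normal_list ! i = (a, b, c)" "a < 4" "b < 4" "c < 4" using nth by blast
    then show "e i \<in> carrier G" by (simp add: e_def F.mon_closed)
  qed
  have "is_basis B G 32 e"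
  proof (rule is_basisI[OF Q.C.module ec])
    fix v assume v: "v \<in> carrier G"
    define N where "N = {\<Oplus>\<^bsub>G\<^esub>i\<in>{..<32}. c i \<odot>\<^bsub>G\<^esub> e i | c. c \<in> {..<32} \<rightarrow> carrier B}"
    have N: "submodule N B G" unfolding N_def by (rule Q.C.span_submodule(1)[OF ec])
    note Ncl = Q.C.submoduleE[OF N]
    have eN: "e i \<in> N" if "i < 32" for i unfolding N_def by (rule Q.C.span_submodule(2)[OF ec that])
    have zeroN: "\<zero>\<^bsub>G\<^esub> \<in> N"
    proof -
      have "\<zero> \<odot>\<^bsub>G\<^esub> e 0 \<in> N" using eN[of 0] Ncl(4) by simp
      moreover have "e 0 \<in> carrier G" using ec by auto
      ultimately show ?thesis by simp
    qed
    have normalN: "F.mon a b c \<in> N" if abc: "a < 4" "b < 4" "c < 4" "normal_monomial a b c" for a b c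
    proof -
      have "(a, b, c) \<in> set normal_list" using abc by (simp add: set_normal_list)
      then obtain i where "i < 32" "normal_list ! i = (a, b, c)"
        by (metis in_set_conv_nth length_normal_list)
      then show ?thesis using eN[of i] by (simp add: e_def)
    qed
    have reduce3N: "reduce3 G F.mon a b c \<in> N" if abc: "a < 4" "b < 4" "c < 4" for a b c
    proof -
      have top: "F.mon 1 2 3 \<in> N" by (rule normalN) (simp_all add: normal_monomial_def)
      have low: "F.mon x y 0 \<in> N" "F.mon x 0 y \<in> N" if "x < 4" "y < 4" for x y
        using that by (simp_all add: normalN normal_monomial_def)
      show ?thesis
      proof (cases "normal_monomial a b c")
        case True
        then show ?thesis using normalN[OF abc] by (simp add: reduce3_def)
      next
        case False
        have tail: "F.mon 0 c b \<in> N" if "a = 0" "b \<noteq> c"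
        proof (rule normalN)
          show "normal_monomial 0 c b" using that False by (auto simp: normal_monomial_def)
        qed (use abc in simp_all)
        have pair: "\<ominus>\<^bsub>G\<^esub> (F.mon x x 0 \<oplus>\<^bsub>G\<^esub> F.mon x 0 x) \<in> N" if "x < 4" for x
          by (intro Ncl(3,5) low that)
        have five: "\<ominus>\<^bsub>G\<^esub> (F.mon c b 0 \<oplus>\<^bsub>G\<^esub> F.mon c 0 b \<oplus>\<^bsub>G\<^esub> F.mon b c 0 \<oplus>\<^bsub>G\<^esub> F.mon 0 c b \<oplus>\<^bsub>G\<^esub> F.mon b 0 c) \<in> N"
          if "a = 0" "b \<noteq> c"
          by (intro Ncl(3,5) low abc tail that)
        show ?thesis
          unfolding reduce3_def using False pair[OF abc(2)] pair[OF abc(3)] five Ncl(3)[OF top] top zeroN by (simp split: if_split)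
      qed
    qed
    have reduce4N: "reduce4 G F.mon a b c d \<in> N" if abcd: "a < 4" "b < 4" "c < 4" "d < 4" for a b c d
    proof -
      have "(if P then reduce3 G F.mon x y z else \<zero>\<^bsub>G\<^esub>) \<in> N" if "x < 4" "y < 4" "z < 4" for P x y z
        using reduce3N[OF that] zeroN by simp
      then have "\<ominus>\<^bsub>G\<^esub> ((if a = 0 then reduce3 G F.mon d b c else \<zero>\<^bsub>G\<^esub>) \<oplus>\<^bsub>G\<^esub>
          (if b = 0 then reduce3 G F.mon a d c else \<zero>\<^bsub>G\<^esub>) \<oplus>\<^bsub>G\<^esub>
          (if c = 0 then reduce3 G F.mon a b d else \<zero>\<^bsub>G\<^esub>)) \<in> N"
        using abcd by (intro Ncl(3,5))
      then show ?thesis unfolding reduce4_def using reduce3N[OF abcd(1-3)] by simp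
    qed
    have pre: "submodule {x \<in> carrier T. ?\<pi> x \<in> N} B T"
      by (rule alg_hom_preimage_submodule[OF TP.T.algebra_axioms Q.C.algebra_axioms hom N])
    obtain x where x: "x \<in> carrier T" "v = ?\<pi> x"
      using v quot_map_surj[OF TP.T.algebra_axioms I] unfolding G_def by blast
    have "x \<in> {x \<in> carrier T. ?\<pi> x \<in> N}"
      by (rule tensor_power_mon4_induct[OF pre _ x(1)])
        (simp add: mon4_closed \<pi>_mon4 F.mon_reduce4 reduce4N)
    then show "\<exists>c\<in>{..<32} \<rightarrow> carrier B. v = (\<Oplus>\<^bsub>G\<^esub>i\<in>{..<32}. c i \<odot>\<^bsub>G\<^esub> e i)"
      unfolding x(2) N_def by blast
  next
    fix k :: nat assume k: "k < 32"
    define g where "g a b c = (if (a, b, c) = normal_list ! k then \<one> else \<zero>)" for a b c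
    have g: "g a b c \<in> carrier B" for a b c by (simp add: g_def)
    have red: "reduce4 B g a b c d \<in> carrier B" for a b c d by (rule A.R.reduce4_closed) (rule g)
    obtain l where l: "linear_form B T l"
      "\<And>a b c d. \<lbrakk>a < 4; b < 4; c < 4; d < 4\<rbrakk> \<Longrightarrow> l (mon4 a b c d) = reduce4 B g a b c d"
      using form_on_mon4[of "reduce4 B g", OF red] by blast
    have "l x = \<zero>" if "x \<in> I" for x
      using form_kills_Sn_ideal[OF g l] that unfolding I_def by blast
    from linear_form_quot[OF TP.T.algebra_axioms I l(1) this, folded G_def]
    obtain l' where l': "linear_form B G l'" "\<And>x. x \<in> carrier T \<Longrightarrow> l' (?\<pi> x) = l x" by blast
    have "l' (e i) = (if i = k then \<one> else \<zero>)" if i: "i < 32" for i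
    proof -
      obtain a b c where abc: "normal_list ! i = (a, b, c)" "a < 4" "b < 4" "c < 4" "normal_monomial a b c"
        using nth[OF i] by blast
      have "l' (e i) = l (mon4 a b c 0)" using abc by (simp add: e_def mon_\<pi> l' mon4_closed)
      also have "\<dots> = g a b c" using abc l(2)[of a b c 0] by (simp add: reduce4_def reduce3_def)
      also have "\<dots> = (if i = k then \<one> else \<zero>)"
        unfolding g_def abc(1)[symmetric]
        using nth_eq_iff_index_eq[OF distinct_normal_list] i k by (simp add: length_normal_list)
      finally show ?thesis .
    qed
    then show "\<exists>l. linear_form B G l \<and> (\<forall>i<32. l (e i) = (if i = k then \<one> else \<zero>))"
      using l'(1) by blast
  qed
  then show ?thesis
    unfolding free_of_rank_def closure using Q.C.module by blast
qed

end

theorem proposition19: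
  fixes B :: "('b, 'm) ring_scheme"
  assumes "cring B"
  shows "free_of_rank B (trunc_xyz B) 4 \<and> free_of_rank B (Sn_closure B (trunc_xyz B) 4) 32"
proof -
  interpret poly_xyz_ring B using assms by (simp add: poly_xyz_ring_def)
  obtain coord where "square_zero_algebra B (trunc_xyz B) u_xyz coord"
    using trunc_square_zero by blast
  then interpret S: square_zero_algebra B "trunc_xyz B" u_xyz coord .
  show ?thesis
    using S.Sn_closure_free S.u_basis algebra.module[OF trunc_algebra] unfolding free_of_rank_def by blast
qed

end
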